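(* Let $A=kQ/I$ be a monomial algebra such that $\dim_k e_iAe_j=1$ whenever there exists an arrow $\alpha:i\to j$ in $Q_1$. Then for every arrow $\alpha\in Q_1$, every $n\ge0$, every $A$-bimodule map $f: A\otimes kAP_n\otimes A\to A$ and every $w\in AP_n$, $$[\delta_\alpha,f](1\otimes w\otimes1)=\big(C(\alpha,f(1\otimes w\otimes1))-C(\alpha,w)\big)\,f(1\otimes w\otimes1).$$
   Context: **Setting.** $k$ is a field, $Q$ a finite quiver with vertices $Q_0$, arrows $Q_1$, source and target maps $s,t$. Paths are written left to right: $\alpha_1\cdots\alpha_l$ with $t(\alpha_i)=s(\alpha_{i+1})$; $|w|$ is the length of $w$; $e_x$ is the trivial path at $x$. $I\subset kQ$ is a two-sided ideal generated by paths such that $J^m\subseteq I\subseteq J^2$ for some $m\ge 2$, where $J$ is the ideal generated by the arrows; $A=kQ/I$. $\mathcal R$ is the minimal set of paths (of minimal length) generating $I$, i.e. the paths in $I$ no proper subpath of which lies in $I$. $\mathcal P$ is the set of paths not in $I$; its classes form a $k$-basis of $A$. $E=kQ_0$, and all $\otimes$ are over $E$. **Counting.** For a path $v=\alpha_1\cdots\alpha_s$ with $\alpha_i\in Q_1$, $C(\alpha,v)=|\{i:\alpha_i=\alpha\}|$ (and $0$ for trivial $v$); this is extended by linearity to a map $C(\alpha,-):A\to k$. The bimodule map $\delta_\alpha:A\otimes kQ_1\otimes A\to A$ is given by $\delta_\alpha(1\otimes\alpha\otimes1)=\alpha$ and $\delta_\alpha(1\otimes\beta\otimes1)=0$ for arrows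 $\beta\ne\alpha$. (Under the dimension hypothesis the classes of the $\delta_\alpha$ are known to generate $\mathrm{HH}^1(A)$, so the formula describes the action of the Lie algebra $\mathrm{HH}^1(A)$ on $\mathrm{HH}^*(A)$.) **Positions.** Subpaths of a path $T$ are regarded as occurrences in $T$; $s(p),t(p)$ denote starting and ending positions on $T$, compared in the order along $T$. If $p$ is a subpath of $T$ we write $T=L(p)\,p\,R(p)$. $\mathcal R(T)$ is the set of (occurrences of) paths of $\mathcal R$ in $T$. **The sets $AP_n$.** $AP_0=Q_0$, $AP_1=Q_1$. For $n\ge2$, $AP_n$ is the set of supports of $n$-concatenations $(p_1,\dots,p_{n-1})$: for a path $T$, $p_1\in\mathcal R(T)$; $p_2\in L_1=\{p\in\mathcal R(T): s(p_1)<s(p)<t(p_1)\}$ with $s(p_2)$ minimal in $L_1$; and for $j\ge2$, $p_{j+1}\in L_{j+1}=\{p\in\mathcal R(T): t(p_{j-1})\le s(p)<t(p_j)\}$ with $s(p_{j+1})$ minimal in $L_{j+1}$. The support is the path along $T$ from $s(p_1)$ to $t(p_{n-1})$. For $w\in AP_n$, $\mathrm{Sub}(w)$ is the set of (occurrences of) elements of $AP_{n-1}$ that are subpaths of $w$. **The maps $F_n: A\otimes kAP_n\otimes A\to A^{\otimes(n+2)}$** (bimodule maps). $F_0(1\otimes e\otimes1)=e\otimes1$, $F_1(1\otimes\alpha\otimes1)=1\otimes\alpha\otimes1$, and for $n\ge2$, $w\in AP_n$, with $\mathrm{Sub}(w)=\{\zeta_1,\dots,\zeta_m\}$, $s(\zeta_1)<\cdots<s(\zeta_m)$,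 $w=L_i\zeta_iR_i$, $F_n(1\otimes w\otimes1)=\sum_{i=1}^{m-1}1\otimes L_{i+1}F_{n-1}(1\otimes\zeta_{i+1}\otimes1)R_{i+1}$. **The maps $G_n: A^{\otimes(n+2)}\to A\otimes kAP_n\otimes A$** (bimodule maps). A sequence $(v_1,\dots,v_n)\in\mathcal P^n$ is well-concatenated if $t(v_i)=s(v_{i+1})$ for all $i<n$; $\mathcal M_{odd}=\{j: v_{2j-1}v_{2j}\notin I\}$, $\mathcal M_{even}=\{j: v_{2j}v_{2j+1}\notin I\}$; it is good if $n$ is even and $\mathcal M_{odd}=\emptyset$, or $n$ is odd and $\mathcal M_{even}=\emptyset$, and bad otherwise. $\chi(v_1,\dots,v_n)$ is the set of (occurrences of) $w\in AP_n$ with $v_1\cdots v_n=L(w)wR(w)$. $G_0(1\otimes1)=\sum_{i\in Q_0}1\otimes e_i\otimes1$; $G_1(1\otimes v\otimes1)=\sum_{i=1}^s\alpha_1\cdots\alpha_{i-1}\otimes\alpha_i\otimes\alpha_{i+1}\cdots\alpha_s$ for $v=\alpha_1\cdots\alpha_s$, $s\ge1$, and $0$ if $|v|=0$. For $n\ge2$, $G_n(1\otimes v_1\otimes\cdots\otimes v_n\otimes1)=0$ if the sequence is bad or $\chi=\emptyset$; otherwise it is $L(w_1)\otimes w_1\otimes R(w_1)$ with $w_1\in\chi(v_1,\dots,v_n)$ of minimal $s(w_1)$ if $n$ is even, and $\sum L(w)\otimes w\otimes R(w)$ over $w\in\chi(v_1,\dots,v_n)$ with $s(v_1)\le s(w)<t(v_1)$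 if $n$ is odd. **Bracket.** Write $F^n(h)=h\circ F_n$ and $G^n(f)=f\circ G_n$. For bimodule maps $f:A^{\otimes(n+2)}\to A$, $g:A^{\otimes(m+2)}\to A$ and $1\le i\le n$, $(f\circ_ig)(1\otimes v_1\otimes\cdots\otimes v_{n+m-1}\otimes1)=f(1\otimes v_1\otimes\cdots\otimes v_{i-1}\otimes g(1\otimes v_i\otimes\cdots\otimes v_{i+m-1}\otimes1)\otimes v_{i+m}\otimes\cdots\otimes v_{n+m-1}\otimes1)$. For bimodule maps $f:A\otimes kAP_n\otimes A\to A$ and $g:A\otimes kAP_m\otimes A\to A$, $f\circ_ig=F^{n+m-1}(G^n(f)\circ_iG^m(g))$, $f\circ g=\sum_{i=1}^n(-1)^{(i-1)(m-1)}f\circ_ig$, and $[f,g]=f\circ g-(-1)^{(n-1)(m-1)}g\circ f$.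
   Formalization: As stated the formula fails (f=2δ_α on the quiver 1→2): its right side is quadratic in f. For x=f(1⊗w⊗1)=Σc_v v it is proved as Σc_v(C(α,v)−C(α,w))v for every f, and literally when x is 0 or the class of a path in 𝒫. *)

theory Defs
  imports
    "HOL-Library.Poly_Mapping"
    "HOL-Algebra.Ideal_Product"
    "HOL-Algebra.QuotRing"
    "Graph_Theory.Arc_Walk"
begin

section \<open>Finitely supported linear combinations\<close>

definition cscale :: "'k::field \<Rightarrow> ('x \<Rightarrow>\<^sub>0 'k) \<Rightarrow> ('x \<Rightarrow>\<^sub>0 'k)" where
  "cscale c x = Poly_Mapping.map ((*) c) x"

definition bas :: "'x \<Rightarrow> ('x \<Rightarrow>\<^sub>0 'k::field)" where
  "bas v = Poly_Mapping.single v 1"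

definition lin_ext :: "('x \<Rightarrow> ('y \<Rightarrow>\<^sub>0 'k)) \<Rightarrow> ('x \<Rightarrow>\<^sub>0 'k::field) \<Rightarrow> ('y \<Rightarrow>\<^sub>0 'k)" where
  "lin_ext \<phi> x = (\<Sum>v\<in>Poly_Mapping.keys x. cscale (Poly_Mapping.lookup x v) (\<phi> v))"


section \<open>Quivers, paths and the path algebra\<close>

text \<open>
  A finite quiver is a \<open>fin_digraph\<close>: multiple arrows and loops are allowed.  A path is its
  starting vertex together with its list of arrows, in the order of travel; the starting vertex
  is needed for the trivial paths.
\<close>

type_synonym ('a, 'b) qpath = "'a \<times> 'b list"

context pre_digraph
begin

definition src :: "('a, 'b) qpath \<Rightarrow> 'a" where
  "src p = fst p"

definition trg :: "('a, 'b) qpath \<Rightarrow> 'a" where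
  "trg p = awlast (fst p) (snd p)"

definition paths :: "('a, 'b) qpath set" where
  "paths = {p. awalk (src p) (snd p) (trg p)}"

definition plen :: "('a, 'b) qpath \<Rightarrow> nat" where
  "plen p = length (snd p)"

definition pcat :: "('a, 'b) qpath \<Rightarrow> ('a, 'b) qpath \<Rightarrow> ('a, 'b) qpath" where
  "pcat p q = (src p, snd p @ snd q)"

definition trivial :: "'a \<Rightarrow> ('a, 'b) qpath" where
  "trivial x = (x, [])"

definition arrow :: "'b \<Rightarrow> ('a, 'b) qpath" where
  "arrow \<beta> = (tail G \<beta>, [\<beta>])"

text \<open>The subpath of \<open>T\<close> between the positions \<open>i \<le> j\<close>, where \<open>0 \<le> i \<le> j \<le> |T|\<close>.\<close>

definition segment :: "('a, 'b) qpath \<Rightarrow> nat \<Rightarrow> nat \<Rightarrow> ('a, 'b) qpath" where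
  "segment T i j = (awalk_verts (fst T) (snd T) ! i, drop i (take j (snd T)))"

text \<open>
  An occurrence in \<open>T\<close> of a path from \<open>X\<close> is the pair of its starting and its ending position.
\<close>

definition occs :: "('a, 'b) qpath set \<Rightarrow> ('a, 'b) qpath \<Rightarrow> (nat \<times> nat) set" where
  "occs X T = {(i, j). i \<le> j \<and> j \<le> plen T \<and> segment T i j \<in> X}"

definition path_mult :: "('a, 'b) qpath \<Rightarrow> ('a, 'b) qpath \<Rightarrow> (('a, 'b) qpath \<Rightarrow>\<^sub>0 'k::field)" where
  "path_mult p q = (if trg p = src q then bas (pcat p q) else 0)"

definition path_algebra :: "(('a, 'b) qpath \<Rightarrow>\<^sub>0 'k::field) ring" where
  "path_algebra = \<lparr>
     carrier = {x. Poly_Mapping.keys x \<subseteq> paths},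
     mult = (\<lambda>x y. lin_ext (\<lambda>p. lin_ext (\<lambda>q. path_mult p q) y) x),
     one = (\<Sum>x\<in>verts G. bas (trivial x)),
     zero = 0,
     add = (+)\<rparr>"

definition arrow_ideal :: "(('a, 'b) qpath \<Rightarrow>\<^sub>0 'k::field) set" where
  "arrow_ideal = Idl\<^bsub>path_algebra\<^esub> ((\<lambda>\<beta>. bas (arrow \<beta>)) ` arcs G)"

primrec arrow_ideal_power :: "nat \<Rightarrow> (('a, 'b) qpath \<Rightarrow>\<^sub>0 'k::field) set" where
  "arrow_ideal_power 0 = carrier path_algebra"
| "arrow_ideal_power (Suc m) = ideal_prod path_algebra (arrow_ideal_power m) arrow_ideal"

definition arrow_count :: "'b \<Rightarrow> ('a, 'b) qpath \<Rightarrow> nat" where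
  "arrow_count \<alpha> v = count_list (snd v) \<alpha>"

definition composable :: "('a, 'b) qpath list \<Rightarrow> bool" where
  "composable vs \<longleftrightarrow> (\<forall>i. Suc i < length vs \<longrightarrow> trg (vs ! i) = src (vs ! Suc i))"

definition pconcat :: "('a, 'b) qpath list \<Rightarrow> ('a, 'b) qpath" where
  "pconcat vs = (src (hd vs), concat (map snd vs))"


section \<open>Tensor products over \<open>E = kQ\<^sub>0\<close>\<close>

text \<open>
  All \<open>E\<close>-bimodules that occur below are spanned by a set of paths.  If \<open>V\<^sub>i\<close> has the basis
  \<open>X\<^sub>i\<close>, then \<open>V\<^sub>1 \<otimes>\<^sub>E \<dots> \<otimes>\<^sub>E V\<^sub>N\<close> has as a basis the tensors
  \<open>v\<^sub>1 \<otimes> \<dots> \<otimes> v\<^sub>N\<close> of composable sequences with \<open>v\<^sub>i \<in> X\<^sub>i\<close>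
  (the other tensors of basis elements vanish), and it is represented by its coordinates in this
  basis.  The function \<open>pure\<close> is the universal \<open>E\<close>-balanced multilinear map
  \<open>(a\<^sub>1, \<dots>, a\<^sub>N) \<mapsto> a\<^sub>1 \<otimes> \<dots> \<otimes> a\<^sub>N\<close>; see \<open>pure_balanced_multilinear\<close> and \<open>tensor_universal\<close>
  below.
\<close>

definition tensor :: "('a, 'b) qpath set list \<Rightarrow> (('a, 'b) qpath list \<Rightarrow>\<^sub>0 'k::field) set" where
  "tensor Xs = {x. Poly_Mapping.keys x \<subseteq> {vs \<in> listset Xs. composable vs}}"

definition pure :: "(('a, 'b) qpath \<Rightarrow>\<^sub>0 'k::field) list \<Rightarrow> (('a, 'b) qpath list \<Rightarrow>\<^sub>0 'k)" where
  "pure as = (\<Sum>vs \<in> {vs \<in> listset (map Poly_Mapping.keys as). composable vs}.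
     Poly_Mapping.single vs (prod_list (map2 Poly_Mapping.lookup as vs)))"

end


section \<open>The algebra \<open>A = kQ/I\<close>\<close>

locale quiver_ideal = pre_digraph Q for Q :: "('a, 'b) pre_digraph" (structure) +
  fixes I :: "(('a, 'b) qpath \<Rightarrow>\<^sub>0 'k::field) set"
begin

definition relations :: "('a, 'b) qpath set" where
  "relations = {p \<in> paths. bas p \<in> I \<and>
     (\<forall>i j. i \<le> j \<and> j \<le> plen p \<and> (i, j) \<noteq> (0, plen p) \<longrightarrow> bas (segment p i j) \<notin> I)}"

definition nonzero_paths :: "('a, 'b) qpath set" where
  "nonzero_paths = {p \<in> paths. bas p \<notin> I}"

text \<open>
  An element of \<open>A = kQ/I\<close> is represented by its unique representative in the span of
  \<open>nonzero_paths\<close>, and \<open>nf\<close> is the quotient map; see \<open>nf_hom\<close>, \<open>nf_surj\<close>, \<open>nf_kernel\<close>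
  and \<open>quotient_iso\<close> below.
\<close>

definition nf :: "(('a, 'b) qpath \<Rightarrow>\<^sub>0 'k) \<Rightarrow> (('a, 'b) qpath \<Rightarrow>\<^sub>0 'k)" where
  "nf = lin_ext (\<lambda>v. if v \<in> nonzero_paths then bas v else 0)"

definition A :: "(('a, 'b) qpath \<Rightarrow>\<^sub>0 'k) ring" where
  "A = \<lparr>
     carrier = {x. Poly_Mapping.keys x \<subseteq> nonzero_paths},
     mult = (\<lambda>x y. nf (x \<otimes>\<^bsub>path_algebra\<^esub> y)),
     one = nf \<one>\<^bsub>path_algebra\<^esub>,
     zero = 0,
     add = (+)\<rparr>"

definition cls :: "('a, 'b) qpath \<Rightarrow> (('a, 'b) qpath \<Rightarrow>\<^sub>0 'k)" where
  "cls v = nf (bas v)"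

definition corner :: "'a \<Rightarrow> 'a \<Rightarrow> (('a, 'b) qpath \<Rightarrow>\<^sub>0 'k) set" where
  "corner i j = (\<lambda>x. cls (trivial i) \<otimes>\<^bsub>A\<^esub> x \<otimes>\<^bsub>A\<^esub> cls (trivial j)) ` carrier A"

definition lin_count :: "'b \<Rightarrow> (('a, 'b) qpath \<Rightarrow>\<^sub>0 'k) \<Rightarrow> 'k" where
  "lin_count \<alpha> x =
     (\<Sum>v\<in>Poly_Mapping.keys x. Poly_Mapping.lookup x v * of_nat (arrow_count \<alpha> v))"


section \<open>The sets \<open>AP\<^sub>n\<close>\<close>

text \<open>In \<open>n_concatenation\<close> the entry \<open>p\<^sub>j\<close> is \<open>ps ! (j - 1)\<close>, and \<open>next_rels T ps j\<close> is \<open>L\<^sub>1\<close>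
  for \<open>j = 1\<close> and \<open>L\<^bsub>j+1\<^esub>\<close> for \<open>j \<ge> 2\<close>, the set from which \<open>p\<^bsub>j+1\<^esub>\<close> is chosen.\<close>

definition next_rels :: "('a, 'b) qpath \<Rightarrow> (nat \<times> nat) list \<Rightarrow> nat \<Rightarrow> (nat \<times> nat) set" where
  "next_rels T ps j =
     (if j = 1 then {p \<in> occs relations T. fst (ps ! 0) < fst p \<and> fst p < snd (ps ! 0)}
      else {p \<in> occs relations T. snd (ps ! (j - 2)) \<le> fst p \<and> fst p < snd (ps ! (j - 1))})"

definition n_concatenation :: "nat \<Rightarrow> ('a, 'b) qpath \<Rightarrow> (nat \<times> nat) list \<Rightarrow> bool" where
  "n_concatenation n T ps \<longleftrightarrow> n \<ge> 2 \<and> length ps = n - 1 \<and> ps ! 0 \<in> occs relations T \<and>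
     (\<forall>j. 1 \<le> j \<and> j < length ps \<longrightarrow> is_arg_min fst (\<lambda>p. p \<in> next_rels T ps j) (ps ! j))"

definition AP :: "nat \<Rightarrow> ('a, 'b) qpath set" where
  "AP n =
     (if n = 0 then trivial ` verts Q
      else if n = 1 then arrow ` arcs Q
      else {segment T (fst (hd ps)) (snd (last ps)) | T ps. T \<in> paths \<and> n_concatenation n T ps})"

definition Sub :: "nat \<Rightarrow> ('a, 'b) qpath \<Rightarrow> (nat \<times> nat) set" where
  "Sub n w = occs (AP (n - 1)) w"


section \<open>Bimodules and bimodule maps\<close>

definition bardzell :: "nat \<Rightarrow> (('a, 'b) qpath list \<Rightarrow>\<^sub>0 'k) set" where
  "bardzell n = tensor [nonzero_paths, AP n, nonzero_paths]"

definition lact ::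
  "(('a, 'b) qpath \<Rightarrow>\<^sub>0 'k) \<Rightarrow> (('a, 'b) qpath list \<Rightarrow>\<^sub>0 'k) \<Rightarrow> (('a, 'b) qpath list \<Rightarrow>\<^sub>0 'k)" where
  "lact a = lin_ext (\<lambda>vs. pure ((a \<otimes>\<^bsub>A\<^esub> bas (hd vs)) # map bas (tl vs)))"

definition ract ::
  "(('a, 'b) qpath list \<Rightarrow>\<^sub>0 'k) \<Rightarrow> (('a, 'b) qpath \<Rightarrow>\<^sub>0 'k) \<Rightarrow> (('a, 'b) qpath list \<Rightarrow>\<^sub>0 'k)" where
  "ract x a = lin_ext (\<lambda>vs. pure (map bas (butlast vs) @ [bas (last vs) \<otimes>\<^bsub>A\<^esub> a])) x"

definition bimod_maps ::
  "(('a, 'b) qpath list \<Rightarrow>\<^sub>0 'k) set \<Rightarrow>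
   ((('a, 'b) qpath list \<Rightarrow>\<^sub>0 'k) \<Rightarrow> (('a, 'b) qpath \<Rightarrow>\<^sub>0 'k)) set" where
  "bimod_maps M = {f. (\<forall>x\<in>M. f x \<in> carrier A) \<and>
     (\<forall>x\<in>M. \<forall>y\<in>M. f (x + y) = f x + f y) \<and>
     (\<forall>a\<in>carrier A. \<forall>x\<in>M. f (lact a x) = a \<otimes>\<^bsub>A\<^esub> f x \<and> f (ract x a) = f x \<otimes>\<^bsub>A\<^esub> a)}"

text \<open>
  The bimodule maps, into a tensor product or into \<open>A\<close>, that take \<open>1 \<otimes> v\<^sub>1 \<otimes> \<dots> \<otimes> v\<^sub>n \<otimes> 1\<close> to
  \<open>\<phi> [v\<^sub>1, \<dots>, v\<^sub>n]\<close>: the basis element \<open>p \<otimes> v\<^sub>1 \<otimes> \<dots> \<otimes> v\<^sub>n \<otimes> q\<close> goes to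
  \<open>p \<cdot> \<phi> [v\<^sub>1, \<dots>, v\<^sub>n] \<cdot> q\<close>.
\<close>

definition bext_tensor ::
  "(('a, 'b) qpath list \<Rightarrow> (('a, 'b) qpath list \<Rightarrow>\<^sub>0 'k)) \<Rightarrow>
   (('a, 'b) qpath list \<Rightarrow>\<^sub>0 'k) \<Rightarrow> (('a, 'b) qpath list \<Rightarrow>\<^sub>0 'k)" where
  "bext_tensor \<phi> =
     lin_ext (\<lambda>us. lact (cls (hd us)) (ract (\<phi> (butlast (tl us))) (cls (last us))))"

definition bext_A ::
  "(('a, 'b) qpath list \<Rightarrow> (('a, 'b) qpath \<Rightarrow>\<^sub>0 'k)) \<Rightarrow>
   (('a, 'b) qpath list \<Rightarrow>\<^sub>0 'k) \<Rightarrow> (('a, 'b) qpath \<Rightarrow>\<^sub>0 'k)" where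
  "bext_A \<phi> =
     lin_ext (\<lambda>us. cls (hd us) \<otimes>\<^bsub>A\<^esub> \<phi> (butlast (tl us)) \<otimes>\<^bsub>A\<^esub> cls (last us))"

definition gen :: "('a, 'b) qpath \<Rightarrow> (('a, 'b) qpath list \<Rightarrow>\<^sub>0 'k)" where
  "gen w = pure [\<one>\<^bsub>A\<^esub>, bas w, \<one>\<^bsub>A\<^esub>]"

definition delta ::
  "'b \<Rightarrow> (('a, 'b) qpath list \<Rightarrow>\<^sub>0 'k) \<Rightarrow> (('a, 'b) qpath \<Rightarrow>\<^sub>0 'k)" where
  "delta \<alpha> = bext_A (\<lambda>vs. if vs = [arrow \<alpha>] then cls (arrow \<alpha>) else 0)"


section \<open>The comparison maps \<open>F\<close> and \<open>G\<close>\<close>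

definition one_tensor :: "(('a, 'b) qpath list \<Rightarrow>\<^sub>0 'k) \<Rightarrow> (('a, 'b) qpath list \<Rightarrow>\<^sub>0 'k)" where
  "one_tensor = lin_ext (\<lambda>vs. pure (\<one>\<^bsub>A\<^esub> # map bas vs))"

text \<open>
  The sum runs over all \<open>\<zeta> \<in> Sub w\<close> but the first one; distinct elements of \<open>Sub w\<close> start
  at distinct positions.
\<close>

fun F_gen :: "nat \<Rightarrow> ('a, 'b) qpath \<Rightarrow> (('a, 'b) qpath list \<Rightarrow>\<^sub>0 'k)" where
  "F_gen 0 w = pure [cls w, \<one>\<^bsub>A\<^esub>]"
| "F_gen (Suc 0) w = pure [\<one>\<^bsub>A\<^esub>, cls w, \<one>\<^bsub>A\<^esub>]"
| "F_gen (Suc (Suc n)) w =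
     (\<Sum>(i, j) \<in> {\<zeta> \<in> Sub (Suc (Suc n)) w. \<exists>\<zeta>' \<in> Sub (Suc (Suc n)) w. fst \<zeta>' < fst \<zeta>}.
        one_tensor (lact (cls (segment w 0 i))
          (ract (F_gen (Suc n) (segment w i j)) (cls (segment w j (plen w))))))"

definition F :: "nat \<Rightarrow> (('a, 'b) qpath list \<Rightarrow>\<^sub>0 'k) \<Rightarrow> (('a, 'b) qpath list \<Rightarrow>\<^sub>0 'k)" where
  "F n = bext_tensor (\<lambda>vs. F_gen n (hd vs))"

text \<open>The entry \<open>v\<^sub>i\<close> of a sequence is \<open>vs ! (i - 1)\<close>.\<close>

definition M_odd :: "('a, 'b) qpath list \<Rightarrow> nat set" where
  "M_odd vs = {j. 1 \<le> j \<and> 2 * j \<le> length vs \<and>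
     bas (pcat (vs ! (2 * j - 2)) (vs ! (2 * j - 1))) \<notin> I}"

definition M_even :: "('a, 'b) qpath list \<Rightarrow> nat set" where
  "M_even vs = {j. 1 \<le> j \<and> 2 * j + 1 \<le> length vs \<and>
     bas (pcat (vs ! (2 * j - 1)) (vs ! (2 * j))) \<notin> I}"

definition good :: "('a, 'b) qpath list \<Rightarrow> bool" where
  "good vs \<longleftrightarrow> (even (length vs) \<and> M_odd vs = {}) \<or> (odd (length vs) \<and> M_even vs = {})"

definition chi :: "('a, 'b) qpath list \<Rightarrow> (nat \<times> nat) set" where
  "chi vs = occs (AP (length vs)) (pconcat vs)"

text \<open>The element \<open>L(w) \<otimes> w \<otimes> R(w)\<close> for the occurrence \<open>w\<close> in \<open>T\<close>.\<close>

definition split_at :: "('a, 'b) qpath \<Rightarrow> nat \<times> nat \<Rightarrow> (('a, 'b) qpath list \<Rightarrow>\<^sub>0 'k)" where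
  "split_at T w = pure [cls (segment T 0 (fst w)), bas (segment T (fst w) (snd w)),
     cls (segment T (snd w) (plen T))]"

definition G_gen :: "('a, 'b) qpath list \<Rightarrow> (('a, 'b) qpath list \<Rightarrow>\<^sub>0 'k)" where
  "G_gen vs =
     (if length vs = 0 then \<Sum>x\<in>verts Q. gen (trivial x)
      else if length vs = 1 then \<Sum>i<plen (hd vs). split_at (hd vs) (i, Suc i)
      else if \<not> good vs \<or> chi vs = {} then 0
      else if even (length vs) then split_at (pconcat vs) (arg_min fst (\<lambda>w. w \<in> chi vs))
      else \<Sum>w\<in>{w \<in> chi vs. 0 \<le> fst w \<and> fst w < plen (hd vs)}. split_at (pconcat vs) w)"

text \<open>
  \<open>G\<close> is \<open>G\<^sub>n\<close> for every \<open>n\<close>: the degree is read off the tensors, those of \<open>A\<^bsup>\<otimes>(n+2)\<^esup>\<close> being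
  supported on lists of length \<open>n + 2\<close>.
\<close>

definition G :: "(('a, 'b) qpath list \<Rightarrow>\<^sub>0 'k) \<Rightarrow> (('a, 'b) qpath list \<Rightarrow>\<^sub>0 'k)" where
  "G = bext_tensor G_gen"


section \<open>The bracket\<close>

text \<open>
  \<open>n\<close> and \<open>m\<close> are the degrees of \<open>f\<close> and \<open>g\<close>.  The sign exponents are integers because \<open>m - 1\<close>
  is \<open>-1\<close> in degree \<open>0\<close>; \<open>n + m - 1\<close> is only used with \<open>n \<ge> 1\<close>.
\<close>

definition bar_circ_i :: "nat \<Rightarrow> nat \<Rightarrow>
  ((('a, 'b) qpath list \<Rightarrow>\<^sub>0 'k) \<Rightarrow> (('a, 'b) qpath \<Rightarrow>\<^sub>0 'k)) \<Rightarrow>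
  ((('a, 'b) qpath list \<Rightarrow>\<^sub>0 'k) \<Rightarrow> (('a, 'b) qpath \<Rightarrow>\<^sub>0 'k)) \<Rightarrow>
  (('a, 'b) qpath list \<Rightarrow>\<^sub>0 'k) \<Rightarrow> (('a, 'b) qpath \<Rightarrow>\<^sub>0 'k)" where
  "bar_circ_i i m f g = bext_A (\<lambda>vs.
     f (pure (\<one>\<^bsub>A\<^esub> # map bas (take (i - 1) vs)
        @ g (pure (\<one>\<^bsub>A\<^esub> # map bas (take m (drop (i - 1) vs)) @ [\<one>\<^bsub>A\<^esub>]))
        # map bas (drop (i - 1 + m) vs) @ [\<one>\<^bsub>A\<^esub>])))"

definition circ_i :: "nat \<Rightarrow> nat \<Rightarrow> nat \<Rightarrow>
  ((('a, 'b) qpath list \<Rightarrow>\<^sub>0 'k) \<Rightarrow> (('a, 'b) qpath \<Rightarrow>\<^sub>0 'k)) \<Rightarrow>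
  ((('a, 'b) qpath list \<Rightarrow>\<^sub>0 'k) \<Rightarrow> (('a, 'b) qpath \<Rightarrow>\<^sub>0 'k)) \<Rightarrow>
  (('a, 'b) qpath list \<Rightarrow>\<^sub>0 'k) \<Rightarrow> (('a, 'b) qpath \<Rightarrow>\<^sub>0 'k)" where
  "circ_i i n m f g = bar_circ_i i m (f \<circ> G) (g \<circ> G) \<circ> F (n + m - 1)"

definition circ :: "nat \<Rightarrow> nat \<Rightarrow>
  ((('a, 'b) qpath list \<Rightarrow>\<^sub>0 'k) \<Rightarrow> (('a, 'b) qpath \<Rightarrow>\<^sub>0 'k)) \<Rightarrow>
  ((('a, 'b) qpath list \<Rightarrow>\<^sub>0 'k) \<Rightarrow> (('a, 'b) qpath \<Rightarrow>\<^sub>0 'k)) \<Rightarrow>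
  (('a, 'b) qpath list \<Rightarrow>\<^sub>0 'k) \<Rightarrow> (('a, 'b) qpath \<Rightarrow>\<^sub>0 'k)" where
  "circ n m f g x =
     (\<Sum>i=1..n. cscale ((-1) powi ((int i - 1) * (int m - 1))) (circ_i i n m f g x))"

definition bracket :: "nat \<Rightarrow> nat \<Rightarrow>
  ((('a, 'b) qpath list \<Rightarrow>\<^sub>0 'k) \<Rightarrow> (('a, 'b) qpath \<Rightarrow>\<^sub>0 'k)) \<Rightarrow>
  ((('a, 'b) qpath list \<Rightarrow>\<^sub>0 'k) \<Rightarrow> (('a, 'b) qpath \<Rightarrow>\<^sub>0 'k)) \<Rightarrow>
  (('a, 'b) qpath list \<Rightarrow>\<^sub>0 'k) \<Rightarrow> (('a, 'b) qpath \<Rightarrow>\<^sub>0 'k)" where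
  "bracket n m f g x =
     circ n m f g x - cscale ((-1) powi ((int n - 1) * (int m - 1))) (circ m n g f x)"

end


section \<open>Monomial algebras\<close>

locale monomial_algebra = quiver_ideal Q I + fin_digraph Q
  for Q :: "('a, 'b) pre_digraph" (structure)
  and I :: "(('a, 'b) qpath \<Rightarrow>\<^sub>0 'k::field) set" +
  assumes generated_by_paths: "\<exists>S\<subseteq>paths. I = Idl\<^bsub>path_algebra\<^esub> (bas ` S)"
    and admissible: "\<exists>m\<ge>2. arrow_ideal_power m \<subseteq> I \<and> I \<subseteq> arrow_ideal_power 2"


section \<open>The ring structure of the path algebra\<close>

lemma lookup_cscale [simp]: "Poly_Mapping.lookup (cscale c x) v = c * Poly_Mapping.lookup x v"
  by (simp add: cscale_def Poly_Mapping.map.rep_eq when_def)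

lemma vector_space_cscale: "vector_space (cscale :: 'k::field \<Rightarrow> ('x \<Rightarrow>\<^sub>0 'k) \<Rightarrow> _)"
  by unfold_locales (auto intro!: poly_mapping_eqI simp: lookup_add algebra_simps)

interpretation cs: vector_space "cscale :: 'k::field \<Rightarrow> ('x \<Rightarrow>\<^sub>0 'k) \<Rightarrow> _"
  by (rule vector_space_cscale)

lemma lin_ext_superset:
  assumes "finite S" "Poly_Mapping.keys x \<subseteq> S"
  shows "lin_ext \<phi> x = (\<Sum>v\<in>S. cscale (Poly_Mapping.lookup x v) (\<phi> v))"
  unfolding lin_ext_def
  by (rule sum.mono_neutral_left) (use assms in \<open>auto simp: in_keys_iff\<close>)

lemma lin_ext_zero [simp]: "lin_ext \<phi> 0 = 0"
  by (simp add: lin_ext_def)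

lemma lin_ext_add: "lin_ext \<phi> (x + y) = lin_ext \<phi> x + lin_ext \<phi> y"
proof -
  let ?S = "Poly_Mapping.keys x \<union> Poly_Mapping.keys y"
  have "lin_ext \<phi> z = (\<Sum>v\<in>?S. cscale (Poly_Mapping.lookup z v) (\<phi> v))" if "Poly_Mapping.keys z \<subseteq> ?S" for z
    using that by (intro lin_ext_superset) auto
  from this[of x] this[of y] this[of "x + y"] show ?thesis
    using Poly_Mapping.keys_add[of x y] by (simp add: lookup_add cs.scale_left_distrib sum.distrib)
qed

lemma keys_cscale: "Poly_Mapping.keys (cscale c x) \<subseteq> Poly_Mapping.keys x"
  by (auto simp: in_keys_iff)

lemma lin_ext_cscale: "lin_ext \<phi> (cscale c x) = cscale c (lin_ext \<phi> x)"
proof -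
  have "lin_ext \<phi> (cscale c x) = (\<Sum>v\<in>Poly_Mapping.keys x. cscale (c * Poly_Mapping.lookup x v) (\<phi> v))"
    by (subst lin_ext_superset[OF _ keys_cscale]) auto
  then show ?thesis by (simp add: lin_ext_def cs.scale_sum_right)
qed

lemma lin_ext_sum: "lin_ext \<phi> (\<Sum>i\<in>T. x i) = (\<Sum>i\<in>T. lin_ext \<phi> (x i))"
  by (induction T rule: infinite_finite_induct) (auto simp: lin_ext_add)

lemma lin_ext_minus: "lin_ext \<phi> (x - y) = lin_ext \<phi> x - lin_ext \<phi> y"
  using lin_ext_add[of \<phi> "x - y" y] by simp

lemma keys_bas [simp]: "Poly_Mapping.keys (bas v :: 'x \<Rightarrow>\<^sub>0 'k::field) = {v}"
  by (simp add: bas_def)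

lemma lin_ext_bas [simp]: "lin_ext \<phi> (bas v) = \<phi> v"
  by (simp add: lin_ext_def) (simp add: bas_def)

lemma single_bas: "Poly_Mapping.single v c = cscale c (bas v)"
  by (auto intro!: poly_mapping_eqI simp: bas_def lookup_single when_def)

lemma lin_ext_bas_id: "lin_ext bas x = x"
proof (rule poly_mapping_eqI)
  fix w
  have "Poly_Mapping.lookup (lin_ext bas x) w =
      (\<Sum>v\<in>Poly_Mapping.keys x. if v = w then Poly_Mapping.lookup x v else 0)"
    unfolding lin_ext_def single_bas[symmetric] lookup_sum
    by (intro sum.cong refl) (simp add: lookup_single when_def)
  then show "Poly_Mapping.lookup (lin_ext bas x) w = Poly_Mapping.lookup x w"
    by (simp add: in_keys_iff)
qed

lemma lin_ext_swap: "lin_ext (\<lambda>p. lin_ext (\<lambda>q. B p q) y) x = lin_ext (\<lambda>q. lin_ext (\<lambda>p. B p q) x) y"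
  unfolding lin_ext_def cs.scale_sum_right cs.scale_scale
  by (subst sum.swap) (simp add: mult.commute)

lemma lin_ext_lin_ext: "lin_ext \<phi> (lin_ext \<psi> x) = lin_ext (\<lambda>v. lin_ext \<phi> (\<psi> v)) x"
  by (simp add: lin_ext_def[of \<psi>] lin_ext_def[of "\<lambda>v. lin_ext \<phi> (\<psi> v)"] lin_ext_sum lin_ext_cscale)

lemma lin_ext_cong: "(\<And>v. v \<in> Poly_Mapping.keys x \<Longrightarrow> \<phi> v = \<psi> v) \<Longrightarrow> lin_ext \<phi> x = lin_ext \<psi> x"
  by (simp add: lin_ext_def)

lemma lin_ext_0_fun [simp]: "lin_ext (\<lambda>_. 0) x = 0"
  by (simp add: lin_ext_def)

lemma lin_ext_fun_add: "lin_ext (\<lambda>v. \<phi> v + \<psi> v) x = lin_ext \<phi> x + lin_ext \<psi> x"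
  by (simp add: lin_ext_def cs.scale_right_distrib sum.distrib)

lemma keys_sum_sub: "Poly_Mapping.keys (\<Sum>i\<in>T. x i) \<subseteq> (\<Union>i\<in>T. Poly_Mapping.keys (x i))"
  by (rule Poly_Mapping.keys_sum)

lemma keys_lin_ext: "Poly_Mapping.keys (lin_ext \<phi> x) \<subseteq> (\<Union>v\<in>Poly_Mapping.keys x. Poly_Mapping.keys (\<phi> v))"
proof -
  have "Poly_Mapping.keys (lin_ext \<phi> x) \<subseteq>
      (\<Union>v\<in>Poly_Mapping.keys x. Poly_Mapping.keys (cscale (Poly_Mapping.lookup x v) (\<phi> v)))"
    unfolding lin_ext_def by (rule keys_sum_sub)
  also have "\<dots> \<subseteq> (\<Union>v\<in>Poly_Mapping.keys x. Poly_Mapping.keys (\<phi> v))"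
    by (intro UN_mono order_refl keys_cscale)
  finally show ?thesis .
qed

context pre_digraph begin

lemma src_pcat [simp]: "src (pcat p q) = src p"
  by (simp add: src_def pcat_def)

lemma trg_pcat [simp]: "trg p = src q \<Longrightarrow> trg (pcat p q) = trg q"
  by (auto simp: trg_def src_def pcat_def awalk_verts_conv split: if_splits)

lemma src_trivial [simp]: "src (trivial x) = x" and trg_trivial [simp]: "trg (trivial x) = x"
  by (auto simp: src_def trg_def trivial_def)

lemma pcat_trivial [simp]: "pcat p (trivial x) = p" "src p = x \<Longrightarrow> pcat (trivial x) p = p"
  by (auto simp: src_def pcat_def trivial_def)

lemma pcat_assoc: "pcat (pcat p q) r = pcat p (pcat q r)"
  by (simp add: pcat_def src_def)

lemma path_mult_assoc:
  "lin_ext (\<lambda>s. path_mult s r) (path_mult p q) = lin_ext (path_mult p) (path_mult q r)"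
  by (auto simp: path_mult_def pcat_assoc)

lemma pmul_def: "x \<otimes>\<^bsub>path_algebra\<^esub> y = lin_ext (\<lambda>p. lin_ext (\<lambda>q. path_mult p q) y) x"
  by (simp add: path_algebra_def)

lemma pmul_bas [simp]: "bas p \<otimes>\<^bsub>path_algebra\<^esub> bas q = path_mult p q"
  by (simp add: pmul_def)

lemma pmul_add_left: "(x + y) \<otimes>\<^bsub>path_algebra\<^esub> z = x \<otimes>\<^bsub>path_algebra\<^esub> z + y \<otimes>\<^bsub>path_algebra\<^esub> z"
  by (simp add: pmul_def lin_ext_add)

lemma pmul_add_right: "x \<otimes>\<^bsub>path_algebra\<^esub> (y + z) = x \<otimes>\<^bsub>path_algebra\<^esub> y + x \<otimes>\<^bsub>path_algebra\<^esub> z"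
  by (simp add: pmul_def lin_ext_add lin_ext_fun_add)

lemma pmul_assoc: "(x \<otimes>\<^bsub>path_algebra\<^esub> y) \<otimes>\<^bsub>path_algebra\<^esub> z = x \<otimes>\<^bsub>path_algebra\<^esub> (y \<otimes>\<^bsub>path_algebra\<^esub> z)"
proof -
  have "lin_ext (\<lambda>s. lin_ext (path_mult s) z) (path_mult p q) =
        lin_ext (path_mult p) (lin_ext (path_mult q) z)" for p q
  proof -
    have "lin_ext (\<lambda>s. lin_ext (path_mult s) z) (path_mult p q) =
      lin_ext (\<lambda>r. lin_ext (\<lambda>s. path_mult s r) (path_mult p q)) z"
      by (rule lin_ext_swap)
    then show ?thesis by (simp only: path_mult_assoc lin_ext_lin_ext)
  qed
  then show ?thesis by (simp add: pmul_def lin_ext_lin_ext)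
qed

lemma path_in_verts: "p \<in> paths \<Longrightarrow> src p \<in> verts G"
  by (simp add: paths_def awalk_def)

lemma cas_append: "cas u p v \<Longrightarrow> cas v q w \<Longrightarrow> cas u (p @ q) w"
  by (induction u p v rule: cas.induct) auto

lemma pcat_paths:
  assumes "p \<in> paths" "q \<in> paths" "trg p = src q"
  shows "pcat p q \<in> paths"
proof -
  have "cas (src p) (snd p @ snd q) (trg q)"
    using assms cas_append[of "src p" "snd p" "src q" "snd q" "trg q"]
    by (simp add: paths_def awalk_def del: cas_append_iff)
  then show ?thesis
    using assms by (simp add: paths_def awalk_def del: cas_append_iff) (simp add: pcat_def)
qed

lemma carrier_pa: "carrier path_algebra = {x. Poly_Mapping.keys x \<subseteq> paths}"
  by (simp add: path_algebra_def)

lemma pmul_closed: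
  "x \<in> carrier path_algebra \<Longrightarrow> y \<in> carrier path_algebra \<Longrightarrow> x \<otimes>\<^bsub>path_algebra\<^esub> y \<in> carrier path_algebra"
proof -
  assume a: "x \<in> carrier path_algebra" "y \<in> carrier path_algebra"
  have "Poly_Mapping.keys (x \<otimes>\<^bsub>path_algebra\<^esub> y) \<subseteq>
    (\<Union>p\<in>Poly_Mapping.keys x. \<Union>q\<in>Poly_Mapping.keys y. Poly_Mapping.keys (path_mult p q :: _ \<Rightarrow>\<^sub>0 'c))"
    unfolding pmul_def by (intro order_trans[OF keys_lin_ext] UN_mono order_refl keys_lin_ext)
  also have "\<dots> \<subseteq> paths"
  proof (intro UN_least)
    fix p q assume "p \<in> Poly_Mapping.keys x" "q \<in> Poly_Mapping.keys y"
    then have "p \<in> paths" "q \<in> paths" using a by (auto simp: carrier_pa)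
    then show "Poly_Mapping.keys (path_mult p q :: _ \<Rightarrow>\<^sub>0 'c) \<subseteq> paths"
      by (simp add: path_mult_def pcat_paths)
  qed
  finally show ?thesis by (simp add: carrier_pa)
qed

end

context fin_digraph begin

lemma trivial_paths [simp]: "x \<in> verts G \<Longrightarrow> trivial x \<in> paths"
  by (simp add: paths_def awalk_def) (simp add: trivial_def)

lemma trg_in_verts: "p \<in> paths \<Longrightarrow> trg p \<in> verts G"
  by (auto simp: paths_def awalk_def trg_def src_def intro: awlast_in_verts)

lemma one_pa: "\<one>\<^bsub>path_algebra\<^esub> = (\<Sum>x\<in>verts G. bas (trivial x))"
  by (simp add: path_algebra_def)

lemma sum_pmul: "(\<Sum>i\<in>S. f i) \<otimes>\<^bsub>path_algebra\<^esub> z = (\<Sum>i\<in>S. f i \<otimes>\<^bsub>path_algebra\<^esub> z)"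
  by (simp add: pmul_def lin_ext_sum)

lemma pmul_sum: "z \<otimes>\<^bsub>path_algebra\<^esub> (\<Sum>i\<in>S. f i) = (\<Sum>i\<in>S. z \<otimes>\<^bsub>path_algebra\<^esub> f i)"
proof (induction S rule: infinite_finite_induct)
  case (insert i S)
  then show ?case by (simp add: pmul_add_right)
qed (simp_all add: pmul_def)

lemma one_pmul:
  assumes "x \<in> carrier path_algebra" shows "\<one>\<^bsub>path_algebra\<^esub> \<otimes>\<^bsub>path_algebra\<^esub> x = x"
proof -
  have "\<one>\<^bsub>path_algebra\<^esub> \<otimes>\<^bsub>path_algebra\<^esub> x = lin_ext (\<lambda>q. lin_ext (\<lambda>p. path_mult p q) \<one>\<^bsub>path_algebra\<^esub>) x"
    unfolding pmul_def by (rule lin_ext_swap)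
  also have "\<dots> = lin_ext bas x"
  proof (rule lin_ext_cong)
    fix q assume "q \<in> Poly_Mapping.keys x"
    then have q: "src q \<in> verts G" using assms by (auto simp: carrier_pa path_in_verts)
    have "lin_ext (\<lambda>p. path_mult p q) \<one>\<^bsub>path_algebra\<^esub> = (\<Sum>y\<in>verts G. if y = src q then bas q else 0)"
      unfolding one_pa lin_ext_sum by (intro sum.cong refl) (auto simp: path_mult_def)
    then show "lin_ext (\<lambda>p. path_mult p q) \<one>\<^bsub>path_algebra\<^esub> = bas q" using q by simp
  qed
  finally show ?thesis by (simp add: lin_ext_bas_id)
qed

lemma pmul_one:
  assumes "x \<in> carrier path_algebra" shows "x \<otimes>\<^bsub>path_algebra\<^esub> \<one>\<^bsub>path_algebra\<^esub> = x"
proof -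
  have "x \<otimes>\<^bsub>path_algebra\<^esub> \<one>\<^bsub>path_algebra\<^esub> = lin_ext bas x"
    unfolding pmul_def
  proof (rule lin_ext_cong)
    fix q assume "q \<in> Poly_Mapping.keys x"
    then have q: "trg q \<in> verts G" using assms by (auto simp: carrier_pa trg_in_verts)
    have "lin_ext (path_mult q) \<one>\<^bsub>path_algebra\<^esub> = (\<Sum>y\<in>verts G. if y = trg q then bas q else 0)"
      unfolding one_pa lin_ext_sum by (intro sum.cong refl) (auto simp: path_mult_def)
    then show "lin_ext (path_mult q) \<one>\<^bsub>path_algebra\<^esub> = bas q" using q by simp
  qed
  then show ?thesis by (simp add: lin_ext_bas_id)
qed

lemma ring_path_algebra: "ring (path_algebra :: (('a, 'b) qpath \<Rightarrow>\<^sub>0 'k::field) ring)"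
proof (rule ringI)
  show "abelian_group (path_algebra :: (('a, 'b) qpath \<Rightarrow>\<^sub>0 'k) ring)"
  proof (rule abelian_groupI)
    fix x :: "('a, 'b) qpath \<Rightarrow>\<^sub>0 'k" assume "x \<in> carrier path_algebra"
    then show "\<exists>y\<in>carrier path_algebra. y \<oplus>\<^bsub>path_algebra\<^esub> x = \<zero>\<^bsub>path_algebra\<^esub>"
      by (intro bexI[of _ "- x"]) (auto simp: path_algebra_def in_keys_iff)
  next
    fix x y :: "('a, 'b) qpath \<Rightarrow>\<^sub>0 'k"
    assume "x \<in> carrier path_algebra" "y \<in> carrier path_algebra"
    then show "x \<oplus>\<^bsub>path_algebra\<^esub> y \<in> carrier path_algebra"
      using Poly_Mapping.keys_add[of x y] by (auto simp: path_algebra_def)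
  qed (auto simp: path_algebra_def algebra_simps)
  show "monoid (path_algebra :: (('a, 'b) qpath \<Rightarrow>\<^sub>0 'k) ring)"
  proof (rule monoidI)
    show "\<one>\<^bsub>path_algebra\<^esub> \<in> carrier (path_algebra :: (('a, 'b) qpath \<Rightarrow>\<^sub>0 'k) ring)"
      unfolding one_pa carrier_pa using keys_sum_sub by fastforce
  qed (auto simp: pmul_closed pmul_assoc one_pmul pmul_one)
next
  fix x y z :: "('a, 'b) qpath \<Rightarrow>\<^sub>0 'k"
  show "(x \<oplus>\<^bsub>path_algebra\<^esub> y) \<otimes>\<^bsub>path_algebra\<^esub> z = x \<otimes>\<^bsub>path_algebra\<^esub> z \<oplus>\<^bsub>path_algebra\<^esub> y \<otimes>\<^bsub>path_algebra\<^esub> z"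
    "z \<otimes>\<^bsub>path_algebra\<^esub> (x \<oplus>\<^bsub>path_algebra\<^esub> y) = z \<otimes>\<^bsub>path_algebra\<^esub> x \<oplus>\<^bsub>path_algebra\<^esub> z \<otimes>\<^bsub>path_algebra\<^esub> y"
    using pmul_add_left[of x y z] pmul_add_right[of z x y] by (simp_all add: path_algebra_def)
qed

end


section \<open>Universality of the tensor products\<close>

lemma lookup_lin_ext_filter:
  "Poly_Mapping.lookup (lin_ext (\<lambda>u. if P u then bas u else 0) x) v =
   (if P v then Poly_Mapping.lookup x v else 0)"
proof -
  have "Poly_Mapping.lookup (lin_ext (\<lambda>u. if P u then bas u else 0) x) v =
      (\<Sum>u\<in>Poly_Mapping.keys x. if u = v then (if P v then Poly_Mapping.lookup x v else 0) else 0)"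
    unfolding lin_ext_def lookup_sum
    by (intro sum.cong refl) (auto simp: bas_def lookup_single when_def)
  then show ?thesis by (simp add: in_keys_iff)
qed

lemma in_listset_iff: "vs \<in> listset Xs \<longleftrightarrow> list_all2 (\<in>) vs Xs"
  by (induction Xs arbitrary: vs) (auto simp: set_Cons_def list_all2_Cons2)

lemma finite_listset: "\<forall>X\<in>set Xs. finite X \<Longrightarrow> finite (listset Xs)"
proof (induction Xs)
  case (Cons X Xs)
  have "listset (X # Xs) = (\<lambda>(v, vs). v # vs) ` (X \<times> listset Xs)"
    by (auto simp: set_Cons_def)
  then show ?case using Cons by simp
qed simp

context pre_digraph
begin

definition tensor_args ::
  "('a, 'b) qpath set list \<Rightarrow> (('a, 'b) qpath \<Rightarrow>\<^sub>0 'k::field) list \<Rightarrow> bool" where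
  "tensor_args Xs as \<longleftrightarrow> list_all2 (\<lambda>a X. Poly_Mapping.keys a \<subseteq> X) as Xs"

definition balanced_multilinear ::
  "('a, 'b) qpath set list \<Rightarrow> ((('a, 'b) qpath \<Rightarrow>\<^sub>0 'k::field) list \<Rightarrow> ('y \<Rightarrow>\<^sub>0 'k)) \<Rightarrow> bool" where
  "balanced_multilinear Xs \<Psi> \<longleftrightarrow>
     (\<forall>as i. tensor_args Xs as \<and> i < length Xs \<longrightarrow>
       (\<forall>x y. Poly_Mapping.keys x \<subseteq> Xs ! i \<and> Poly_Mapping.keys y \<subseteq> Xs ! i \<longrightarrow>
          \<Psi> (as[i := x + y]) = \<Psi> (as[i := x]) + \<Psi> (as[i := y])) \<and>
       (\<forall>c x. Poly_Mapping.keys x \<subseteq> Xs ! i \<longrightarrow> \<Psi> (as[i := cscale c x]) = cscale c (\<Psi> (as[i := x]))) \<and>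
       (Suc i < length Xs \<longrightarrow> (\<forall>z\<in>verts G.
          \<Psi> (as[i := as ! i \<otimes>\<^bsub>path_algebra\<^esub> bas (trivial z)]) =
          \<Psi> (as[Suc i := bas (trivial z) \<otimes>\<^bsub>path_algebra\<^esub> as ! Suc i]))))"

definition linear_on :: "('x \<Rightarrow>\<^sub>0 'k::field) set \<Rightarrow> (('x \<Rightarrow>\<^sub>0 'k) \<Rightarrow> ('y \<Rightarrow>\<^sub>0 'k)) \<Rightarrow> bool" where
  "linear_on M h \<longleftrightarrow>
     (\<forall>x\<in>M. \<forall>y\<in>M. h (x + y) = h x + h y) \<and> (\<forall>c. \<forall>x\<in>M. h (cscale c x) = cscale c (h x))"

lemma lookup_pure:
  "Poly_Mapping.lookup (pure as) vs =
   (if length vs = length as \<and> composable vs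
    then \<Prod>j<length as. Poly_Mapping.lookup (as ! j) (vs ! j) else 0)"
proof -
  let ?S = "{us \<in> listset (map Poly_Mapping.keys as). composable us}"
  let ?p = "\<lambda>us. prod_list (map2 Poly_Mapping.lookup as us)"
  have fin: "finite ?S" by (simp add: finite_listset)
  have "Poly_Mapping.lookup (pure as) vs = (\<Sum>us\<in>?S. if us = vs then ?p vs else 0)"
    unfolding pure_def lookup_sum by (intro sum.cong refl) (auto simp: lookup_single when_def)
  also have "\<dots> = (if vs \<in> ?S then ?p vs else 0)"
    using fin by simp
  also have "\<dots> = (if length vs = length as \<and> composable vs
    then \<Prod>j<length as. Poly_Mapping.lookup (as ! j) (vs ! j) else 0)"
  proof (cases "length vs = length as \<and> composable vs")
    case True
    have p: "?p vs = (\<Prod>j<length as. Poly_Mapping.lookup (as ! j) (vs ! j))"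
      using True by (simp add: prod.list_conv_set_nth atLeast0LessThan)
    have m: "vs \<in> ?S \<longleftrightarrow> (\<forall>j<length as. Poly_Mapping.lookup (as ! j) (vs ! j) \<noteq> 0)"
      using True by (auto simp: in_listset_iff list_all2_conv_all_nth in_keys_iff)
    show ?thesis
    proof (cases "vs \<in> ?S")
      case False
      then show ?thesis using m p by auto
    qed (use True p in simp)
  next
    case False
    then have "vs \<notin> ?S" by (auto simp: in_listset_iff dest: list_all2_lengthD)
    with False show ?thesis by (simp only: if_False)
  qed
  finally show ?thesis .
qed

lemma lookup_pure_update:
  assumes "i < length as"
  shows "Poly_Mapping.lookup (pure (as[i := x])) vs =
   (if length vs = length as \<and> composable vs
    then Poly_Mapping.lookup x (vs ! i) *
      (\<Prod>j\<in>{..<length as} - {i}. Poly_Mapping.lookup (as ! j) (vs ! j)) else 0)"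
proof -
  have "(\<Prod>j<length as. Poly_Mapping.lookup (as[i := x] ! j) (vs ! j)) =
    Poly_Mapping.lookup x (vs ! i) *
      (\<Prod>j\<in>{..<length as} - {i}. Poly_Mapping.lookup (as[i := x] ! j) (vs ! j))"
    using assms by (subst prod.remove[of _ i]) auto
  also have "(\<Prod>j\<in>{..<length as} - {i}. Poly_Mapping.lookup (as[i := x] ! j) (vs ! j)) =
      (\<Prod>j\<in>{..<length as} - {i}. Poly_Mapping.lookup (as ! j) (vs ! j))"
    by (intro prod.cong refl) auto
  finally show ?thesis by (simp add: lookup_pure)
qed

lemma pmul_trivial_right:
  "Poly_Mapping.lookup (x \<otimes>\<^bsub>path_algebra\<^esub> bas (trivial z)) v =
   (if trg v = z then Poly_Mapping.lookup x v else 0)"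
proof -
  have "x \<otimes>\<^bsub>path_algebra\<^esub> bas (trivial z) = lin_ext (\<lambda>v. if trg v = z then bas v else 0) x"
    unfolding pmul_def by (rule lin_ext_cong) (simp add: path_mult_def)
  then show ?thesis by (simp add: lookup_lin_ext_filter)
qed

lemma pmul_trivial_left:
  "Poly_Mapping.lookup (bas (trivial z) \<otimes>\<^bsub>path_algebra\<^esub> x) v =
   (if src v = z then Poly_Mapping.lookup x v else 0)"
proof -
  have "bas (trivial z) \<otimes>\<^bsub>path_algebra\<^esub> x = lin_ext (\<lambda>v. if src v = z then bas v else 0) x"
    unfolding pmul_def lin_ext_bas by (rule lin_ext_cong) (auto simp: path_mult_def)
  then show ?thesis by (simp add: lookup_lin_ext_filter)
qed

theorem pure_balanced_multilinear:
  "balanced_multilinear Xs (pure :: (_ \<Rightarrow>\<^sub>0 'k::field) list \<Rightarrow> _)"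
  unfolding balanced_multilinear_def
proof (intro allI impI conjI ballI)
  fix as :: "(('a, 'b) qpath \<Rightarrow>\<^sub>0 'k) list" and i
  assume a: "tensor_args Xs as \<and> i < length Xs"
  then have i: "i < length as" by (auto simp: tensor_args_def dest: list_all2_lengthD)
  show "pure (as[i := x + y]) = pure (as[i := x]) + pure (as[i := y])" for x y
    by (rule poly_mapping_eqI) (simp add: lookup_pure_update[OF i] lookup_add distrib_right)
  show "pure (as[i := cscale c x]) = cscale c (pure (as[i := x]))" for c x
    by (rule poly_mapping_eqI) (simp add: lookup_pure_update[OF i] mult.assoc)
  fix z assume "Suc i < length Xs"
  then have i': "Suc i < length as" using a by (auto simp: tensor_args_def dest: list_all2_lengthD)
  show "pure (as[i := as ! i \<otimes>\<^bsub>path_algebra\<^esub> bas (trivial z)]) =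
        pure (as[Suc i := bas (trivial z) \<otimes>\<^bsub>path_algebra\<^esub> as ! Suc i])"
  proof (rule poly_mapping_eqI)
    fix vs
    show "Poly_Mapping.lookup (pure (as[i := as ! i \<otimes>\<^bsub>path_algebra\<^esub> bas (trivial z)])) vs =
      Poly_Mapping.lookup (pure (as[Suc i := bas (trivial z) \<otimes>\<^bsub>path_algebra\<^esub> as ! Suc i])) vs"
    proof (cases "length vs = length as \<and> composable vs")
      case True
      then have t: "trg (vs ! i) = src (vs ! Suc i)" using i' by (auto simp: composable_def)
      have e: "Poly_Mapping.lookup (as ! j) (vs ! j) *
          (\<Prod>j\<in>{..<length as} - {j}. Poly_Mapping.lookup (as ! j) (vs ! j)) =
          (\<Prod>j<length as. Poly_Mapping.lookup (as ! j) (vs ! j))" if "j < length as" for j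
        using that by (subst (2) prod.remove[of _ j]) auto
      show ?thesis
        unfolding lookup_pure_update[OF i] lookup_pure_update[OF i'] pmul_trivial_right
          pmul_trivial_left t using True e[OF i] e[OF i'] by simp
    qed (simp only: lookup_pure_update[OF i] lookup_pure_update[OF i'] if_False)
  qed
qed

theorem pure_in_tensor:
  assumes "tensor_args Xs as"
  shows "pure as \<in> tensor Xs"
proof -
  have len: "length as = length Xs" and k: "\<And>j. j < length as \<Longrightarrow> Poly_Mapping.keys (as ! j) \<subseteq> Xs ! j"
    using assms by (auto simp: tensor_args_def list_all2_conv_all_nth)
  have "list_all2 (\<in>) vs Xs \<and> composable vs" if "vs \<in> Poly_Mapping.keys (pure as)" for vs
  proof -
    have "Poly_Mapping.lookup (pure as) vs \<noteq> 0" using that by (simp add: in_keys_iff)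
    then have v: "length vs = length as" "composable vs"
      "(\<Prod>j<length as. Poly_Mapping.lookup (as ! j) (vs ! j)) \<noteq> 0"
      by (auto simp: lookup_pure split: if_splits)
    then have "\<forall>j<length as. vs ! j \<in> Poly_Mapping.keys (as ! j)" by (auto simp: in_keys_iff)
    then show ?thesis using v len k by (fastforce simp: list_all2_conv_all_nth)
  qed
  then show ?thesis by (auto simp: tensor_def in_listset_iff)
qed

lemma slot_expand:
  assumes \<Psi>: "balanced_multilinear Xs \<Psi>" and as: "tensor_args Xs as" and i: "i < length Xs"
    and a: "Poly_Mapping.keys a \<subseteq> Xs ! i"
  shows "\<Psi> (as[i := a]) =
    (\<Sum>v\<in>Poly_Mapping.keys a. cscale (Poly_Mapping.lookup a v) (\<Psi> (as[i := bas v])))"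
proof -
  have add: "\<Psi> (as[i := x + y]) = \<Psi> (as[i := x]) + \<Psi> (as[i := y])"
    if "Poly_Mapping.keys x \<subseteq> Xs ! i" "Poly_Mapping.keys y \<subseteq> Xs ! i" for x y
    using \<Psi> as i that by (simp add: balanced_multilinear_def)
  have scl: "\<Psi> (as[i := cscale c x]) = cscale c (\<Psi> (as[i := x]))"
    if "Poly_Mapping.keys x \<subseteq> Xs ! i" for c x
    using \<Psi> as i that by (simp add: balanced_multilinear_def)
  have "\<Psi> (as[i := (\<Sum>v\<in>T. cscale (c v) (bas v))]) = (\<Sum>v\<in>T. cscale (c v) (\<Psi> (as[i := bas v])))"
    if "finite T" "T \<subseteq> Xs ! i" for T c
    using that
  proof (induction T rule: finite_induct)
    case empty
    then show ?case using scl[of 0 0] by simp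
  next
    case (insert v T)
    have 1: "Poly_Mapping.keys (cscale (c v) (bas v) :: _ \<Rightarrow>\<^sub>0 'c) \<subseteq> Xs ! i"
      using insert.prems keys_cscale[of "c v" "bas v"] by auto
    have 2: "Poly_Mapping.keys (\<Sum>v\<in>T. cscale (c v) (bas v) :: _ \<Rightarrow>\<^sub>0 'c) \<subseteq> Xs ! i"
    proof (rule order_trans[OF keys_sum_sub], rule UN_least)
      fix u assume "u \<in> T"
      then show "Poly_Mapping.keys (cscale (c u) (bas u) :: _ \<Rightarrow>\<^sub>0 'c) \<subseteq> Xs ! i"
        using insert.prems keys_cscale[of "c u" "bas u"] by auto
    qed
    show ?case using insert add[OF 1 2] scl[of "bas v" "c v"] by simp
  qed
  from this[OF finite_keys a, of "Poly_Mapping.lookup a"] show ?thesis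
    using lin_ext_bas_id[of a] by (simp add: lin_ext_def)
qed

lemma multilinear_expand:
  assumes "balanced_multilinear (Ps @ Bs) \<Psi>" "tensor_args Ps ps" "tensor_args Bs as"
  shows "\<Psi> (ps @ as) = (\<Sum>vs\<in>listset (map Poly_Mapping.keys as).
    cscale (prod_list (map2 Poly_Mapping.lookup as vs)) (\<Psi> (ps @ map bas vs)))"
  using assms
proof (induction as arbitrary: ps Ps Bs)
  case Nil
  then show ?case by simp
next
  case (Cons a as)
  then obtain B Bs' where B: "Bs = B # Bs'" "Poly_Mapping.keys a \<subseteq> B" "tensor_args Bs' as"
    by (auto simp: tensor_args_def list_all2_Cons1)
  have len: "length ps = length Ps" using Cons.prems by (auto simp: tensor_args_def dest: list_all2_lengthD)
  have "\<Psi> ((ps @ a # as)[length ps := a]) = (\<Sum>v\<in>Poly_Mapping.keys a.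
      cscale (Poly_Mapping.lookup a v) (\<Psi> ((ps @ a # as)[length ps := bas v])))"
    using Cons.prems B len
    by (intro slot_expand[where Xs = "Ps @ Bs"]) (auto simp: tensor_args_def nth_append intro: list_all2_appendI)
  then have "\<Psi> (ps @ a # as) = (\<Sum>v\<in>Poly_Mapping.keys a.
      cscale (Poly_Mapping.lookup a v) (\<Psi> ((ps @ [bas v]) @ as)))"
    by simp
  also have "\<dots> = (\<Sum>v\<in>Poly_Mapping.keys a. cscale (Poly_Mapping.lookup a v)
      (\<Sum>vs\<in>listset (map Poly_Mapping.keys as).
        cscale (prod_list (map2 Poly_Mapping.lookup as vs)) (\<Psi> ((ps @ [bas v]) @ map bas vs))))"
  proof (intro sum.cong refl arg_cong[where f = "cscale _"])
    fix v assume v: "v \<in> Poly_Mapping.keys a"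
    show "\<Psi> ((ps @ [bas v]) @ as) = (\<Sum>vs\<in>listset (map Poly_Mapping.keys as).
        cscale (prod_list (map2 Poly_Mapping.lookup as vs)) (\<Psi> ((ps @ [bas v]) @ map bas vs)))"
    proof (rule Cons.IH[of "Ps @ [B]" Bs' "ps @ [bas v]"])
      show "tensor_args (Ps @ [B]) (ps @ [bas v])"
        using Cons.prems(2) B(2) v by (auto simp: tensor_args_def intro!: list_all2_appendI)
    qed (use Cons.prems(1) B in auto)
  qed
  also have "\<dots> = (\<Sum>(v, vs)\<in>Poly_Mapping.keys a \<times> listset (map Poly_Mapping.keys as).
      cscale (prod_list (map2 Poly_Mapping.lookup (a # as) (v # vs))) (\<Psi> (ps @ map bas (v # vs))))"
    by (simp add: sum.cartesian_product cs.scale_sum_right)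
  also have "\<dots> = (\<Sum>vs\<in>(\<lambda>(v, vs). v # vs) ` (Poly_Mapping.keys a \<times> listset (map Poly_Mapping.keys as)).
      cscale (prod_list (map2 Poly_Mapping.lookup (a # as) vs)) (\<Psi> (ps @ map bas vs)))"
    by (subst sum.reindex) (auto simp: inj_on_def case_prod_unfold comp_def)
  also have "(\<lambda>(v, vs). v # vs) ` (Poly_Mapping.keys a \<times> listset (map Poly_Mapping.keys as)) =
      listset (map Poly_Mapping.keys (a # as))"
    by (auto simp: set_Cons_def)
  finally show ?case .
qed

end

context fin_digraph
begin

theorem tensor_universal:
  fixes \<Psi> :: "(('a, 'b) qpath \<Rightarrow>\<^sub>0 'k::field) list \<Rightarrow> ('y \<Rightarrow>\<^sub>0 'k)"
  assumes Xs: "\<forall>X\<in>set Xs. X \<subseteq> paths" and \<Psi>: "balanced_multilinear Xs \<Psi>"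
  shows "\<exists>h. linear_on (tensor Xs) h \<and> (\<forall>as. tensor_args Xs as \<longrightarrow> h (pure as) = \<Psi> as) \<and>
    (\<forall>h'. linear_on (tensor Xs) h' \<and> (\<forall>as. tensor_args Xs as \<longrightarrow> h' (pure as) = \<Psi> as) \<longrightarrow>
       (\<forall>x\<in>tensor Xs. h' x = h x))"
proof (intro exI conjI allI impI ballI)
  let ?h = "lin_ext (\<lambda>vs. \<Psi> (map bas vs))"
  show "linear_on (tensor Xs) ?h"
    by (simp add: linear_on_def lin_ext_add lin_ext_cscale)
  have args: "tensor_args Xs (map bas vs :: (_ \<Rightarrow>\<^sub>0 'k) list)" if "list_all2 (\<in>) vs Xs" for vs
    using that by (simp add: tensor_args_def list_all2_conv_all_nth)
  have noncomp: "\<Psi> (map bas vs) = 0" if vs: "list_all2 (\<in>) vs Xs" and "\<not> composable vs" for vs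
  proof -
    obtain i where i: "Suc i < length vs" "trg (vs ! i) \<noteq> src (vs ! Suc i)"
      using \<open>\<not> composable vs\<close> by (auto simp: composable_def)
    have len: "length vs = length Xs" using vs by (rule list_all2_lengthD)
    have "vs ! i \<in> Xs ! i" "Xs ! i \<in> set Xs" using vs i len by (auto simp: list_all2_conv_all_nth)
    then have z: "trg (vs ! i) \<in> verts G" using Xs trg_in_verts by blast
    let ?as = "map bas vs :: (_ \<Rightarrow>\<^sub>0 'k) list" and ?e = "bas (trivial (trg (vs ! i))) :: _ \<Rightarrow>\<^sub>0 'k"
    have "\<Psi> (?as[i := ?as ! i \<otimes>\<^bsub>path_algebra\<^esub> ?e]) = \<Psi> (?as[Suc i := ?e \<otimes>\<^bsub>path_algebra\<^esub> ?as ! Suc i])"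
      using \<Psi>[unfolded balanced_multilinear_def, rule_format, of ?as i] args[OF vs] i len z
      by (auto simp del: pmul_bas)
    moreover have "?as ! i \<otimes>\<^bsub>path_algebra\<^esub> ?e = ?as ! i" "?e \<otimes>\<^bsub>path_algebra\<^esub> ?as ! Suc i = 0"
      using i by (simp_all add: path_mult_def)
    ultimately have "\<Psi> ?as = \<Psi> (?as[Suc i := cscale 0 0])" by (simp only: list_update_id) simp
    also have "\<dots> = cscale 0 (\<Psi> (?as[Suc i := 0]))"
    proof -
      have "\<forall>c x. Poly_Mapping.keys x \<subseteq> Xs ! Suc i \<longrightarrow>
          \<Psi> (?as[Suc i := cscale c x]) = cscale c (\<Psi> (?as[Suc i := x]))"
        using \<Psi>[unfolded balanced_multilinear_def, rule_format, of ?as "Suc i"] args[OF vs] i len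
        by auto
      from this[rule_format, of 0 0] show ?thesis by simp
    qed
    finally show ?thesis by simp
  qed
  show hp: "?h (pure as) = \<Psi> as" if as: "tensor_args Xs as" for as
  proof -
    have "?h (pure as) = (\<Sum>vs\<in>{vs \<in> listset (map Poly_Mapping.keys as). composable vs}.
        cscale (prod_list (map2 Poly_Mapping.lookup as vs)) (\<Psi> (map bas vs)))"
      by (simp add: pure_def lin_ext_sum single_bas lin_ext_cscale)
    also have "\<dots> = (\<Sum>vs\<in>listset (map Poly_Mapping.keys as).
        cscale (prod_list (map2 Poly_Mapping.lookup as vs)) (\<Psi> (map bas vs)))"
    proof (rule sum.mono_neutral_left)
      show "\<forall>vs\<in>listset (map Poly_Mapping.keys as) -
          {vs \<in> listset (map Poly_Mapping.keys as). composable vs}.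
          cscale (prod_list (map2 Poly_Mapping.lookup as vs)) (\<Psi> (map bas vs)) = 0"
      proof
        fix vs assume vs: "vs \<in> listset (map Poly_Mapping.keys as) -
          {vs \<in> listset (map Poly_Mapping.keys as). composable vs}"
        then have "list_all2 (\<in>) vs (map Poly_Mapping.keys as)" by (simp add: in_listset_iff)
        then have "list_all2 (\<in>) vs Xs"
          using as unfolding tensor_args_def list_all2_conv_all_nth
          by (metis length_map nth_map subsetD)
        then show "cscale (prod_list (map2 Poly_Mapping.lookup as vs)) (\<Psi> (map bas vs)) = 0"
          using vs noncomp by auto
      qed
    qed (auto simp: finite_listset)
    also have "\<dots> = \<Psi> as"
      using multilinear_expand[of "[]" Xs \<Psi> "[]" as] \<Psi> as by (simp add: tensor_args_def)
    finally show ?thesis .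
  qed
  fix h' and x :: "('a, 'b) qpath list \<Rightarrow>\<^sub>0 'k"
  assume h': "linear_on (tensor Xs) h' \<and> (\<forall>as. tensor_args Xs as \<longrightarrow> h' (pure as) = \<Psi> as)"
    and x: "x \<in> tensor Xs"
  have pb: "pure (map bas vs) = (bas vs :: _ \<Rightarrow>\<^sub>0 'k)" if "composable vs" for vs
  proof (rule poly_mapping_eqI)
    fix us
    show "Poly_Mapping.lookup (pure (map bas vs)) us = Poly_Mapping.lookup (bas vs :: _ \<Rightarrow>\<^sub>0 'k) us"
    proof (cases "us = vs")
      case True
      then show ?thesis using that by (simp add: lookup_pure) (simp add: bas_def)
    next
      case False
      have "(\<Prod>j<length vs. Poly_Mapping.lookup (bas (vs ! j) :: _ \<Rightarrow>\<^sub>0 'k) (us ! j)) = 0"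
        if len: "length us = length vs"
      proof -
        obtain j where "j < length vs" "us ! j \<noteq> vs ! j" using len False nth_equalityI[of us vs] by auto
        then show ?thesis by (intro prod_zero) (auto simp: bas_def lookup_single when_def intro!: bexI[of _ j])
      qed
      then show ?thesis using False by (simp add: lookup_pure) (auto simp: bas_def lookup_single when_def)
    qed
  qed
  have kx: "list_all2 (\<in>) vs Xs \<and> composable vs" if "vs \<in> Poly_Mapping.keys x" for vs
    using x that by (auto simp: tensor_def in_listset_iff)
  have hb: "h' (bas vs) = \<Psi> (map bas vs)" "bas vs \<in> (tensor Xs :: (_ \<Rightarrow>\<^sub>0 'k) set)"
    if "vs \<in> Poly_Mapping.keys x" for vs
  proof -
    have "h' (pure (map bas vs)) = \<Psi> (map bas vs)" using h' args kx[OF that] by blast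
    then show "h' (bas vs) = \<Psi> (map bas vs)" using pb kx[OF that] by simp
    show "bas vs \<in> (tensor Xs :: (_ \<Rightarrow>\<^sub>0 'k) set)" using kx[OF that] by (simp add: tensor_def in_listset_iff)
  qed
  have sub: "cscale c y \<in> tensor Xs" if "y \<in> tensor Xs" for c and y :: "_ \<Rightarrow>\<^sub>0 'k"
    using that keys_cscale[of c y] by (auto simp: tensor_def)
  have suba: "y + y' \<in> tensor Xs" if "y \<in> tensor Xs" "y' \<in> tensor Xs" for y y' :: "_ \<Rightarrow>\<^sub>0 'k"
    using that Poly_Mapping.keys_add[of y y'] by (auto simp: tensor_def)
  have hadd: "h' (y + y') = h' y + h' y'" if "y \<in> tensor Xs" "y' \<in> tensor Xs" for y y'
    using h' that by (simp add: linear_on_def)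
  have hscl: "h' (cscale c y) = cscale c (h' y)" if "y \<in> tensor Xs" for c y
    using h' that by (simp add: linear_on_def)
  have h0: "h' 0 = 0"
  proof -
    have "0 \<in> (tensor Xs :: (_ \<Rightarrow>\<^sub>0 'k) set)" by (simp add: tensor_def)
    from hscl[OF this, of 0] show ?thesis by simp
  qed
  have "h' (\<Sum>vs\<in>T. cscale (c vs) (bas vs)) = (\<Sum>vs\<in>T. cscale (c vs) (\<Psi> (map bas vs))) \<and>
      (\<Sum>vs\<in>T. cscale (c vs) (bas vs)) \<in> (tensor Xs :: (_ \<Rightarrow>\<^sub>0 'k) set)"
    if "finite T" "T \<subseteq> Poly_Mapping.keys x" for T c
    using that
  proof (induction T rule: finite_induct)
    case empty
    then show ?case using h0 by (simp add: tensor_def)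
  next
    case (insert v T)
    have v: "bas v \<in> (tensor Xs :: (_ \<Rightarrow>\<^sub>0 'k) set)" "h' (bas v) = \<Psi> (map bas v)"
      using hb insert.prems by auto
    have IH: "h' (\<Sum>vs\<in>T. cscale (c vs) (bas vs)) = (\<Sum>vs\<in>T. cscale (c vs) (\<Psi> (map bas vs)))"
      "(\<Sum>vs\<in>T. cscale (c vs) (bas vs)) \<in> (tensor Xs :: (_ \<Rightarrow>\<^sub>0 'k) set)"
      using insert.IH insert.prems by auto
    have "h' (cscale (c v) (bas v) + (\<Sum>vs\<in>T. cscale (c vs) (bas vs))) =
        cscale (c v) (h' (bas v)) + h' (\<Sum>vs\<in>T. cscale (c vs) (bas vs))"
      using hadd[OF sub[OF v(1), of "c v"] IH(2)] hscl[OF v(1), of "c v"] by simp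
    then show ?case using insert.hyps suba[OF sub[OF v(1)] IH(2)] v(2) IH(1) by simp
  qed
  from this[OF finite_keys order_refl, of "Poly_Mapping.lookup x"]
  show "h' x = ?h x" using lin_ext_bas_id[of x] by (simp add: lin_ext_def)
qed

end


section \<open>The quotient by a monomial ideal\<close>

context quiver_ideal begin

lemma lookup_nf: "Poly_Mapping.lookup (nf x) v = (if v \<in> nonzero_paths then Poly_Mapping.lookup x v else 0)"
proof -
  have "Poly_Mapping.lookup (nf x) v = (\<Sum>u\<in>Poly_Mapping.keys x.
      if u = v then (if v \<in> nonzero_paths then Poly_Mapping.lookup x v else 0) else 0)"
    unfolding nf_def lin_ext_def lookup_sum
    by (intro sum.cong refl) (auto simp: bas_def lookup_single when_def)
  then show ?thesis by (simp add: in_keys_iff)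
qed

lemma keys_nf: "Poly_Mapping.keys (nf x) = Poly_Mapping.keys x \<inter> nonzero_paths"
  by (auto simp: in_keys_iff lookup_nf split: if_splits)

lemma carrier_A: "carrier A = {x. Poly_Mapping.keys x \<subseteq> nonzero_paths}"
  by (simp add: A_def)

lemma nf_id: "x \<in> carrier A \<Longrightarrow> nf x = x"
  by (rule poly_mapping_eqI) (auto simp: lookup_nf carrier_A in_keys_iff)

lemma A_sub: "carrier A \<subseteq> carrier path_algebra"
  by (auto simp: carrier_A carrier_pa nonzero_paths_def)

lemma nf_closed: "nf x \<in> carrier A"
  by (simp add: keys_nf carrier_A)

lemma nf_add: "nf (x + y) = nf x + nf y" and nf_minus: "nf (x - y) = nf x - nf y"
  by (simp_all add: nf_def lin_ext_add lin_ext_minus)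

end

context monomial_algebra begin

lemma ideal_I: "ideal I path_algebra"
proof -
  obtain S where S: "S \<subseteq> paths" "I = Idl\<^bsub>path_algebra\<^esub> (bas ` S)"
    using generated_by_paths by blast
  then have "bas ` S \<subseteq> carrier path_algebra" by (auto simp: carrier_pa)
  then show ?thesis unfolding S(2) by (rule ring.genideal_ideal[OF ring_path_algebra])
qed

lemma I_add: "x \<in> I \<Longrightarrow> y \<in> I \<Longrightarrow> x + y \<in> I"
  using additive_subgroup.a_closed[OF ideal.axioms(1)[OF ideal_I], of x y]
  by (simp add: path_algebra_def)

lemma I_zero: "0 \<in> I"
  using additive_subgroup.zero_closed[OF ideal.axioms(1)[OF ideal_I]]
  by (simp add: path_algebra_def)

lemma I_carr: "x \<in> I \<Longrightarrow> x \<in> carrier path_algebra"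
  using ideal.Icarr[OF ideal_I] .

lemma I_cscale_bas:
  assumes "bas v \<in> I" shows "cscale c (bas v) \<in> I"
proof -
  have v: "v \<in> paths" using I_carr[OF assms] by (simp add: carrier_pa)
  have "cscale c (bas (trivial (src v))) \<otimes>\<^bsub>path_algebra\<^esub> bas v = cscale c (bas v)"
    by (simp add: pmul_def lin_ext_cscale path_mult_def)
  moreover have "cscale c (bas (trivial (src v)) :: _ \<Rightarrow>\<^sub>0 'k) \<in> carrier path_algebra"
    using keys_cscale[of c "bas (trivial (src v)) :: _ \<Rightarrow>\<^sub>0 'k"] path_in_verts[OF v]
    by (auto simp: carrier_pa)
  ultimately show ?thesis using ideal.I_l_closed[OF ideal_I assms] by metis
qed

lemma I_sum: "(\<And>i. i \<in> T \<Longrightarrow> x i \<in> I) \<Longrightarrow> (\<Sum>i\<in>T. x i) \<in> I"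
  by (induction T rule: infinite_finite_induct) (auto intro: I_add I_zero)

lemma I_pcat:
  assumes "p \<in> paths" "q \<in> paths" "trg p = src q" "bas p \<in> I \<or> bas q \<in> I"
  shows "bas (pcat p q) \<in> I"
proof -
  have "bas p \<otimes>\<^bsub>path_algebra\<^esub> bas q \<in> I"
    using assms ideal.I_l_closed[OF ideal_I, of "bas q" "bas p"]
      ideal.I_r_closed[OF ideal_I, of "bas p" "bas q"] by (auto simp: carrier_pa simp del: pmul_bas)
  then show ?thesis using assms(3) by (simp add: path_mult_def)
qed

lemma keys_path_mult: "r \<in> Poly_Mapping.keys (path_mult p q :: _ \<Rightarrow>\<^sub>0 'k) \<Longrightarrow> trg p = src q \<and> r = pcat p q"
  by (auto simp: path_mult_def split: if_splits)

lemma keys_pmul: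
  fixes x y :: "('a, 'b) qpath \<Rightarrow>\<^sub>0 'k"
  assumes "r \<in> Poly_Mapping.keys (x \<otimes>\<^bsub>path_algebra\<^esub> y)"
  obtains p q where "p \<in> Poly_Mapping.keys x" "q \<in> Poly_Mapping.keys y" "trg p = src q" "r = pcat p q"
proof -
  have "Poly_Mapping.keys (x \<otimes>\<^bsub>path_algebra\<^esub> y) \<subseteq>
    (\<Union>p\<in>Poly_Mapping.keys x. \<Union>q\<in>Poly_Mapping.keys y. Poly_Mapping.keys (path_mult p q :: _ \<Rightarrow>\<^sub>0 'k))"
    unfolding pmul_def by (intro order_trans[OF keys_lin_ext] UN_mono order_refl keys_lin_ext)
  from subsetD[OF this assms] show thesis
  proof (elim UN_E)
    fix p q assume "p \<in> Poly_Mapping.keys x" "q \<in> Poly_Mapping.keys y"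
      and "r \<in> Poly_Mapping.keys (path_mult p q :: _ \<Rightarrow>\<^sub>0 'k)"
    then show thesis using that keys_path_mult[of r p q] by simp
  qed
qed

lemma I_iff: "x \<in> I \<longleftrightarrow> (\<forall>v\<in>Poly_Mapping.keys x. v \<in> paths \<and> bas v \<in> I)"
proof
  define K :: "(('a, 'b) qpath \<Rightarrow>\<^sub>0 'k) set"
    where "K = {x. \<forall>v\<in>Poly_Mapping.keys x. v \<in> paths \<and> bas v \<in> I}"
  have "ideal K path_algebra"
  proof (rule idealI[OF ring_path_algebra])
    have carr: "K \<subseteq> carrier path_algebra" by (auto simp: K_def carrier_pa)
    interpret R: ring "path_algebra :: (('a, 'b) qpath \<Rightarrow>\<^sub>0 'k) ring" by (rule ring_path_algebra)
    show "subgroup K (add_monoid path_algebra)"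
    proof (rule R.add.subgroupI)
      show "K \<noteq> {}" unfolding K_def by (auto intro!: exI[of _ 0])
    next
      fix x assume x: "x \<in> K"
      have "- x = \<ominus>\<^bsub>path_algebra\<^esub> x"
        by (rule sym, rule R.minus_equality)
          (use x carr in \<open>auto simp: path_algebra_def K_def in_keys_iff\<close>)
      then show "\<ominus>\<^bsub>path_algebra\<^esub> x \<in> K" using x by (simp add: K_def in_keys_iff flip: \<open>- x = _\<close>)
    next
      fix x y assume "x \<in> K" "y \<in> K"
      then show "x \<oplus>\<^bsub>path_algebra\<^esub> y \<in> K"
        using Poly_Mapping.keys_add[of x y] by (auto simp: K_def path_algebra_def)
    qed (use carr in simp)
  next
    fix a x :: "('a, 'b) qpath \<Rightarrow>\<^sub>0 'k" assume a: "a \<in> K" "x \<in> carrier path_algebra"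
    have "r \<in> paths \<and> bas r \<in> I" if "r \<in> Poly_Mapping.keys (x \<otimes>\<^bsub>path_algebra\<^esub> a)" for r
    proof -
      obtain p q where pq: "p \<in> Poly_Mapping.keys x" "q \<in> Poly_Mapping.keys a" "trg p = src q" "r = pcat p q"
        using \<open>r \<in> _\<close> by (rule keys_pmul)
      then have "p \<in> paths" "q \<in> paths" "bas q \<in> I" using a by (auto simp: K_def carrier_pa)
      then show ?thesis using pq by (simp add: I_pcat pcat_paths)
    qed
    then show "x \<otimes>\<^bsub>path_algebra\<^esub> a \<in> K" by (simp add: K_def)
    have "r \<in> paths \<and> bas r \<in> I" if "r \<in> Poly_Mapping.keys (a \<otimes>\<^bsub>path_algebra\<^esub> x)" for r
    proof -
      obtain p q where pq: "p \<in> Poly_Mapping.keys a" "q \<in> Poly_Mapping.keys x" "trg p = src q" "r = pcat p q"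
        using \<open>r \<in> _\<close> by (rule keys_pmul)
      then have "p \<in> paths" "q \<in> paths" "bas p \<in> I" using a by (auto simp: K_def carrier_pa)
      then show ?thesis using pq by (simp add: I_pcat pcat_paths)
    qed
    then show "a \<otimes>\<^bsub>path_algebra\<^esub> x \<in> K" by (simp add: K_def)
  qed
  moreover obtain S where S: "S \<subseteq> paths" "I = Idl\<^bsub>path_algebra\<^esub> (bas ` S)"
    using generated_by_paths by blast
  moreover have "bas ` S \<subseteq> I" 
    unfolding S(2) using S(1) by (intro ring.genideal_self ring_path_algebra) (auto simp: carrier_pa)
  then have "bas ` S \<subseteq> K" using S(1) by (auto simp: K_def)
  ultimately have "I \<subseteq> K" using ring.genideal_minimal[OF ring_path_algebra] by metis
  then show "x \<in> I \<Longrightarrow> \<forall>v\<in>Poly_Mapping.keys x. v \<in> paths \<and> bas v \<in> I" by (auto simp: K_def)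
next
  assume "\<forall>v\<in>Poly_Mapping.keys x. v \<in> paths \<and> bas v \<in> I"
  then have "lin_ext bas x \<in> I" unfolding lin_ext_def by (auto intro!: I_sum I_cscale_bas)
  then show "x \<in> I" by (simp add: lin_ext_bas_id)
qed

lemma I_iff_nf: "x \<in> I \<longleftrightarrow> x \<in> carrier path_algebra \<and> nf x = 0"
proof -
  have "nf x = 0 \<longleftrightarrow> (\<forall>v\<in>Poly_Mapping.keys x. v \<notin> nonzero_paths)"
    using keys_nf[of x] keys_eq_empty[of "nf x"] by blast
  then show ?thesis
    unfolding I_iff[of x] carrier_pa nonzero_paths_def by blast
qed

lemma nf_mult:
  assumes "x \<in> carrier path_algebra" "y \<in> carrier path_algebra"
  shows "nf (nf x \<otimes>\<^bsub>path_algebra\<^esub> nf y) = nf (x \<otimes>\<^bsub>path_algebra\<^esub> y)"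
proof -
  interpret R: ring "path_algebra :: (('a, 'b) qpath \<Rightarrow>\<^sub>0 'k) ring" by (rule ring_path_algebra)
  have c: "nf z \<in> carrier path_algebra" for z using nf_closed A_sub by blast
  have d: "z - nf z \<in> I" if "z \<in> carrier path_algebra" for z
  proof -
    have "Poly_Mapping.keys (z - nf z) \<subseteq> Poly_Mapping.keys z" by (auto simp: in_keys_iff lookup_minus lookup_nf split: if_splits)
    then show ?thesis using that nf_id[OF nf_closed, of z] by (auto simp: I_iff_nf nf_minus carrier_pa)
  qed
  have "x \<otimes>\<^bsub>path_algebra\<^esub> y =
      ((x - nf x) \<otimes>\<^bsub>path_algebra\<^esub> y + nf x \<otimes>\<^bsub>path_algebra\<^esub> (y - nf y))
      + nf x \<otimes>\<^bsub>path_algebra\<^esub> nf y"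
    using pmul_add_left[of "x - nf x" "nf x" y] pmul_add_right[of "nf x" "y - nf y" "nf y"]
    by (simp add: add.assoc)
  moreover have "(x - nf x) \<otimes>\<^bsub>path_algebra\<^esub> y + nf x \<otimes>\<^bsub>path_algebra\<^esub> (y - nf y) \<in> I"
    using assms c d by (intro I_add ideal.I_l_closed[OF ideal_I] ideal.I_r_closed[OF ideal_I])
  ultimately show ?thesis by (simp add: nf_add I_iff_nf)
qed

theorem ring_A: "ring A"
proof (rule ringI)
  show "abelian_group A"
  proof (rule abelian_groupI)
    fix x assume "x \<in> carrier A"
    then show "\<exists>y\<in>carrier A. y \<oplus>\<^bsub>A\<^esub> x = \<zero>\<^bsub>A\<^esub>"
      by (intro bexI[of _ "- x"]) (auto simp: A_def in_keys_iff)
  next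
    fix x y assume "x \<in> carrier A" "y \<in> carrier A"
    then show "x \<oplus>\<^bsub>A\<^esub> y \<in> carrier A"
      using Poly_Mapping.keys_add[of x y] by (auto simp: A_def)
  qed (auto simp: A_def algebra_simps)
next
  have m: "x \<otimes>\<^bsub>A\<^esub> y = nf (x \<otimes>\<^bsub>path_algebra\<^esub> y)" for x y by (simp add: A_def)
  have s: "x \<in> carrier A \<Longrightarrow> x \<in> carrier path_algebra" for x using A_sub by blast
  interpret R: ring "path_algebra :: (('a, 'b) qpath \<Rightarrow>\<^sub>0 'k) ring" by (rule ring_path_algebra)
  show "monoid A"
  proof (rule monoidI)
    fix x y z assume a: "x \<in> carrier A" "y \<in> carrier A" "z \<in> carrier A"
    have "nf (nf (x \<otimes>\<^bsub>path_algebra\<^esub> y) \<otimes>\<^bsub>path_algebra\<^esub> z) = nf (nf (x \<otimes>\<^bsub>path_algebra\<^esub> y) \<otimes>\<^bsub>path_algebra\<^esub> nf z)" by (simp add: nf_id a)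
    also have "\<dots> = nf (x \<otimes>\<^bsub>path_algebra\<^esub> y \<otimes>\<^bsub>path_algebra\<^esub> z)" using a s by (intro nf_mult) auto
    also have "\<dots> = nf (x \<otimes>\<^bsub>path_algebra\<^esub> (y \<otimes>\<^bsub>path_algebra\<^esub> z))" by (simp add: pmul_assoc)
    also have "\<dots> = nf (nf x \<otimes>\<^bsub>path_algebra\<^esub> nf (y \<otimes>\<^bsub>path_algebra\<^esub> z))" using a s by (intro nf_mult[symmetric]) auto
    finally show "x \<otimes>\<^bsub>A\<^esub> y \<otimes>\<^bsub>A\<^esub> z = x \<otimes>\<^bsub>A\<^esub> (y \<otimes>\<^bsub>A\<^esub> z)" by (simp add: m nf_id a)
  next
    fix x assume a: "x \<in> carrier A"
    have "nf (nf \<one>\<^bsub>path_algebra\<^esub> \<otimes>\<^bsub>path_algebra\<^esub> nf x) = x" using a s by (subst nf_mult) (auto simp: nf_id)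
    then show "\<one>\<^bsub>A\<^esub> \<otimes>\<^bsub>A\<^esub> x = x" using a by (simp add: m nf_id) (simp add: A_def)
    have "nf (nf x \<otimes>\<^bsub>path_algebra\<^esub> nf \<one>\<^bsub>path_algebra\<^esub>) = x" using a s by (subst nf_mult) (auto simp: nf_id)
    then show "x \<otimes>\<^bsub>A\<^esub> \<one>\<^bsub>A\<^esub> = x" using a by (simp add: m nf_id) (simp add: A_def)
  next
    show "\<one>\<^bsub>A\<^esub> \<in> carrier A" using nf_closed by (simp add: A_def)
  qed (simp add: m nf_closed)
next
  fix x y z
  show "(x \<oplus>\<^bsub>A\<^esub> y) \<otimes>\<^bsub>A\<^esub> z = x \<otimes>\<^bsub>A\<^esub> z \<oplus>\<^bsub>A\<^esub> y \<otimes>\<^bsub>A\<^esub> z"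
    "z \<otimes>\<^bsub>A\<^esub> (x \<oplus>\<^bsub>A\<^esub> y) = z \<otimes>\<^bsub>A\<^esub> x \<oplus>\<^bsub>A\<^esub> z \<otimes>\<^bsub>A\<^esub> y"
    by (simp_all add: A_def pmul_add_left pmul_add_right nf_add)
qed

theorem nf_hom: "nf \<in> ring_hom path_algebra A"
proof (rule ring_hom_memI)
  fix x y :: "('a, 'b) qpath \<Rightarrow>\<^sub>0 'k"
  assume "x \<in> carrier path_algebra" "y \<in> carrier path_algebra"
  then show "nf (x \<otimes>\<^bsub>path_algebra\<^esub> y) = nf x \<otimes>\<^bsub>A\<^esub> nf y" by (simp add: A_def nf_mult)
  show "nf (x \<oplus>\<^bsub>path_algebra\<^esub> y) = nf x \<oplus>\<^bsub>A\<^esub> nf y"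
    using nf_add[of x y] by (simp add: A_def path_algebra_def)
qed (auto simp: nf_closed, simp add: A_def)

theorem nf_surj: "nf ` carrier path_algebra = carrier A"
proof
  show "carrier A \<subseteq> nf ` carrier path_algebra"
  proof
    fix x assume "x \<in> carrier A"
    then show "x \<in> nf ` carrier path_algebra"
      using nf_id[of x] A_sub by (intro image_eqI[of x nf x]) auto
  qed
qed (auto simp: nf_closed)

theorem nf_kernel: "a_kernel path_algebra A nf = I"
proof -
  have "a_kernel path_algebra A nf = {x \<in> carrier path_algebra. nf x = \<zero>\<^bsub>A\<^esub>}"
    by (rule a_kernel_def')
  also have "\<dots> = I" unfolding set_eq_iff mem_Collect_eq I_iff_nf by (simp add: A_def)
  finally show ?thesis .
qed

theorem quotient_iso: "path_algebra Quot I \<simeq> A"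
  using ring_hom_ring.FactRing_iso[OF ring_hom_ringI2[OF ring_path_algebra ring_A nf_hom] nf_surj]
  by (simp add: nf_kernel)

end

end

theory Submission
  imports Defs
begin

text \<open>
  Write \<open>D\<close> for the derivation of \<open>A\<close> with \<open>D v = C(\<alpha>, v) v\<close> on paths.  Under \<open>G\<^sub>1\<close> the cochain
  \<open>\<delta>\<^sub>\<alpha>\<close> becomes \<open>D\<close> (\<open>delta_G\<close>), so on a term \<open>1 \<otimes> v\<^sub>1 \<otimes> \<dots> \<otimes> v\<^sub>n \<otimes> b\<close> of \<open>F\<^sub>n(1 \<otimes> w \<otimes> 1)\<close> the
  product \<open>\<delta>\<^sub>\<alpha> \<circ> f\<close> applies \<open>D\<close> to the value of \<open>f \<circ> G\<^sub>n\<close>, while \<open>f \<circ> \<delta>\<^sub>\<alpha>\<close> multiplies that value by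
  \<open>C(\<alpha>, v\<^sub>1) + \<dots> + C(\<alpha>, v\<^sub>n)\<close>.  Every term satisfies \<open>v\<^sub>1 \<cdots> v\<^sub>n b = w\<close> in the path algebra
  (\<open>keys_F_gen\<close>), and the Leibniz rule for the right factor \<open>b\<close> supplies the missing count
  \<open>C(\<alpha>, b)\<close>.  Hence the bracket is \<open>D x - C(\<alpha>, w) x\<close> for \<open>x = f(G\<^sub>n(F\<^sub>n(1 \<otimes> w \<otimes> 1)))\<close>, and what
  remains is \<open>G\<^sub>n \<circ> F\<^sub>n = id\<close> on generators (\<open>G_F_gen\<close>).

  That identity is combinatorial.  On a path of length \<open>l\<close> let \<open>\<epsilon>(y)\<close> be the end of the shortest
  subpath in \<open>I\<close> that starts at position \<open>y\<close>, or \<open>\<infinity>\<close> if there is none.  Choosing relations with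
  minimal start in an \<open>n\<close>-concatenation amounts to iterating \<open>\<epsilon>\<close>: the elements of \<open>AP\<^sub>n\<close> that occur
  at \<open>x\<close> are governed by the sequence \<open>x, x + 1, \<epsilon>(x), \<epsilon>(x + 1), \<epsilon>(\<epsilon>(x)), \<dots>\<close>, which has to be
  strictly increasing up to the entry after the \<open>n\<close>-th, and the \<open>n\<close>-th entry is the end of the
  occurrence (\<open>AP_iff\<close>, \<open>occs_AP\<close>).  Since \<open>\<epsilon>\<close> is monotone, everything about \<open>Sub(w)\<close> follows by
  comparing iterates of \<open>\<epsilon>\<close>: for odd \<open>n\<close> the set \<open>Sub(w)\<close> has just two elements, a prefix and a
  suffix of \<open>w\<close> (\<open>odd_chain_subs\<close>), and for even \<open>n\<close> exactly one non-initial element of \<open>Sub(w)\<close>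
  leads to a product \<open>v\<^sub>1 v\<^sub>2\<close> in \<open>I\<close>, and that element is a suffix too (\<open>even_chain_good_sub\<close>).  By
  induction \<open>F\<^sub>n(1 \<otimes> w \<otimes> 1)\<close> has precisely one good term, it exhausts \<open>w\<close> (\<open>F_gen_good\<close>), and \<open>G\<^sub>n\<close>
  sends this term to \<open>1 \<otimes> w \<otimes> 1\<close> and all the others to zero.
\<close>

section \<open>Chains of shortest zero intervals\<close>

text \<open>
  \<open>Z i j\<close> stands for: the subpath between the positions \<open>i\<close> and \<open>j\<close> of a fixed path of length \<open>l\<close>
  lies in \<open>I\<close>.  Only the two properties below of a monomial ideal matter for the chains.
\<close>

locale zero_intervals =
  fixes Z :: "nat \<Rightarrow> nat \<Rightarrow> bool" and l :: nat
  assumes Z_bounds: "Z i j \<Longrightarrow> i + 2 \<le> j \<and> j \<le> l"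
    and Z_mono: "Z i j \<Longrightarrow> i' \<le> i \<Longrightarrow> j \<le> j' \<Longrightarrow> j' \<le> l \<Longrightarrow> Z i' j'"
begin

text \<open>
  The value \<open>Suc l\<close> plays the role of infinity.  It is a fixed point of \<open>first_end\<close>, so that the
  iterates stay in \<open>{0..Suc l}\<close> and a strict inequality \<open>a < b\<close> implies that \<open>a\<close> is finite.
\<close>

definition first_end :: "nat \<Rightarrow> nat" where
  "first_end y = (if \<exists>z. Z y z then LEAST z. Z y z else Suc l)"

text \<open>
  The \<open>n\<close>-th entry of \<open>x, x + 1, \<epsilon>(x), \<epsilon>(x + 1), \<epsilon>(\<epsilon>(x)), \<dots>\<close> for \<open>\<epsilon> = first_end\<close>: the two
  interleaved orbits of \<open>x\<close> and \<open>x + 1\<close>.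
\<close>

definition pos :: "nat \<Rightarrow> nat \<Rightarrow> nat" where
  "pos n x = (first_end ^^ (n div 2)) (x + n mod 2)"

definition occ :: "nat \<Rightarrow> (nat \<times> nat) set" where
  "occ n = {(x, y). y = pos n x \<and> y \<le> l \<and> (\<forall>j\<le>n. pos j x < pos (Suc j) x)}"

lemma first_end_le_iff: "z \<le> l \<Longrightarrow> first_end y \<le> z \<longleftrightarrow> Z y z"
proof
  assume z: "z \<le> l" and "first_end y \<le> z"
  then have ex: "\<exists>z. Z y z" by (auto simp: first_end_def split: if_splits)
  then have "Z y (first_end y)" by (auto simp: first_end_def intro: LeastI)
  then show "Z y z" using Z_mono \<open>first_end y \<le> z\<close> z by blast
next
  assume "Z y z" then show "first_end y \<le> z" by (auto simp: first_end_def intro: Least_le)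
qed

lemma first_end_le: "first_end y \<le> Suc l"
proof (cases "first_end y \<le> l")
  case False
  then have "\<not> Z y z" for z using Z_bounds[of y z] first_end_le_iff[of z y] by force
  then show ?thesis by (simp add: first_end_def)
qed simp

lemma first_end_eq_or: "first_end y \<le> l \<or> first_end y = Suc l"
  using first_end_le[of y] by linarith

lemma first_end_mono: "x \<le> y \<Longrightarrow> first_end x \<le> first_end y"
  using first_end_eq_or[of y] first_end_le[of x] first_end_le_iff[of "first_end y" y] first_end_le_iff[of "first_end y" x] Z_mono[of y "first_end y" x "first_end y"]
  by auto

lemma first_end_finite: "first_end y \<le> l \<Longrightarrow> y + 2 \<le> first_end y"
  using first_end_le_iff[of "first_end y" y] Z_bounds[of y "first_end y"] by auto

lemma first_end_ge: "y \<le> Suc l \<Longrightarrow> y \<le> first_end y"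
  using first_end_eq_or[of y] first_end_finite[of y] by auto

lemma first_end_infinity [simp]: "first_end (Suc l) = Suc l"
  using first_end_ge[of "Suc l"] first_end_le[of "Suc l"] by simp

lemma iter_mono: "x \<le> y \<Longrightarrow> (first_end ^^ k) x \<le> (first_end ^^ k) y"
  by (induction k) (auto intro: first_end_mono)

lemma iter_infinity [simp]: "(first_end ^^ k) (Suc l) = Suc l"
  by (induction k) auto

lemma iter_finite: "(first_end ^^ k) x \<le> l \<Longrightarrow> x \<le> l"
  using iter_mono[of "Suc l" x k] by (cases "x \<le> l") auto

lemma pos_0 [simp]: "pos 0 x = x" and pos_1 [simp]: "pos (Suc 0) x = Suc x"
  and pos_Suc_Suc [simp]: "pos (Suc (Suc n)) x = first_end (pos n x)"
  by (simp_all add: pos_def)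

lemma pos_mono: "x \<le> y \<Longrightarrow> pos n x \<le> pos n y"
  by (simp add: pos_def iter_mono)

text \<open>
  Monotonicity of \<open>first_end\<close> makes strictness propagate downwards two steps at a time, so that the
  last two strict inequalities already imply all the others.
\<close>

lemma occ_iff:
  "(x, y) \<in> occ n \<longleftrightarrow> y = pos n x \<and> y \<le> l \<and> y < pos (Suc n) x \<and> (0 < n \<longrightarrow> pos (n - 1) x < y)"
proof
  assume r: "y = pos n x \<and> y \<le> l \<and> y < pos (Suc n) x \<and> (0 < n \<longrightarrow> pos (n - 1) x < y)"
  have "pos j x < pos (Suc j) x" if "j \<le> n" for j
    using that
  proof (induction "n - j" arbitrary: j rule: less_induct)
    case less
    consider "j = n" | "j = n - 1" "0 < n" | "j + 2 \<le> n" using less.prems by linarith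
    then show ?case
    proof cases
      case 3
      then have "pos (j + 2) x < pos (Suc (j + 2)) x" by (intro less.hyps) auto
      then show ?thesis using first_end_mono[of "pos (Suc j) x" "pos j x"] by (auto simp: not_le[symmetric])
    qed (use r in auto)
  qed
  then show "(x, y) \<in> occ n" using r by (simp add: occ_def)
next
  assume "(x, y) \<in> occ n"
  then show "y = pos n x \<and> y \<le> l \<and> y < pos (Suc n) x \<and> (0 < n \<longrightarrow> pos (n - 1) x < y)"
    by (cases n) (auto simp: occ_def)
qed

lemma pos_ge: "x \<le> Suc l \<Longrightarrow> pos n x \<le> l \<Longrightarrow> x \<le> pos n x"
proof (induction n rule: induct_nat_012)
  case (ge2 n)
  then show ?case using first_end_eq_or[of "pos n x"] first_end_finite[of "pos n x"] by auto
qed auto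

lemma occ_bounds: "(x, y) \<in> occ n \<Longrightarrow> x \<le> y \<and> y \<le> l"
  using pos_ge[of x n] iter_finite[of "n div 2" "x + n mod 2"] by (auto simp: occ_iff pos_def)

lemma occ_even_iff:
  "(x, y) \<in> occ (2 * k) \<longleftrightarrow> y = (first_end ^^ k) x \<and> y \<le> l \<and> y < (first_end ^^ k) (Suc x) \<and>
     (0 < k \<longrightarrow> (first_end ^^ (k - 1)) (Suc x) < y)"
  unfolding occ_iff by (cases k) (auto simp: pos_def)

lemma occ_odd_iff:
  "(x, y) \<in> occ (Suc (2 * k)) \<longleftrightarrow>
     y = (first_end ^^ k) (Suc x) \<and> y \<le> l \<and> y < (first_end ^^ Suc k) x \<and> (first_end ^^ k) x < y"
  unfolding occ_iff by (auto simp: pos_def)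

text \<open>
  For even \<open>n\<close> the end of an occurrence at \<open>x > 0\<close> would be no earlier than the entry after the end
  of the chain from \<open>0\<close>, and that entry is infinite; for odd \<open>n\<close> its last entry but one would already
  be at least \<open>l\<close>.
\<close>

lemma occ_whole_unique:
  assumes "(0, l) \<in> occ n" shows "occ n = {(0, l)}"
proof -
  have "x = 0 \<and> y = l" if xy: "(x, y) \<in> occ n" for x y
  proof -
    have "x = 0"
    proof (rule ccontr)
      assume "x \<noteq> 0"
      obtain k where "n = 2 * k \<or> n = Suc (2 * k)" by (metis oddE evenE Suc_eq_plus1)
      then show False
      proof
        assume "n = 2 * k"
        then show False using xy assms iter_mono[of 1 x k] \<open>x \<noteq> 0\<close> by (auto simp: occ_even_iff)
      next
        assume "n = Suc (2 * k)"
        then show False using xy assms iter_mono[of 1 x k] \<open>x \<noteq> 0\<close> by (auto simp: occ_odd_iff)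
      qed
    qed
    then show ?thesis using xy assms by (auto simp: occ_iff)
  qed
  then show ?thesis using assms by auto
qed

text \<open>
  The second chain starts at the last position whose orbit still hits \<open>l\<close>; any other start \<open>x > 0\<close>
  either has the wrong end or violates strictness.
\<close>

lemma odd_chain_subs:
  assumes "(0, l) \<in> occ (Suc (2 * k))"
  obtains y where "0 < y" "\<not> Z 0 y" "occ (2 * k) = {(0, (first_end ^^ k) 0), (y, l)}"
proof -
  have h: "(first_end ^^ k) 1 = l" "l < (first_end ^^ Suc k) 0" "(first_end ^^ k) 0 < l"
    using assms by (auto simp: occ_odd_iff)
  define y where "y = (GREATEST x. (first_end ^^ k) x = l)"
  have b: "x \<le> l" if "(first_end ^^ k) x = l" for x using that iter_finite[of k x] by simp
  have y: "(first_end ^^ k) y = l" unfolding y_def by (rule GreatestI_nat[of _ 1 l]) (use h b in auto)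
  have max: "x \<le> y" if "(first_end ^^ k) x = l" for x
    unfolding y_def by (rule Greatest_le_nat[of _ _ l]) (use that b in auto)
  have "1 \<le> y" using max h by auto
  have "(first_end ^^ k) (Suc y) \<noteq> l" using max[of "Suc y"] by auto
  then have lt: "l < (first_end ^^ k) (Suc y)" using iter_mono[of y "Suc y" k] y by simp
  \<comment> \<open>Otherwise the orbit of \<open>0\<close> would stay finite one step longer than the given chain allows.\<close>
  have E0: "y < first_end 0"
  proof (rule ccontr)
    assume "\<not> y < first_end 0"
    then have "(first_end ^^ k) (first_end 0) \<le> l" using iter_mono[of "first_end 0" y k] y by simp
    then show False using h by (simp add: funpow_Suc_right del: funpow.simps)
  qed
  have "(first_end ^^ (k - 1)) (Suc y) < l" if "0 < k"
  proof -
    have "(first_end ^^ (k - 1)) (Suc y) \<le> (first_end ^^ (k - 1)) (first_end 0)" using E0 by (intro iter_mono) simp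
    also have "\<dots> = (first_end ^^ k) 0" using that by (cases k) (simp_all add: funpow_Suc_right del: funpow.simps)
    finally show ?thesis using h by simp
  qed
  then have yo: "(y, l) \<in> occ (2 * k)" using y lt by (simp add: occ_even_iff)
  have "pos j 0 < pos (Suc j) 0" if "j \<le> Suc (2 * k)" for j
    using assms that by (auto simp: occ_def)
  then have zo: "(0, (first_end ^^ k) 0) \<in> occ (2 * k)"
    using h by (auto simp: occ_def pos_def[of "2 * k"])
  have "x = y \<and> z = l" if xz: "(x, z) \<in> occ (2 * k)" "x \<noteq> 0" for x z
  proof -
    have x: "z = (first_end ^^ k) x" "z \<le> l" "z < (first_end ^^ k) (Suc x)" using xz by (auto simp: occ_even_iff)
    have "z = l" using x iter_mono[of 1 x k] h xz(2) by auto
    moreover from this have "x \<le> y" using max x by simp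
    moreover have "\<not> Suc x \<le> y" using iter_mono[of "Suc x" y k] x y \<open>z = l\<close> by auto
    ultimately show ?thesis by simp
  qed
  moreover have "z = (first_end ^^ k) 0" if "(0, z) \<in> occ (2 * k)" for z using that by (simp add: occ_even_iff)
  ultimately have "p \<in> {(0, (first_end ^^ k) 0), (y, l)}" if "p \<in> occ (2 * k)" for p
    using that by (cases p; cases "fst p = 0") auto
  then have "occ (2 * k) = {(0, (first_end ^^ k) 0), (y, l)}" using yo zo by auto
  moreover have "\<not> Z 0 y" using E0 first_end_le_iff[of y 0] b[OF y] by auto
  ultimately show thesis using that[of y] \<open>1 \<le> y\<close> by auto
qed

text \<open>
  Here \<open>x'\<close> ranges over the starts of the \<open>(2k + 1)\<close>-chains and \<open>y\<close> is the start of the last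
  \<open>2k\<close>-chain inside, as in \<open>odd_chain_subs\<close>; \<open>Z 0 y\<close> is the condition that the first two factors of
  the corresponding term of \<open>F\<close> multiply to zero.  It forces \<open>y\<close> beyond \<open>first_end 0\<close>, whose orbit ends
  at \<open>l\<close>, and so the \<open>(2k + 1)\<close>-chain must end at \<open>l\<close>, which determines its start.
\<close>

lemma even_chain_good_sub:
  assumes "(0, l) \<in> occ (Suc (Suc (2 * k)))"
  obtains x where "0 < x" "\<not> Z 0 x" "(x, l) \<in> occ (Suc (2 * k))" "\<exists>z. (0, z) \<in> occ (Suc (2 * k))"
    "\<forall>x' z y. (x', z) \<in> occ (Suc (2 * k)) \<and> (y, z) \<in> occ (2 * k) \<and> x' < y \<longrightarrow>
       (Z 0 y \<longleftrightarrow> x' = x)"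
proof -
  have "(0, l) \<in> occ (2 * Suc k)" using assms by simp
  then have h: "(first_end ^^ k) (first_end 0) = l" "l < (first_end ^^ Suc k) 1" "(first_end ^^ k) 1 < l"
    unfolding occ_even_iff by (auto simp: funpow_Suc_right simp del: funpow.simps)
  define x where "x = (GREATEST x. (first_end ^^ k) x < l)"
  have b: "x \<le> l" if "(first_end ^^ k) x < l" for x using that iter_finite[of k x] by simp
  have x: "(first_end ^^ k) x < l" unfolding x_def by (rule GreatestI_nat[of _ 1 l]) (use h b in auto)
  have max: "x' \<le> x" if "(first_end ^^ k) x' < l" for x'
    unfolding x_def by (rule Greatest_le_nat[of _ _ l]) (use that b in auto)
  have "1 \<le> x" using max h by auto
  have E0: "x < first_end 0"
    using x h(1) iter_mono[of "first_end 0" x k] by (cases "x < first_end 0") auto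
  have "(first_end ^^ k) (Suc x) \<le> l" using E0 h(1) iter_mono[of "Suc x" "first_end 0" k] by simp
  moreover have "\<not> (first_end ^^ k) (Suc x) < l" using max[of "Suc x"] by auto
  ultimately have sx: "(first_end ^^ k) (Suc x) = l" by simp
  have "l < (first_end ^^ Suc k) x" using h(2) iter_mono[of 1 x "Suc k"] \<open>1 \<le> x\<close> by simp
  then have xo: "(x, l) \<in> occ (Suc (2 * k))" using sx x by (simp add: occ_odd_iff)
  have "(0, pos (Suc (2 * k)) 0) \<in> occ (Suc (2 * k))"
    using assms h by (auto simp: occ_def pos_def[of "Suc (2 * k)"])
  moreover have "Z 0 y \<longleftrightarrow> x' = x"
    if a: "(x', z) \<in> occ (Suc (2 * k))" "(y, z) \<in> occ (2 * k)" "x' < y" for x' z y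
  proof
    have y: "z = (first_end ^^ k) y" "z \<le> l" "z < (first_end ^^ k) (Suc y)" using a by (auto simp: occ_even_iff)
    have x': "z = (first_end ^^ k) (Suc x')" "(first_end ^^ k) x' < z" using a by (auto simp: occ_odd_iff)
    show "x' = x" if "Z 0 y"
    proof -
      have "first_end 0 \<le> y" using \<open>Z 0 y\<close> first_end_le_iff Z_bounds by blast
      then have "l \<le> z" using iter_mono[of "first_end 0" y k] h y by simp
      then have "z = l" using y by simp
      then have "x' \<le> x" using max x' by simp
      moreover have "\<not> Suc x' \<le> x" using iter_mono[of "Suc x'" x k] x x' \<open>z = l\<close> by auto
      ultimately show ?thesis by simp
    qed
    show "Z 0 y" if "x' = x"
    proof -
      have "z = l" using that x' sx by simp
      have "first_end 0 \<le> y"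
        using iter_mono[of "Suc y" "first_end 0" k] y h \<open>z = l\<close> by (cases "Suc y \<le> first_end 0") auto
      moreover have "y \<le> l" using y iter_finite[of k y] by simp
      ultimately show ?thesis using first_end_le_iff by simp
    qed
  qed
  moreover have "\<not> Z 0 x" using E0 first_end_le_iff[of x 0] b[OF x] by auto
  ultimately show thesis using that[of x] \<open>1 \<le> x\<close> xo by auto
qed

definition minimal :: "(nat \<times> nat) set" where
  "minimal = {(i, j). Z i j \<and> (\<forall>i' j'. i \<le> i' \<and> j' \<le> j \<and> (i', j') \<noteq> (i, j) \<longrightarrow> \<not> Z i' j')}"

text \<open>
  Meaningful for finite \<open>first_end y\<close>: the interval from \<open>last_start y\<close> to \<open>first_end y\<close> is the
  first minimal zero interval that starts at or after \<open>y\<close>.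
\<close>

definition last_start :: "nat \<Rightarrow> nat" where
  "last_start y = (GREATEST i. Z i (first_end y))"

lemma last_start_props:
  assumes "first_end y \<le> l"
  shows "Z (last_start y) (first_end y)" "y \<le> last_start y" "Z i (first_end y) \<Longrightarrow> i \<le> last_start y"
proof -
  have Zy: "Z y (first_end y)" using assms first_end_le_iff by blast
  have b: "\<And>i. Z i (first_end y) \<Longrightarrow> i \<le> l" using Z_bounds by fastforce
  show "Z (last_start y) (first_end y)" unfolding last_start_def by (rule GreatestI_nat[of _ y l]) (use Zy b in auto)
  show "i \<le> last_start y" if "Z i (first_end y)" for i
    unfolding last_start_def by (rule Greatest_le_nat[of _ _ l]) (use that b in auto)
  then show "y \<le> last_start y" using Zy .
qed

text \<open>
  A condition on the start of a relation, as in the definition of concatenations, is turned into a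
  condition on \<open>first_end\<close> alone.
\<close>

lemma last_start_less_iff: "first_end y \<le> l \<Longrightarrow> last_start y < t \<longleftrightarrow> first_end y < first_end t"
  using last_start_props[of y] first_end_le_iff[of "first_end y" t] Z_mono[of "last_start y" "first_end y" t "first_end y"] 
  by (metis leI leD le_refl order_less_le_trans)

lemma last_start_minimal:
  assumes "first_end y \<le> l" shows "(last_start y, first_end y) \<in> minimal"
proof -
  have "i' = last_start y \<and> j' = first_end y" if "last_start y \<le> i'" "j' \<le> first_end y" "Z i' j'" for i' j'
  proof -
    have "Z i' (first_end y)" using Z_mono[OF that(3) le_refl that(2) assms] .
    then have "i' = last_start y" using last_start_props[OF assms] that(1) by (simp add: antisym)
    have "Z y j'" using Z_mono[OF that(3), of y j'] Z_bounds[OF that(3)] that(1) last_start_props(2)[OF assms] by auto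
    then have "first_end y \<le> j'" using first_end_le_iff Z_bounds by blast
    then show ?thesis using that \<open>i' = last_start y\<close> by simp
  qed
  then show ?thesis using last_start_props(1)[OF assms] by (auto simp: minimal_def)
qed

lemma minimal_last_start: "(i, j) \<in> minimal \<Longrightarrow> y \<le> i \<Longrightarrow> first_end y \<le> l \<and> last_start y \<le> i"
proof -
  assume a: "(i, j) \<in> minimal" "y \<le> i"
  then have Zj: "Z y j" "j \<le> l" "Z i j" using Z_mono[of i j y j] Z_bounds[of i j] by (auto simp: minimal_def)
  then have fin: "first_end y \<le> j" using first_end_le_iff by blast
  then have El: "first_end y \<le> l" using Zj fin by simp
  have "last_start y \<le> i"
  proof (rule ccontr)
    assume "\<not> last_start y \<le> i"
    then show False using a fin last_start_props(1)[OF El] unfolding minimal_def by fastforce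
  qed
  then show ?thesis using El by simp
qed

lemma minimal_inj: "(i, j) \<in> minimal \<Longrightarrow> (i, j') \<in> minimal \<Longrightarrow> j = j'"
  unfolding minimal_def by (cases j j' rule: linorder_cases) fastforce+

text \<open>
  One step of an \<open>n\<close>-concatenation: choosing the relation with minimal start in a window is the same
  as applying \<open>first_end\<close> to the left end of the window.
\<close>

lemma arg_min_minimal_iff:
  "is_arg_min fst (\<lambda>p. p \<in> minimal \<and> y \<le> fst p \<and> fst p < t) q \<longleftrightarrow>
   first_end y \<le> l \<and> q = (last_start y, first_end y) \<and> first_end y < first_end t"
proof
  assume a: "is_arg_min fst (\<lambda>p. p \<in> minimal \<and> y \<le> fst p \<and> fst p < t) q"
  obtain i j where q: "q = (i, j)" by (cases q)
  have ij: "(i, j) \<in> minimal" "y \<le> i" "i < t" using a by (auto simp: is_arg_min_def q)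
  have fin: "first_end y \<le> l" "last_start y \<le> i" using minimal_last_start[OF ij(1,2)] by auto
  have "\<not> last_start y < i"
    using a fin ij last_start_minimal[OF fin(1)] last_start_props(2)[OF fin(1)] unfolding is_arg_min_def q
    by (metis fst_conv less_trans)
  then have "i = last_start y" using fin by simp
  then have "j = first_end y" using minimal_inj[of i j] ij last_start_minimal[OF fin(1)] by blast
  then show "first_end y \<le> l \<and> q = (last_start y, first_end y) \<and> first_end y < first_end t"
    using fin q \<open>i = last_start y\<close> ij last_start_less_iff by auto
next
  assume a: "first_end y \<le> l \<and> q = (last_start y, first_end y) \<and> first_end y < first_end t"
  then have "q \<in> minimal" "y \<le> fst q" "fst q < t"
    using last_start_minimal last_start_props(2) last_start_less_iff by auto
  moreover have "fst q \<le> fst p" if "p \<in> minimal" "y \<le> fst p" for p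
    using minimal_last_start[of "fst p" "snd p" y] that a by auto
  ultimately show "is_arg_min fst (\<lambda>p. p \<in> minimal \<and> y \<le> fst p \<and> fst p < t) q"
    by (auto simp: is_arg_min_def not_less)
qed

lemma minimal_start_iff: "(x, j) \<in> minimal \<longleftrightarrow> first_end x \<le> l \<and> last_start x = x \<and> j = first_end x"
proof
  assume a: "(x, j) \<in> minimal"
  then have "first_end x \<le> l" "last_start x \<le> x" using minimal_last_start[of x j x] by auto
  moreover have "last_start x = x" using calculation last_start_props(2) by (simp add: antisym)
  ultimately show "first_end x \<le> l \<and> last_start x = x \<and> j = first_end x"
    using minimal_inj[OF a] last_start_minimal[of x] by auto
qed (use last_start_minimal in force)

end

text \<open>
  Cutting the ambient path replaces \<open>first_end\<close> by its truncation at the new end, and a chain inside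
  the smaller interval sees no difference.  So being a chain is intrinsic to the interval.
\<close>

lemma occ_restrict:
  assumes "zero_intervals Z l" "a \<le> b" "b \<le> l" 
    and Z': "\<And>i j. Z' i j \<longleftrightarrow> j \<le> b - a \<and> Z (a + i) (a + j)"
    and x: "y \<le> b - a"
  shows "(x, y) \<in> zero_intervals.occ Z' (b - a) n \<longleftrightarrow> (a + x, a + y) \<in> zero_intervals.occ Z l n"
proof -
  interpret T: zero_intervals Z l by fact
  interpret W: zero_intervals Z' "b - a"
  proof
    show "i + 2 \<le> j \<and> j \<le> b - a" if "Z' i j" for i j using that Z' T.Z_bounds[of "a + i" "a + j"] by auto
    show "Z' i' j'" if "Z' i j" "i' \<le> i" "j \<le> j'" "j' \<le> b - a" for i j i' j'
      using that Z' assms(2,3) T.Z_mono[of "a + i" "a + j" "a + i'" "a + j'"] by auto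
  qed
  have EE: "a + W.first_end y = min (T.first_end (a + y)) (Suc b)" for y
  proof -
    have "a + W.first_end y \<le> z \<longleftrightarrow> min (T.first_end (a + y)) (Suc b) \<le> z" if "z \<le> b" for z
    proof (cases "a \<le> z")
      case True
      have "a + W.first_end y \<le> z \<longleftrightarrow> W.first_end y \<le> z - a" using True by auto
      also have "\<dots> \<longleftrightarrow> Z (a + y) z" using True that by (subst W.first_end_le_iff) (auto simp: Z')
      also have "\<dots> \<longleftrightarrow> T.first_end (a + y) \<le> z" using that assms by (subst T.first_end_le_iff) auto
      finally show ?thesis using that by auto
    next
      case False
      have "z < T.first_end (a + y)" using False T.first_end_finite[of "a + y"] T.first_end_eq_or[of "a + y"] assms(2,3) by auto
      then show ?thesis using False that by auto
    qed
    moreover have "a + W.first_end y \<le> Suc b" using W.first_end_le[of y] assms(2) by simp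
    ultimately show ?thesis
      by (metis (no_types, opaque_lifting) le_SucE le_antisym le_refl min.cobounded2)
  qed
  have pos: "a + W.pos n x = min (T.pos n (a + x)) (Suc b)" if "x \<le> b - a" for n x
  proof (induction n rule: induct_nat_012)
    case (ge2 n)
    have "a + W.pos (Suc (Suc n)) x = min (T.first_end (a + W.pos n x)) (Suc b)" by (simp add: EE)
    also have "\<dots> = min (T.first_end (min (T.pos n (a + x)) (Suc b))) (Suc b)" using ge2 by simp
    also have "\<dots> = min (T.first_end (T.pos n (a + x))) (Suc b)"
    proof (cases "T.pos n (a + x) \<le> Suc b")
      case False
      have "Suc b \<le> T.first_end (Suc b)" using T.first_end_ge assms by simp
      moreover have "T.first_end (Suc b) \<le> T.first_end (T.pos n (a + x))" using False by (intro T.first_end_mono) auto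
      ultimately show ?thesis using False by (simp add: min_def)
    qed simp
    finally show ?case by simp
  qed (use that assms(2,3) in auto)
  show ?thesis
  proof (cases "x \<le> b - a")
    case True
    note p = pos[OF True]
    define u v where uv: "u = (\<lambda>n. W.pos n x)" "v = (\<lambda>n. T.pos n (a + x))"
    have p: "a + u n = min (v n) (Suc b)" for n using p by (simp add: uv)
    have "y = u n \<and> y \<le> b - a \<longleftrightarrow> a + y = v n" 
      using p[of n] x assms(2) by linarith
    moreover have "y < u (Suc n) \<longleftrightarrow> a + y < v (Suc n)"
      using p[of "Suc n"] x assms(2) by linarith
    moreover have "u (n - 1) < y \<longleftrightarrow> v (n - 1) < a + y"
      using p[of "n - 1"] x assms(2) by linarith
    ultimately show ?thesis
      unfolding W.occ_iff T.occ_iff uv(1)[THEN fun_cong, symmetric] uv(2)[THEN fun_cong, symmetric]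
      using x assms(2,3) by linarith
  next
    case False
    have "y \<noteq> W.pos n x" using W.iter_finite[of "n div 2" "x + n mod 2"] False x by (auto simp: W.pos_def)
    moreover have "a + y \<noteq> T.pos n (a + x)"
    proof
      assume e: "a + y = T.pos n (a + x)"
      have "T.pos n (Suc b) \<le> T.pos n (a + x)" using False by (intro T.pos_mono) auto
      moreover have "Suc b \<le> T.pos n (Suc b)" 
      proof -
        have "Suc b \<le> (T.first_end ^^ k) (Suc b)" for k
        proof (induction k)
          case (Suc k)
          then show ?case using T.first_end_ge[of "(T.first_end ^^ k) (Suc b)"] T.first_end_ge[of "Suc b"] T.first_end_mono[of "Suc b"] assms
            by (simp) (meson dual_order.trans)
        qed simp
        from this[of "n div 2"] show ?thesis
          unfolding T.pos_def using T.iter_mono[of "Suc b" "Suc b + n mod 2" "n div 2"] by linarith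
      qed
      ultimately show False using e x assms(2) by auto
    qed
    ultimately show ?thesis by (simp add: W.occ_iff T.occ_iff)
  qed
qed

section \<open>Subpaths and the sets \<open>AP\<^sub>n\<close>\<close>

lemma take_split: "i \<le> j \<Longrightarrow> take i xs @ drop i (take j xs) = take j xs"
  by (metis append_take_drop_id min.absorb1 take_take)

lemma drop_split:
  assumes "i \<le> j" "j \<le> k" "k \<le> length xs"
  shows "drop i (take j xs) @ drop j (take k xs) = drop i (take k xs)"
proof -
  have "drop i (take k xs) = drop i (take j xs @ drop j (take k xs))"
    using assms by (simp only: take_split)
  then show ?thesis using assms by simp
qed

context wf_digraph
begin

definition vtx :: "('a, 'b) qpath \<Rightarrow> nat \<Rightarrow> 'a" where
  "vtx T i = awlast (fst T) (take i (snd T))"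

lemma paths_iff: "T \<in> paths \<longleftrightarrow>
    fst T \<in> verts G \<and> set (snd T) \<subseteq> arcs G \<and> cas (fst T) (snd T) (awlast (fst T) (snd T))"
  by (simp add: paths_def awalk_def src_def trg_def)

lemma awlast_Cons: "awlast u (e # p) = awlast (head G e) p"
  by (cases p) auto

lemma awalk_verts_nth: "cas u p v \<Longrightarrow> i \<le> length p \<Longrightarrow> awalk_verts u p ! i = awlast u (take i p)"
proof (induction p arbitrary: u i)
  case (Cons e p)
  then have "awalk_verts u (e # p) = u # awalk_verts (head G e) p" by simp
  then show ?case using Cons by (cases i) (auto simp: awlast_Cons simp del: awalk_verts.simps(2))
qed simp

lemma segment_conv: "T \<in> paths \<Longrightarrow> i \<le> plen T \<Longrightarrow> segment T i j = (vtx T i, drop i (take j (snd T)))"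
  by (auto simp: segment_def vtx_def paths_iff plen_def intro: awalk_verts_nth)

lemma path_splits:
  assumes "(u, p @ q) \<in> paths"
  shows "(u, p) \<in> paths" "(awlast u p, q) \<in> paths"
proof -
  have c: "cas u p (awlast u p)" "cas (awlast u p) q (awlast u (p @ q))"
    using assms by (auto simp: paths_iff)
  show p: "(u, p) \<in> paths" using assms c by (auto simp: paths_iff)
  then have "awlast u p \<in> verts G" by (auto simp: paths_iff intro: awlast_in_verts)
  then show "(awlast u p, q) \<in> paths" using assms c(2) by (auto simp: paths_iff awlast_append)
qed

lemma segment_paths:
  assumes "T \<in> paths" "i \<le> j" "j \<le> plen T"
  shows "segment T i j \<in> paths"
proof -
  have "take i (snd T) @ (drop i (take j (snd T)) @ drop j (snd T)) = snd T"
    unfolding append.assoc[symmetric] take_split[OF assms(2)] by (rule append_take_drop_id)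
  then have "(fst T, take i (snd T) @ (drop i (take j (snd T)) @ drop j (snd T))) \<in> paths"
    using assms by simp
  from path_splits(1)[OF path_splits(2)[OF this]] show ?thesis
    using assms by (simp add: segment_conv vtx_def)
qed

lemma plen_segment: "i \<le> j \<Longrightarrow> j \<le> plen T \<Longrightarrow> plen (segment T i j) = j - i"
  by (simp add: plen_def segment_def)

lemma src_segment: "T \<in> paths \<Longrightarrow> i \<le> plen T \<Longrightarrow> src (segment T i j) = vtx T i"
  by (simp add: segment_conv src_def)

lemma trg_segment:
  assumes "T \<in> paths" "i \<le> j" "j \<le> plen T"
  shows "trg (segment T i j) = vtx T j"
  using assms by (simp add: segment_conv vtx_def trg_def awlast_append[symmetric] take_split)

lemma segment_whole: "T \<in> paths \<Longrightarrow> segment T 0 (plen T) = T"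
  by (simp add: segment_conv vtx_def) (simp add: plen_def)

lemma pcat_segment:
  assumes "T \<in> paths" "i \<le> j" "j \<le> k" "k \<le> plen T"
  shows "pcat (segment T i j) (segment T j k) = segment T i k"
  using assms drop_split[of i j k "snd T"] by (simp add: segment_conv pcat_def src_def plen_def)

lemma segment_segment:
  assumes "T \<in> paths" "i \<le> j" "j \<le> plen T" "a \<le> b" "b \<le> j - i"
  shows "segment (segment T i j) a b = segment T (i + a) (i + b)"
proof -
  have take: "take c (drop i (take j (snd T))) = drop i (take (i + c) (snd T))" if "c \<le> j - i" for c
    using that assms by (simp add: take_drop add.commute min_absorb1)
  have s: "segment T i j = (vtx T i, drop i (take j (snd T)))" using assms by (simp add: segment_conv)
  have "vtx (segment T i j) a = vtx T (i + a)"
    using take[of a] assms by (simp add: s vtx_def awlast_append[symmetric] take_split)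
  moreover have "drop a (take b (snd (segment T i j))) = drop (i + a) (take (i + b) (snd T))"
    using take[of b] assms by (simp add: s add.commute)
  ultimately show ?thesis
    using assms segment_conv[OF segment_paths[OF assms(1-3)], of a b] segment_conv[OF assms(1), of "i + a" "i + b"]
    by (simp add: plen_segment)
qed

lemma segment_trivial: "T \<in> paths \<Longrightarrow> i \<le> plen T \<Longrightarrow> segment T i i = trivial (vtx T i)"
  by (simp add: segment_conv trivial_def)

lemma vtx_0 [simp]: "vtx T 0 = src T" by (simp add: src_def vtx_def)
lemma vtx_end [simp]: "vtx T (plen T) = trg T" by (simp add: trg_def plen_def vtx_def)

lemma segment_arrow:
  assumes "T \<in> paths" "i < plen T"
  shows "segment T i (Suc i) = arrow (snd T ! i)" "snd T ! i \<in> arcs G"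
proof -
  have s: "segment T i (Suc i) = (vtx T i, [snd T ! i])"
    using assms by (simp add: segment_conv plen_def take_Suc_conv_app_nth)
  have "segment T i (Suc i) \<in> paths" using assms by (intro segment_paths) auto
  then show "segment T i (Suc i) = arrow (snd T ! i)" "snd T ! i \<in> arcs G"
    unfolding s by (auto simp: arrow_def paths_iff)
qed

lemma arrow_paths: "\<beta> \<in> arcs G \<Longrightarrow> arrow \<beta> \<in> paths"
  by (simp add: arrow_def paths_iff)

lemma plen_pcat: "plen (pcat p q) = plen p + plen q"
  by (simp add: plen_def pcat_def)

lemma plen_arrow: "plen (arrow \<beta>) = 1" and plen_trivial: "plen (trivial x) = 0"
  by (simp_all add: plen_def arrow_def trivial_def)

end

context monomial_algebra
begin

definition length_ge :: "nat \<Rightarrow> (('a, 'b) qpath \<Rightarrow>\<^sub>0 'k) set" where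
  "length_ge m = {x. \<forall>p\<in>Poly_Mapping.keys x. p \<in> paths \<and> m \<le> plen p}"

lemma length_ge_mult:
  assumes "x \<in> length_ge a" "y \<in> length_ge b" shows "x \<otimes>\<^bsub>path_algebra\<^esub> y \<in> length_ge (a + b)"
proof -
  have "r \<in> paths \<and> a + b \<le> plen r" if r: "r \<in> Poly_Mapping.keys (x \<otimes>\<^bsub>path_algebra\<^esub> y)" for r
    using r
  proof (rule keys_pmul)
    fix p q assume "p \<in> Poly_Mapping.keys x" "q \<in> Poly_Mapping.keys y" "trg p = src q" "r = pcat p q"
    then show ?thesis using assms by (auto simp: length_ge_def plen_pcat pcat_paths intro!: add_mono)
  qed
  then show ?thesis by (simp add: length_ge_def)
qed

text \<open>
  Together with \<open>I \<subseteq> J\<^sup>2\<close> this yields that no path of length at most one lies in \<open>I\<close>, because \<open>J\<^sup>2\<close> is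
  contained in \<open>length_ge 2\<close>.
\<close>

lemma length_ge_ideal: "ideal (length_ge m) path_algebra"
proof (rule idealI[OF ring_path_algebra])
  interpret R: ring "path_algebra :: (('a, 'b) qpath \<Rightarrow>\<^sub>0 'k) ring" by (rule ring_path_algebra)
  have carr: "length_ge m \<subseteq> carrier path_algebra" by (auto simp: length_ge_def carrier_pa)
  show "subgroup (length_ge m) (add_monoid path_algebra)"
  proof (rule R.add.subgroupI)
    show "length_ge m \<noteq> {}" unfolding length_ge_def by (auto intro!: exI[of _ 0])
  next
    fix x assume x: "x \<in> length_ge m"
    have "- x = \<ominus>\<^bsub>path_algebra\<^esub> x"
      by (rule sym, rule R.minus_equality)
        (use x carr in \<open>auto simp: path_algebra_def length_ge_def in_keys_iff\<close>)
    then show "\<ominus>\<^bsub>path_algebra\<^esub> x \<in> length_ge m" using x by (simp add: length_ge_def in_keys_iff flip: \<open>- x = _\<close>)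
  next
    fix x y assume "x \<in> length_ge m" "y \<in> length_ge m"
    then show "x \<oplus>\<^bsub>path_algebra\<^esub> y \<in> length_ge m"
      using Poly_Mapping.keys_add[of x y] by (auto simp: length_ge_def path_algebra_def)
  qed (use carr in simp)
next
  fix a x :: "('a, 'b) qpath \<Rightarrow>\<^sub>0 'k" assume a: "a \<in> length_ge m" "x \<in> carrier path_algebra"
  then have "x \<in> length_ge 0" by (auto simp: length_ge_def carrier_pa)
  then show "x \<otimes>\<^bsub>path_algebra\<^esub> a \<in> length_ge m" "a \<otimes>\<^bsub>path_algebra\<^esub> x \<in> length_ge m"
    using length_ge_mult[of x 0 a m] length_ge_mult[of a m x 0] a by auto
qed

lemma ideal_prod_length_ge: "J \<subseteq> length_ge a \<Longrightarrow> K \<subseteq> length_ge b \<Longrightarrow> ideal_prod path_algebra J K \<subseteq> length_ge (a + b)"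
proof
  fix x assume s: "J \<subseteq> length_ge a" "K \<subseteq> length_ge b"
  assume "x \<in> ideal_prod path_algebra J K"
  then show "x \<in> length_ge (a + b)"
  proof (induction rule: ideal_prod.induct)
    case (prod i j)
    then show ?case using s length_ge_mult by blast
  next
    case (sum s1 s2)
    then show ?case using additive_subgroup.a_closed[OF ideal.axioms(1)[OF length_ge_ideal]] by blast
  qed
qed

lemma arrow_ideal_length_ge: "arrow_ideal \<subseteq> length_ge 1"
  unfolding arrow_ideal_def
  by (rule ring.genideal_minimal[OF ring_path_algebra length_ge_ideal])
    (auto simp: length_ge_def arrow_paths plen_arrow)

lemma zero_path_length: "bas p \<in> I \<Longrightarrow> p \<in> paths \<and> 2 \<le> plen p"
proof -
  assume p: "bas p \<in> I"
  have "carrier path_algebra \<subseteq> length_ge 0" by (auto simp: length_ge_def carrier_pa)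
  then have "(arrow_ideal_power 2 :: (('a, 'b) qpath \<Rightarrow>\<^sub>0 'k) set) \<subseteq> length_ge (0 + 1 + 1)"
    unfolding numeral_2_eq_2 arrow_ideal_power.simps
    by (intro ideal_prod_length_ge arrow_ideal_length_ge)
  moreover obtain m where "I \<subseteq> arrow_ideal_power 2" using admissible by blast
  ultimately have "bas p \<in> length_ge 2" using p by (auto simp: numeral_2_eq_2)
  then show ?thesis by (simp add: length_ge_def)
qed

definition zero_at :: "('a, 'b) qpath \<Rightarrow> nat \<Rightarrow> nat \<Rightarrow> bool" where
  "zero_at T i j \<longleftrightarrow> i \<le> j \<and> j \<le> plen T \<and> bas (segment T i j) \<in> I"

lemma zero_intervals: "T \<in> paths \<Longrightarrow> zero_intervals (zero_at T) (plen T)"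
proof
  fix i j i' j'
  assume T: "T \<in> paths" and z: "zero_at T i j"
  show "i + 2 \<le> j \<and> j \<le> plen T"
    using z zero_path_length[of "segment T i j"] by (auto simp: zero_at_def plen_segment)
  assume m: "i' \<le> i" "j \<le> j'" "j' \<le> plen T"
  have i: "i \<le> j" "bas (segment T i j) \<in> I" using z by (auto simp: zero_at_def)
  have "bas (pcat (segment T i j) (segment T j j')) \<in> I"
    using T i m by (intro I_pcat) (auto intro!: segment_paths simp: src_segment trg_segment)
  then have "bas (segment T i j') \<in> I" using T i m by (simp add: pcat_segment)
  then have "bas (pcat (segment T i' i) (segment T i j')) \<in> I"
    using T i m by (intro I_pcat) (auto intro!: segment_paths simp: src_segment trg_segment)
  then show "zero_at T i' j'" using T i m by (simp add: pcat_segment zero_at_def)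
qed

abbreviation chain_occ :: "('a, 'b) qpath \<Rightarrow> nat \<Rightarrow> (nat \<times> nat) set" where
  "chain_occ T n \<equiv> zero_intervals.occ (zero_at T) (plen T) n"

lemma zero_at_segment:
  assumes "T \<in> paths" "a \<le> b" "b \<le> plen T"
  shows "zero_at (segment T a b) i j \<longleftrightarrow> j \<le> b - a \<and> zero_at T (a + i) (a + j)"
  using assms by (auto simp: zero_at_def plen_segment segment_segment)

lemma chain_occ_segment:
  assumes "T \<in> paths" "a \<le> b" "b \<le> plen T" "y \<le> b - a"
  shows "(x, y) \<in> chain_occ (segment T a b) n \<longleftrightarrow> (a + x, a + y) \<in> chain_occ T n"
  using occ_restrict[OF zero_intervals[OF assms(1)] assms(2,3) zero_at_segment[OF assms(1-3)] assms(4)]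
    plen_segment[OF assms(2,3)] by simp

lemma occs_relations:
  assumes T: "T \<in> paths"
  shows "occs relations T = zero_intervals.minimal (zero_at T)"
proof -
  interpret zero_intervals "zero_at T" "plen T" using zero_intervals[OF T] .
  have "(i, j) \<in> occs relations T \<longleftrightarrow> (i, j) \<in> minimal" for i j
  proof (cases "i \<le> j \<and> j \<le> plen T")
    case True
    have "(\<forall>a b. a \<le> b \<and> b \<le> j - i \<and> (a, b) \<noteq> (0, j - i) \<longrightarrow> bas (segment (segment T i j) a b) \<notin> I)
      \<longleftrightarrow> (\<forall>i' j'. i \<le> i' \<and> j' \<le> j \<and> (i', j') \<noteq> (i, j) \<longrightarrow> \<not> zero_at T i' j')"
      (is "?l \<longleftrightarrow> ?r")
    proof
      assume l: ?l
      show ?r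
      proof (intro allI impI notI)
        fix i' j' assume a: "i \<le> i' \<and> j' \<le> j \<and> (i', j') \<noteq> (i, j)" "zero_at T i' j'"
        show False
        proof -
          have "i' \<le> j'" using a by (simp add: zero_at_def)
          then have b: "i' - i \<le> j' - i" "j' - i \<le> j - i" "(i' - i, j' - i) \<noteq> (0, j - i)"
            using a(1) True by auto
          have "bas (segment (segment T i j) (i' - i) (j' - i)) \<notin> I" using l b by blast
          moreover have "segment (segment T i j) (i' - i) (j' - i) = segment T i' j'"
            using segment_segment[of T i j "i' - i" "j' - i"] T True b a \<open>i' \<le> j'\<close> by auto
          ultimately show False using a(2) by (simp add: zero_at_def)
        qed
      qed
    next
      assume r: ?r
      show ?l
      proof (intro allI impI)
        fix a b assume a: "a \<le> b \<and> b \<le> j - i \<and> (a, b) \<noteq> (0, j - i)"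
        then have "i + b \<le> j" "(i + a, i + b) \<noteq> (i, j)" using True by auto
        then show "bas (segment (segment T i j) a b) \<notin> I"
          using a r[rule_format, of "i + a" "i + b"] True T
          by (auto simp: zero_at_def segment_segment)
      qed
    qed
    then show ?thesis
      using True T by (auto simp: occs_def relations_def minimal_def segment_paths plen_segment zero_at_def)
  next
    case False
    then show ?thesis by (auto simp: occs_def minimal_def zero_at_def)
  qed
  then show ?thesis by auto
qed

text \<open>
  The \<open>j\<close>-th relation of the concatenation, counted from \<open>0\<close>, has to be the first one that starts at
  or after \<open>pos j x\<close>, and it ends at \<open>pos (j + 2) x\<close>.  The window in which it may start closes at
  \<open>pos (j + 1) x\<close>, which is the strict inequality between \<open>pos (j + 2) x\<close> and \<open>pos (j + 3) x\<close>.
\<close>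

lemma n_concatenation_iff:
  assumes T: "T \<in> paths" and n: "2 \<le> n"
  shows "(\<exists>ps. n_concatenation n T ps \<and> fst (hd ps) = x \<and> snd (last ps) = y) \<longleftrightarrow>
    (x, y) \<in> chain_occ T n"
proof -
  interpret zero_intervals "zero_at T" "plen T" using zero_intervals[OF T] .
  have next_rels: "next_rels T ps j = {p. p \<in> minimal \<and> pos j x \<le> fst p \<and> fst p < pos (Suc j) x}"
    if "1 \<le> j" "fst (ps ! 0) = x" "\<And>i. i < j \<Longrightarrow> snd (ps ! i) = pos (i + 2) x" for ps j
  proof (cases "j = 1")
    case True
    then show ?thesis using that(2) that(3)[of 0] by (auto simp: next_rels_def occs_relations[OF T])
  next
    case False
    then have "j = Suc (Suc (j - 2))" using that(1) by simp
    then obtain i where "j = Suc (Suc i)" ..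
    then show ?thesis using that(3)[of i] that(3)[of "Suc i"] by (auto simp: next_rels_def occs_relations[OF T])
  qed
  show ?thesis
  proof
    assume "\<exists>ps. n_concatenation n T ps \<and> fst (hd ps) = x \<and> snd (last ps) = y"
    then obtain ps where ps: "n_concatenation n T ps" "fst (hd ps) = x" "snd (last ps) = y" by blast
    have len: "length ps = n - 1" using ps by (simp add: n_concatenation_def)
    then have x: "fst (ps ! 0) = x" using ps n by (cases ps) auto
    have step: "snd (ps ! j) = pos (j + 2) x \<and> pos (j + 2) x \<le> plen T \<and> pos (j + 2) x < pos (j + 3) x"
      if "j < n - 1" for j
      using that
    proof (induction j rule: less_induct)
      case (less j)
      show ?case
      proof (cases "j = 0")
        case True
        have "ps ! 0 \<in> minimal" using ps by (simp add: n_concatenation_def occs_relations[OF T])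
        then have "(x, snd (ps ! 0)) \<in> minimal" using x by (metis prod.collapse)
        then have m: "first_end x \<le> plen T" "last_start x = x" "snd (ps ! 0) = first_end x" using minimal_start_iff by auto
        then have "first_end x < first_end (Suc x)" using last_start_less_iff[of x "Suc x"] by simp
        then show ?thesis using True m by (simp add: numeral_eq_Suc)
      next
        case False
        have IH: "snd (ps ! i) = pos (i + 2) x" if "i < j" for i using less that by auto
        have "is_arg_min fst (\<lambda>p. p \<in> next_rels T ps j) (ps ! j)"
          using ps(1) False less.prems len by (simp add: n_concatenation_def)
        then have "is_arg_min fst (\<lambda>p. p \<in> minimal \<and> pos j x \<le> fst p \<and> fst p < pos (Suc j) x) (ps ! j)"
          using next_rels[of j ps] False x IH by simp
        then show ?thesis unfolding arg_min_minimal_iff by (simp add: numeral_eq_Suc)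
      qed
    qed
    have "n = Suc (Suc (n - 2))" using n by simp
    then obtain k where k: "n = Suc (Suc k)" ..
    have "last ps = ps ! k" using len k by (subst last_conv_nth) auto
    then have y: "y = pos n x" "y \<le> plen T" using step[of k] k ps(3) by simp_all
    have "pos j x < pos (Suc j) x" if "j \<le> n" for j
    proof -
      have "j = 0 \<or> j = 1 \<or> j = (j - 2) + 2" by arith
      then consider "j = 0" | "j = 1" | i where "j = i + 2" by blast
      then show ?thesis
      proof cases
        case 2
        then show ?thesis using step[of 0] k first_end_finite[of x] by (simp add: numeral_eq_Suc)
      next
        case (3 i)
        then show ?thesis using step[of i] that n by (simp add: numeral_eq_Suc)
      qed simp
    qed
    then show "(x, y) \<in> occ n" using y by (simp add: occ_def)
  next
    assume "(x, y) \<in> occ n"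
    then have y: "y = pos n x" "y \<le> plen T" and strict: "\<And>j. j \<le> n \<Longrightarrow> pos j x < pos (Suc j) x"
      by (auto simp: occ_def)
    have le: "pos j x \<le> plen T" if "j \<le> n" for j
    proof -
      have "pos (n - i) x \<le> plen T" if "i \<le> n" for i
        using that
      proof (induction i)
        case (Suc i)
        then show ?case using strict[of "n - Suc i"] by (simp add: Suc_diff_Suc)
      qed (use y in simp)
      from this[of "n - j"] show ?thesis using that by simp
    qed
    define ps where "ps = map (\<lambda>j. (last_start (pos j x), first_end (pos j x))) [0..<n - 1]"
    have nth: "ps ! j = (last_start (pos j x), first_end (pos j x))" if "j < n - 1" for j
      using that by (simp add: ps_def)
    have "first_end x \<le> plen T" "first_end x < first_end (Suc x)" using le[of 2] strict[of 2] n by (simp_all add: numeral_eq_Suc)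
    then have Sx: "last_start x = x" using last_start_less_iff[of x "Suc x"] last_start_props(2)[of x] by simp
    then have min0: "(x, first_end x) \<in> minimal" using \<open>first_end x \<le> plen T\<close> minimal_start_iff by simp
    have "is_arg_min fst (\<lambda>p. p \<in> next_rels T ps j) (ps ! j)" if j: "1 \<le> j" "j < n - 1" for j
    proof -
      have "next_rels T ps j = {p. p \<in> minimal \<and> pos j x \<le> fst p \<and> fst p < pos (Suc j) x}"
        by (rule next_rels) (use j nth Sx in auto)
      moreover have "first_end (pos j x) \<le> plen T" using le[of "Suc (Suc j)"] j by simp
      moreover have "first_end (pos j x) < first_end (pos (Suc j) x)" using strict[of "Suc (Suc j)"] j by simp
      ultimately show ?thesis using arg_min_minimal_iff nth[OF j(2)] by simp
    qed
    then have "n_concatenation n T ps"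
      using n nth[of 0] Sx min0 by (auto simp: n_concatenation_def occs_relations[OF T] ps_def)
    moreover have "fst (hd ps) = x" using n Sx nth[of 0] by (simp add: hd_conv_nth ps_def)
    moreover have "snd (last ps) = y"
    proof -
      have "n = Suc (Suc (n - 2))" using n by simp
      then obtain k where k: "n = Suc (Suc k)" ..
      have "last ps = ps ! k" using k by (subst last_conv_nth) (auto simp: ps_def)
      then show ?thesis using nth[of k] k y by simp
    qed
    ultimately show "\<exists>ps. n_concatenation n T ps \<and> fst (hd ps) = x \<and> snd (last ps) = y" by blast
  qed
qed

text \<open>
  Uniform in \<open>n\<close>: the trivial paths and the arrows are the chains of lengths \<open>0\<close> and \<open>1\<close>.
\<close>

lemma AP_iff: "w \<in> AP n \<longleftrightarrow> w \<in> paths \<and> (0, plen w) \<in> chain_occ w n"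
proof (cases "w \<in> paths")
  case True
  interpret zero_intervals "zero_at w" "plen w" using zero_intervals[OF True] .
  consider "n = 0" | "n = 1" | "2 \<le> n" by linarith
  then show ?thesis
  proof cases
    case 1
    have "w \<in> trivial ` verts Q \<longleftrightarrow> plen w = 0"
      using True path_in_verts[OF True]
      by (cases w) (auto simp: trivial_def plen_def src_def)
    then show ?thesis using 1 True by (auto simp: AP_def occ_iff)
  next
    case 2
    have "w \<in> arrow ` arcs Q \<longleftrightarrow> plen w = 1"
      using True segment_arrow[OF True, of 0] segment_whole[OF True]
      by (auto simp: plen_arrow) (metis imageI)
    moreover have "plen w = 1 \<Longrightarrow> first_end 0 = 2" using first_end_eq_or[of 0] first_end_finite[of 0] by auto
    ultimately show ?thesis using 2 True by (auto simp: AP_def occ_iff)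
  next
    case 3
    have "w \<in> AP n \<longleftrightarrow> (\<exists>T x y. T \<in> paths \<and> (x, y) \<in> chain_occ T n \<and> w = segment T x y)"
    proof
      assume "w \<in> AP n"
      then obtain T ps where "T \<in> paths" "n_concatenation n T ps" "w = segment T (fst (hd ps)) (snd (last ps))"
        using 3 by (auto simp: AP_def)
      then show "\<exists>T x y. T \<in> paths \<and> (x, y) \<in> chain_occ T n \<and> w = segment T x y"
        using n_concatenation_iff[of T n] 3 by blast
    next
      assume "\<exists>T x y. T \<in> paths \<and> (x, y) \<in> chain_occ T n \<and> w = segment T x y"
      then obtain T x y where T: "T \<in> paths" "(x, y) \<in> chain_occ T n" "w = segment T x y" by blast
      then obtain ps where "n_concatenation n T ps" "fst (hd ps) = x" "snd (last ps) = y"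
        using n_concatenation_iff[of T n x y] 3 by blast
      moreover have "AP n = {segment T (fst (hd ps)) (snd (last ps)) | T ps. T \<in> paths \<and> n_concatenation n T ps}"
        using 3 by (simp add: AP_def)
      ultimately show "w \<in> AP n" using T by blast
    qed
    also have "\<dots> \<longleftrightarrow> (0, plen w) \<in> chain_occ w n"
    proof
      assume "\<exists>T x y. T \<in> paths \<and> (x, y) \<in> chain_occ T n \<and> w = segment T x y"
      then obtain T x y where T: "T \<in> paths" "(x, y) \<in> chain_occ T n" "w = segment T x y" by blast
      interpret T: zero_intervals "zero_at T" "plen T" using zero_intervals[OF T(1)] .
      have "x \<le> y" "y \<le> plen T" 
        using T(2) T.occ_bounds by auto
      then show "(0, plen w) \<in> chain_occ w n"
        using chain_occ_segment[OF T(1), of x y "y - x" 0 n] T by (simp add: plen_segment)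
    next
      assume "(0, plen w) \<in> chain_occ w n"
      then show "\<exists>T x y. T \<in> paths \<and> (x, y) \<in> chain_occ T n \<and> w = segment T x y"
        using True segment_whole[OF True] by metis
    qed
    finally show ?thesis using True by simp
  qed
next
  case False
  have "AP n \<subseteq> paths"
  proof
    fix w assume w: "w \<in> AP n"
    show "w \<in> paths"
    proof (cases "2 \<le> n")
      case True
      then obtain T x y where T: "T \<in> paths" "(x, y) \<in> chain_occ T n" "w = segment T x y"
        using w by (auto simp: AP_def) (metis n_concatenation_iff)
      interpret T: zero_intervals "zero_at T" "plen T" using zero_intervals[OF T(1)] .
      show ?thesis using T T.occ_bounds by (auto intro!: segment_paths)
    next
      case False
      then show ?thesis using w by (auto simp: AP_def arrow_paths split: if_splits)
    qed
  qed
  then show ?thesis using False by auto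
qed

lemma occs_AP: "T \<in> paths \<Longrightarrow> occs (AP n) T = chain_occ T n"
proof -
  assume T: "T \<in> paths"
  interpret zero_intervals "zero_at T" "plen T" using zero_intervals[OF T] .
  have "(i, j) \<in> occs (AP n) T \<longleftrightarrow> (i, j) \<in> occ n" for i j
  proof (cases "i \<le> j \<and> j \<le> plen T")
    case True
    then show ?thesis
      using T chain_occ_segment[OF T, of i j "j - i" 0 n]
      by (simp add: occs_def AP_iff segment_paths plen_segment)
  next
    case False
    then show ?thesis using occ_bounds by (auto simp: occs_def)
  qed
  then show ?thesis by auto
qed

end

section \<open>Tensors of paths\<close>

context pre_digraph
begin

lemma composable_simps [simp]:
  "composable []" "composable [p]"
  "composable (p # q # vs) \<longleftrightarrow> trg p = src q \<and> composable (q # vs)"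
proof -
  show "composable (p # q # vs) \<longleftrightarrow> trg p = src q \<and> composable (q # vs)"
    unfolding composable_def
  proof (intro iffI conjI allI impI)
    fix i assume a: "trg p = src q \<and> (\<forall>i. Suc i < length (q # vs) \<longrightarrow> trg ((q # vs) ! i) = src ((q # vs) ! Suc i))"
      "Suc i < length (p # q # vs)"
    then show "trg ((p # q # vs) ! i) = src ((p # q # vs) ! Suc i)" by (cases i) auto
  qed force+
qed (simp_all add: composable_def)

lemma composable_append:
  "us \<noteq> [] \<Longrightarrow> vs \<noteq> [] \<Longrightarrow>
   composable (us @ vs) \<longleftrightarrow> composable us \<and> trg (last us) = src (hd vs) \<and> composable vs"
proof (induction us rule: induct_list012)
  case (2 x)
  then show ?case by (cases vs) auto
qed auto

lemma pconcat_Cons: "vs \<noteq> [] \<Longrightarrow> pconcat (v # vs) = pcat v (pconcat vs)"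
  by (simp add: pconcat_def pcat_def)

lemma pconcat_single [simp]: "pconcat [v] = v"
  by (simp add: pconcat_def src_def)

lemma pconcat_snoc: "pconcat (vs @ [pcat b r]) = pcat (pconcat (vs @ [b])) r"
  by (cases vs) (simp_all add: pconcat_def pcat_def src_def)

lemma src_pconcat [simp]: "src (pconcat vs) = src (hd vs)"
  by (simp add: pconcat_def src_def)

lemma trg_pconcat: "vs \<noteq> [] \<Longrightarrow> composable vs \<Longrightarrow> trg (pconcat vs) = trg (last vs)"
proof (induction vs rule: induct_list012)
  case (3 x y zs)
  then show ?case by (simp add: pconcat_Cons[of "y # zs"])
qed auto

lemma pcat_arrow_count: "arrow_count \<alpha> (pcat p q) = arrow_count \<alpha> p + arrow_count \<alpha> q"
  by (simp add: arrow_count_def pcat_def)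

lemma arrow_count_trivial [simp]: "arrow_count \<alpha> (trivial x) = 0"
  by (simp add: arrow_count_def trivial_def)

lemma arrow_count_pconcat: "arrow_count \<alpha> (pconcat vs) = (\<Sum>v\<leftarrow>vs. arrow_count \<alpha> v)"
  by (induction vs) (simp_all add: arrow_count_def pconcat_def)

text \<open>
  The tensor of a list of basis elements, which vanishes over \<open>E\<close> unless consecutive end points match.
\<close>

definition pbas :: "('a, 'b) qpath list \<Rightarrow> (('a, 'b) qpath list \<Rightarrow>\<^sub>0 'k::field)" where
  "pbas vs = (if composable vs then bas vs else 0)"

lemma pure_bas:
  fixes vs :: "('a, 'b) qpath list"
  shows "pure (map bas vs) = (pbas vs :: _ \<Rightarrow>\<^sub>0 'c::field)"
proof (rule poly_mapping_eqI)
  fix us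
  have "(\<Prod>j<length vs. Poly_Mapping.lookup (bas (vs ! j) :: _ \<Rightarrow>\<^sub>0 'c) (us ! j)) = (if us = vs then 1 else 0)"
    if len: "length us = length vs"
  proof (cases "us = vs")
    case False
    then obtain j where "j < length vs" "us ! j \<noteq> vs ! j" using len nth_equalityI[of us vs] by auto
    then show ?thesis using False
      by (auto simp: bas_def lookup_single when_def intro!: bexI[of _ j])
  qed (simp add: bas_def)
  then show "Poly_Mapping.lookup (pure (map bas vs)) us = Poly_Mapping.lookup (pbas vs :: _ \<Rightarrow>\<^sub>0 'c) us"
    by (auto simp: lookup_pure pbas_def) (auto simp: bas_def lookup_single when_def)
qed

lemma pure_slot: "pure (as @ a # bs) = lin_ext (\<lambda>v. pure (as @ bas v # bs)) a"
proof -
  define Xs :: "('a, 'b) qpath set list" where "Xs = map (\<lambda>_. UNIV) (as @ a # bs)"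
  have Xs: "length Xs = length (as @ a # bs)" by (simp add: Xs_def)
  have Xs': "Xs ! i = UNIV" if "i < length (as @ a # bs)" for i
    unfolding Xs_def using nth_map[OF that, of "\<lambda>_. UNIV"] .
  have "pure ((as @ a # bs)[length as := a]) = (\<Sum>v\<in>Poly_Mapping.keys a.
      cscale (Poly_Mapping.lookup a v) (pure ((as @ a # bs)[length as := bas v])))"
    by (rule slot_expand[OF pure_balanced_multilinear[of Xs]])
      (use Xs Xs' in \<open>auto simp: tensor_args_def list_all2_conv_all_nth\<close>)
  then show ?thesis by (simp add: lin_ext_def)
qed

lemma pure_zero: "0 \<in> set as \<Longrightarrow> pure as = 0"
  using split_list[of 0 as] by (auto simp: pure_slot[where a = 0])

end

context monomial_algebra
begin

lemma trivial_nonzero: "x \<in> verts Q \<Longrightarrow> trivial x \<in> nonzero_paths"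
  using zero_path_length[of "trivial x"] by (auto simp: nonzero_paths_def plen_trivial)

lemma arrow_nonzero: "\<beta> \<in> arcs Q \<Longrightarrow> arrow \<beta> \<in> nonzero_paths"
  using zero_path_length[of "arrow \<beta>"] by (auto simp: nonzero_paths_def plen_arrow arrow_paths)

lemma nonzero_is_path: "p \<in> nonzero_paths \<Longrightarrow> p \<in> paths"
  by (simp add: nonzero_paths_def)

lemma nonzero_verts: "p \<in> nonzero_paths \<Longrightarrow> src p \<in> verts Q \<and> trg p \<in> verts Q"
  by (simp add: nonzero_is_path path_in_verts trg_in_verts)

lemma nonzero_pcat:
  assumes "p \<in> paths" "q \<in> paths" "trg p = src q" "pcat p q \<in> nonzero_paths"
  shows "p \<in> nonzero_paths" "q \<in> nonzero_paths"
  using assms I_pcat[OF assms(1-3)] by (auto simp: nonzero_paths_def)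

lemma cls_eq: "cls p = (if p \<in> nonzero_paths then bas p else 0)"
  by (simp add: cls_def nf_def)

lemma one_A: "\<one>\<^bsub>A\<^esub> = (\<Sum>x\<in>verts Q. bas (trivial x))"
proof -
  have "\<one>\<^bsub>A\<^esub> = nf (\<Sum>x\<in>verts Q. bas (trivial x))" by (simp add: A_def one_pa)
  also have "\<dots> = (\<Sum>x\<in>verts Q. bas (trivial x))"
    unfolding nf_def lin_ext_sum by (intro sum.cong) (auto simp: trivial_nonzero)
  finally show ?thesis .
qed

lemma lin_ext_one: "lin_ext \<phi> \<one>\<^bsub>A\<^esub> = (\<Sum>x\<in>verts Q. \<phi> (trivial x))"
  by (simp add: one_A lin_ext_sum)

lemma A_mult: "x \<otimes>\<^bsub>A\<^esub> y = lin_ext (\<lambda>p. lin_ext (\<lambda>q. nf (path_mult p q)) y) x"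
  by (simp add: A_def pmul_def nf_def lin_ext_lin_ext)

lemma A_mult_bas: "bas p \<otimes>\<^bsub>A\<^esub> bas q =
    (if trg p = src q \<and> pcat p q \<in> nonzero_paths then bas (pcat p q) else 0)"
  by (auto simp: A_mult path_mult_def nf_def)

lemma A_mult_zero [simp]: "0 \<otimes>\<^bsub>A\<^esub> y = 0" "x \<otimes>\<^bsub>A\<^esub> 0 = 0"
  by (simp_all add: A_mult)

lemma A_mult_right: "x \<otimes>\<^bsub>A\<^esub> y = lin_ext (\<lambda>q. x \<otimes>\<^bsub>A\<^esub> bas q) y"
  by (simp add: A_mult) (rule lin_ext_swap)

lemma A_mult_cscale: "cscale c x \<otimes>\<^bsub>A\<^esub> y = cscale c (x \<otimes>\<^bsub>A\<^esub> y)" "x \<otimes>\<^bsub>A\<^esub> cscale c y = cscale c (x \<otimes>\<^bsub>A\<^esub> y)"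
proof -
  show "cscale c x \<otimes>\<^bsub>A\<^esub> y = cscale c (x \<otimes>\<^bsub>A\<^esub> y)" by (simp add: A_mult lin_ext_cscale)
  show "x \<otimes>\<^bsub>A\<^esub> cscale c y = cscale c (x \<otimes>\<^bsub>A\<^esub> y)"
    by (subst (1 2) A_mult_right) (simp add: lin_ext_cscale)
qed

lemma bas_carrier: "p \<in> nonzero_paths \<Longrightarrow> bas p \<in> carrier A"
  by (simp add: carrier_A)

lemma cscale_carrier: "x \<in> carrier A \<Longrightarrow> cscale c x \<in> carrier A"
  using keys_cscale[of c x] by (auto simp: carrier_A)

lemma A_one_mult: "x \<in> carrier A \<Longrightarrow> \<one>\<^bsub>A\<^esub> \<otimes>\<^bsub>A\<^esub> x = x"
  using ring.ring_simprules(12)[OF ring_A] by simp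

lemma A_one_closed: "\<one>\<^bsub>A\<^esub> \<in> carrier A"
  using ring.ring_simprules(6)[OF ring_A] by simp

lemma lact_bas:
  assumes "composable (q # vs)"
  shows "lact (bas p) (bas (q # vs)) =
    (if trg p = src q \<and> pcat p q \<in> nonzero_paths then bas (pcat p q # vs) else 0)"
proof -
  have "composable (pcat p q # vs)" if "trg p = src q" using that assms by (cases vs) auto
  then show ?thesis
    using pure_bas[of "pcat p q # vs"] by (auto simp: lact_def A_mult_bas pure_zero pbas_def)
qed

lemma ract_bas:
  assumes "composable (vs @ [q])"
  shows "ract (bas (vs @ [q])) (bas r) =
    (if trg q = src r \<and> pcat q r \<in> nonzero_paths then bas (vs @ [pcat q r]) else 0)"
proof -
  have "composable (vs @ [pcat q r])" using assms by (cases "vs = []") (auto simp: composable_append)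
  then show ?thesis
    using pure_bas[of "vs @ [pcat q r]"] by (auto simp: ract_def A_mult_bas pure_zero pbas_def)
qed

lemma lact_zero [simp]: "lact 0 x = 0" "lact a 0 = 0"
  by (simp_all add: lact_def pure_zero)

lemma ract_zero [simp]: "ract x 0 = 0" "ract 0 a = 0"
  by (simp_all add: ract_def pure_zero)

lemma lact_linear: "lact a (lin_ext \<phi> x) = lin_ext (\<lambda>v. lact a (\<phi> v)) x"
  by (simp add: lact_def lin_ext_lin_ext)

lemma ract_linear: "ract (lin_ext \<phi> x) a = lin_ext (\<lambda>v. ract (\<phi> v) a) x"
  by (simp add: ract_def lin_ext_lin_ext)

lemma sum_at_vertex:
  assumes "z \<in> verts Q"
  shows "(\<Sum>x\<in>verts Q. if x = z then f x else (0 :: _ \<Rightarrow>\<^sub>0 'k)) = f z"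
  using assms by simp

lemma pure_one_left:
  assumes "composable (q # vs)" "src q \<in> verts Q"
  shows "pure (\<one>\<^bsub>A\<^esub> # map bas (q # vs)) = (bas (trivial (src q) # q # vs) :: _ \<Rightarrow>\<^sub>0 'k)"
proof -
  have "pure (\<one>\<^bsub>A\<^esub> # map bas (q # vs)) = lin_ext (\<lambda>v. pbas (v # q # vs)) \<one>\<^bsub>A\<^esub>"
    using pure_slot[of "[]" "\<one>\<^bsub>A\<^esub>" "map bas (q # vs)"] by (simp flip: pure_bas)
  also have "\<dots> = (\<Sum>x\<in>verts Q. if x = src q then bas (trivial x # q # vs) else 0)"
    unfolding lin_ext_one using assms(1) by (intro sum.cong) (auto simp: pbas_def)
  finally show ?thesis using assms(2) by simp
qed

lemma pure_one_right:
  assumes "composable (vs @ [q])" "trg q \<in> verts Q"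
  shows "pure (map bas (vs @ [q]) @ [\<one>\<^bsub>A\<^esub>]) = (bas (vs @ [q] @ [trivial (trg q)]) :: _ \<Rightarrow>\<^sub>0 'k)"
proof -
  have "pure (map bas (vs @ [q]) @ [\<one>\<^bsub>A\<^esub>]) = lin_ext (\<lambda>v. pbas ((vs @ [q]) @ [v])) \<one>\<^bsub>A\<^esub>"
    by (subst pure_slot[of _ _ "[]"]) (simp flip: pure_bas)
  also have "\<dots> = (\<Sum>x\<in>verts Q. if x = trg q then bas (vs @ [q] @ [trivial x]) else 0)"
    unfolding lin_ext_one using assms(1) composable_append[of "vs @ [q]"]
    by (intro sum.cong) (auto simp: pbas_def)
  finally show ?thesis using assms(2) by simp
qed

lemma pure_one_one:
  assumes "vs \<noteq> []" "composable vs" "set vs \<subseteq> paths"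
  shows "pure (\<one>\<^bsub>A\<^esub> # map bas vs @ [\<one>\<^bsub>A\<^esub>]) =
    (bas (trivial (src (hd vs)) # vs @ [trivial (trg (last vs))]) :: _ \<Rightarrow>\<^sub>0 'k)"
proof -
  have "pure (\<one>\<^bsub>A\<^esub> # map bas vs @ [\<one>\<^bsub>A\<^esub>]) =
      lin_ext (\<lambda>v. pure (map bas (v # vs) @ [\<one>\<^bsub>A\<^esub>])) \<one>\<^bsub>A\<^esub>"
    using pure_slot[of "[]" "\<one>\<^bsub>A\<^esub>" "map bas vs @ [\<one>\<^bsub>A\<^esub>]"] by simp
  also have "\<dots> = (\<Sum>x\<in>verts Q. if x = src (hd vs)
      then bas (trivial (src (hd vs)) # vs @ [trivial (trg (last vs))]) else 0)"
    unfolding lin_ext_one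
  proof (intro sum.cong refl)
    fix x assume "x \<in> verts Q"
    obtain us q where vs: "vs = us @ [q]" using assms(1) by (metis rev_exhaust)
    have q: "trg q \<in> verts Q" using assms(3) vs by (auto intro: trg_in_verts)
    have c: "composable (trivial x # vs) \<longleftrightarrow> x = src (hd vs)"
      using assms(1,2) by (cases vs) auto
    show "pure (map bas (trivial x # vs) @ [\<one>\<^bsub>A\<^esub>]) = (if x = src (hd vs)
      then bas (trivial (src (hd vs)) # vs @ [trivial (trg (last vs))]) else (0 :: _ \<Rightarrow>\<^sub>0 'k))"
    proof (cases "x = src (hd vs)")
      case True
      then show ?thesis using pure_one_right[of "trivial x # us" q] c q vs by simp
    next
      case False
      have "\<not> composable ((trivial x # vs) @ [v])" for v
        using False c by (subst composable_append) auto
      then have "pure (map bas ((trivial x # vs) @ [v])) = (0 :: _ \<Rightarrow>\<^sub>0 'k)" for v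
        by (simp only: pure_bas pbas_def if_False)
      then have "pure (map bas (trivial x # vs) @ [\<one>\<^bsub>A\<^esub>]) = (0 :: _ \<Rightarrow>\<^sub>0 'k)"
        by (subst pure_slot[of _ _ "[]"]) simp
      then show ?thesis using False by simp
    qed
  qed
  also have "\<dots> = bas (trivial (src (hd vs)) # vs @ [trivial (trg (last vs))])"
    using path_in_verts[OF subsetD[OF assms(3) hd_in_set[OF assms(1)]]] by (rule sum_at_vertex)
  finally show ?thesis .
qed

lemma one_tensor_bas:
  assumes "composable (q # vs)" "src q \<in> verts Q"
  shows "one_tensor (bas (q # vs)) = bas (trivial (src q) # q # vs)"
  using pure_one_left[OF assms] by (simp add: one_tensor_def)

lemma gen_eq:
  assumes "w \<in> paths"
  shows "gen w = bas [trivial (src w), w, trivial (trg w)]"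
  using pure_one_one[of "[w]"] assms by (simp add: gen_def)

lemma split_at_eq:
  "split_at T (i, j) = (if segment T 0 i \<in> nonzero_paths \<and> segment T j (plen T) \<in> nonzero_paths
     then pbas [segment T 0 i, segment T i j, segment T j (plen T)] else 0)"
  using pure_bas[of "[segment T 0 i, segment T i j, segment T j (plen T)]"]
  by (auto simp: split_at_def cls_eq pure_zero)

lemma bext_tensor_bas: "bext_tensor \<phi> (bas (p # vs @ [q])) = lact (cls p) (ract (\<phi> vs) (cls q))"
  by (simp add: bext_tensor_def)

lemma bext_A_bas: "bext_A \<phi> (bas (p # vs @ [q])) = cls p \<otimes>\<^bsub>A\<^esub> \<phi> vs \<otimes>\<^bsub>A\<^esub> cls q"
  by (simp add: bext_A_def)

text \<open>
  Basis tensors on which the idempotents at the outer end points \<open>x\<close> and \<open>z\<close> act as the identity.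
\<close>

definition between :: "'a \<Rightarrow> 'a \<Rightarrow> ('a, 'b) qpath list set" where
  "between x z = {p # vs @ [q] | p vs q. composable (p # vs @ [q]) \<and> p \<in> nonzero_paths \<and>
     q \<in> nonzero_paths \<and> src p = x \<and> trg q = z}"

lemma between_act:
  assumes "Poly_Mapping.keys y \<subseteq> between x z" "x \<in> verts Q" "z \<in> verts Q"
  shows "lact (cls (trivial x)) (ract y (cls (trivial z))) = y"
proof -
  have "lact (cls (trivial x)) (ract (bas us) (cls (trivial z))) = (bas us :: _ \<Rightarrow>\<^sub>0 'k)"
    if us: "us \<in> between x z" for us
  proof -
    obtain p vs q where u: "us = p # vs @ [q]" "composable (p # vs @ [q])" "p \<in> nonzero_paths"
      "q \<in> nonzero_paths" "src p = x" "trg q = z" using us by (auto simp: between_def)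
    have "ract (bas us) (cls (trivial z)) = (bas us :: _ \<Rightarrow>\<^sub>0 'k)"
      using u ract_bas[of "p # vs" q "trivial z"] trivial_nonzero[OF assms(3)] by (simp add: cls_eq)
    moreover have "lact (cls (trivial x)) (bas us) = (bas us :: _ \<Rightarrow>\<^sub>0 'k)"
      using u lact_bas[of p "vs @ [q]" "trivial x"] trivial_nonzero[OF assms(2)] by (simp add: cls_eq)
    ultimately show ?thesis by simp
  qed
  then have "lin_ext (\<lambda>us. lact (cls (trivial x)) (ract (bas us) (cls (trivial z)))) y = lin_ext bas y"
    using assms(1) by (intro lin_ext_cong) auto
  then show ?thesis by (simp only: ract_linear[symmetric] lact_linear[symmetric] lin_ext_bas_id)
qed

end

section \<open>The good term of \<open>F\<^sub>n\<close>\<close>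

context monomial_algebra
begin

text \<open>
  One summand of the recursion for \<open>F\<close>: \<open>1 \<otimes> L x R\<close>.
\<close>

definition step :: "('a, 'b) qpath \<Rightarrow> ('a, 'b) qpath \<Rightarrow>
    (('a, 'b) qpath list \<Rightarrow>\<^sub>0 'k) \<Rightarrow> (('a, 'b) qpath list \<Rightarrow>\<^sub>0 'k)" where
  "step L R x = one_tensor (lact (cls L) (ract x (cls R)))"

text \<open>
  The shape of the terms of \<open>F\<^sub>n(1 \<otimes> w \<otimes> 1)\<close>: the left outer factor is trivial, since the recursion
  always puts a new \<open>1\<close> in front, and the other factors cut \<open>w\<close> into pieces.
\<close>

definition splits :: "('a, 'b) qpath \<Rightarrow> nat \<Rightarrow> ('a, 'b) qpath list set" where
  "splits w n = {trivial (src w) # vs @ [b] | vs b. length vs = n \<and> set vs \<subseteq> nonzero_paths \<and>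
     b \<in> nonzero_paths \<and> composable (vs @ [b]) \<and> pconcat (vs @ [b]) = w}"

abbreviation middle :: "('a, 'b) qpath list \<Rightarrow> ('a, 'b) qpath list" where
  "middle us \<equiv> butlast (tl us)"

lemma splits_composable:
  assumes "composable (vs @ [b])" "pconcat (vs @ [b]) = w"
  shows "composable (trivial (src w) # vs @ [b])" "trg b = trg w"
proof -
  have "src (hd (vs @ [b])) = src w" using assms(2) by (metis src_pconcat)
  then show "composable (trivial (src w) # vs @ [b])"
    using assms(1) by (cases vs) auto
  show "trg b = trg w" using trg_pconcat[of "vs @ [b]"] assms by simp
qed

lemma splits_between:
  assumes "w \<in> paths" "us \<in> splits w n" shows "us \<in> between (src w) (trg w)"
proof -
  obtain vs b where "us = trivial (src w) # vs @ [b]" "b \<in> nonzero_paths" "composable (vs @ [b])"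
    "pconcat (vs @ [b]) = w" using assms by (auto simp: splits_def)
  then show ?thesis
    using splits_composable[of vs b w] trivial_nonzero path_in_verts[OF assms(1)]
    unfolding between_def by fastforce
qed

lemma step_linear: "step L R (lin_ext \<phi> x) = lin_ext (\<lambda>v. step L R (\<phi> v)) x"
  by (simp add: step_def ract_linear lact_linear) (simp add: one_tensor_def lin_ext_lin_ext)

lemma one_tensor_zero [simp]: "one_tensor 0 = 0"
  by (simp add: one_tensor_def)

lemma step_bas:
  assumes w: "w \<in> paths" and ij: "i \<le> j" "j \<le> plen w"
    and us: "us \<in> splits (segment w i j) n"
  defines "L \<equiv> segment w 0 i" and "R \<equiv> segment w j (plen w)"
  shows "step L R (bas us) = (if L \<in> nonzero_paths \<and> pcat (last us) R \<in> nonzero_paths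
      then bas (trivial (src w) # L # middle us @ [pcat (last us) R]) else 0)"
    and "L \<in> nonzero_paths \<Longrightarrow> pcat (last us) R \<in> nonzero_paths \<Longrightarrow>
      trivial (src w) # L # middle us @ [pcat (last us) R] \<in> splits w (Suc n)"
proof -
  let ?\<zeta> = "segment w i j"
  obtain vs b where u: "us = trivial (src ?\<zeta>) # vs @ [b]" "length vs = n" "set vs \<subseteq> nonzero_paths"
    "b \<in> nonzero_paths" "composable (vs @ [b])" "pconcat (vs @ [b]) = ?\<zeta>"
    using us by (auto simp: splits_def)
  note c = splits_composable[OF u(5,6)]
  have LR: "L \<in> paths" "R \<in> paths" "trg L = src ?\<zeta>" "src R = trg b" "src L = src w"
    using w ij c(2) by (auto simp: L_def R_def segment_paths trg_segment src_segment)
  have b: "b \<in> paths" using u(4) by (rule nonzero_is_path)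
  have R: "R \<in> nonzero_paths" if "pcat b R \<in> nonzero_paths"
    using nonzero_pcat(2)[OF b LR(2)] LR that by simp
  have r: "ract (bas us) (cls R) =
      (if pcat b R \<in> nonzero_paths then bas (trivial (src ?\<zeta>) # vs @ [pcat b R]) else 0)"
    using ract_bas[of "trivial (src ?\<zeta>) # vs" b R] c LR R u by (auto simp: cls_eq)
  have c1: "composable (vs @ [pcat b R])"
    using u(5) LR by (cases "vs = []") (auto simp: composable_append)
  have c2: "composable (trivial (src ?\<zeta>) # vs @ [pcat b R])"
    using c(1) c1 by (cases vs) auto
  have c3: "composable (L # vs @ [pcat b R])"
    using c2 LR(3) by (cases vs) auto
  have "lact (cls L) (bas (trivial (src ?\<zeta>) # vs @ [pcat b R])) =
      (if L \<in> nonzero_paths then bas (L # vs @ [pcat b R]) else 0)"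
    using lact_bas[OF c2, of L] LR by (simp add: cls_eq)
  moreover have "one_tensor (bas (L # vs @ [pcat b R])) =
      bas (trivial (src w) # L # vs @ [pcat b R])"
    using one_tensor_bas[OF c3] LR path_in_verts[OF w] by simp
  ultimately show "step L R (bas us) = (if L \<in> nonzero_paths \<and> pcat (last us) R \<in> nonzero_paths
      then bas (trivial (src w) # L # middle us @ [pcat (last us) R]) else 0)"
    unfolding step_def r using u(1) by simp
  have "pconcat ((L # vs) @ [pcat b R]) = pcat L (pcat ?\<zeta> R)"
    unfolding pconcat_snoc using u(6) by (simp add: pconcat_Cons pcat_assoc)
  also have "pcat ?\<zeta> R = segment w i (plen w)" unfolding R_def using w ij by (intro pcat_segment) auto
  also have "pcat L \<dots> = w" unfolding L_def using w ij by (subst pcat_segment) (auto simp: segment_whole)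
  finally show "trivial (src w) # L # middle us @ [pcat (last us) R] \<in> splits w (Suc n)"
    if "L \<in> nonzero_paths" "pcat (last us) R \<in> nonzero_paths"
    unfolding splits_def mem_Collect_eq using u c3 that
    by (intro exI[of _ "L # vs"] exI[of _ "pcat b R"]) auto
qed

lemma F_gen_0: "w \<in> AP 0 \<Longrightarrow> F_gen 0 w = bas [w, w] \<and> w = trivial (src w) \<and> src w \<in> verts Q"
proof -
  assume "w \<in> AP 0"
  then obtain x where x: "w = trivial x" "x \<in> verts Q" by (auto simp: AP_def)
  then have "cls w = (bas w :: _ \<Rightarrow>\<^sub>0 'k)" by (simp add: cls_eq trivial_nonzero)
  then show ?thesis using pure_one_right[of "[]" w] x by simp
qed

lemma F_gen_1: "w \<in> AP 1 \<Longrightarrow> F_gen 1 w = bas [trivial (src w), w, trivial (trg w)]"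
proof -
  assume "w \<in> AP 1"
  then have w: "w \<in> nonzero_paths" by (auto simp: AP_def arrow_nonzero)
  then have "cls w = (bas w :: _ \<Rightarrow>\<^sub>0 'k)" by (simp add: cls_eq)
  then show ?thesis using pure_one_one[of "[w]"] w by (simp add: nonzero_is_path)
qed

definition later_subs :: "('a, 'b) qpath \<Rightarrow> nat \<Rightarrow> (nat \<times> nat) set" where
  "later_subs w n = {\<zeta> \<in> chain_occ w n. \<exists>\<zeta>' \<in> chain_occ w n. fst \<zeta>' < fst \<zeta>}"

lemma F_gen_Suc:
  assumes "w \<in> paths" "1 \<le> n"
  shows "F_gen (Suc n) w = (\<Sum>(i, j) \<in> later_subs w n.
    step (segment w 0 i) (segment w j (plen w)) (F_gen n (segment w i j)))"
  using assms by (cases n) (simp_all add: step_def later_subs_def Sub_def occs_AP)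

lemma chain_occ_bounds: "w \<in> paths \<Longrightarrow> (i, j) \<in> chain_occ w n \<Longrightarrow> i \<le> j \<and> j \<le> plen w"
  using zero_intervals.occ_bounds[OF zero_intervals] .

lemma finite_later_subs: "w \<in> paths \<Longrightarrow> finite (later_subs w n)"
proof -
  assume w: "w \<in> paths"
  have "later_subs w n \<subseteq> {..plen w} \<times> {..plen w}"
    using chain_occ_bounds[OF w] by (fastforce simp: later_subs_def)
  then show ?thesis by (rule finite_subset) simp
qed

lemma chain_occ_AP: "w \<in> paths \<Longrightarrow> (i, j) \<in> chain_occ w n \<Longrightarrow> segment w i j \<in> AP n"
  using occs_AP[of w n] by (auto simp: occs_def)

lemma keys_F_gen:
  assumes "w \<in> AP n" shows "Poly_Mapping.keys (F_gen n w) \<subseteq> splits w n"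
  using assms
proof (induction n arbitrary: w)
  case 0
  then have "F_gen 0 w = bas [w, w]" "w = trivial (src w)" "w \<in> nonzero_paths"
    using F_gen_0[of w] trivial_nonzero[of "src w"] by auto
  moreover have "[trivial (src w), w] \<in> splits w 0"
    unfolding splits_def mem_Collect_eq using \<open>w \<in> nonzero_paths\<close> 
    by (intro exI[of _ "[]"] exI[of _ w]) auto
  ultimately show ?case by (simp del: F_gen.simps)
next
  case (Suc n)
  have w: "w \<in> paths" using Suc.prems AP_iff by blast
  show ?case
  proof (cases n)
    case 0
    then have "w \<in> nonzero_paths" using Suc.prems by (auto simp: AP_def arrow_nonzero)
    moreover have "pconcat ([w] @ [trivial (trg w)]) = w" by (simp add: pconcat_Cons)
    ultimately show ?thesis
      using 0 F_gen_1[of w] Suc.prems trivial_nonzero[of "trg w"] nonzero_verts[of w]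
      unfolding splits_def by fastforce
  next
    case (Suc m)
    have "Poly_Mapping.keys (step (segment w 0 i) (segment w j (plen w)) (F_gen n (segment w i j)))
        \<subseteq> splits w (Suc n)" if ij: "(i, j) \<in> later_subs w n" for i j
    proof -
      have o: "(i, j) \<in> chain_occ w n" using ij by (simp add: later_subs_def)
      have b: "i \<le> j" "j \<le> plen w" using chain_occ_bounds[OF w o] by auto
      have IH: "Poly_Mapping.keys (F_gen n (segment w i j)) \<subseteq> splits (segment w i j) n"
        using Suc.IH chain_occ_AP[OF w o] .
      have "Poly_Mapping.keys (step (segment w 0 i) (segment w j (plen w)) (bas us)) \<subseteq> splits w (Suc n)"
        if "us \<in> splits (segment w i j) n" for us
        using step_bas[OF w b that] by (simp split: if_splits)
      then have "Poly_Mapping.keys (lin_ext (\<lambda>us. step (segment w 0 i) (segment w j (plen w)) (bas us))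
          (F_gen n (segment w i j))) \<subseteq> splits w (Suc n)"
        using keys_lin_ext IH by fastforce
      then show ?thesis by (simp only: step_linear[symmetric] lin_ext_bas_id)
    qed
    then show ?thesis
      using F_gen_Suc[OF w, of n] \<open>n = Suc m\<close> keys_sum_sub by (simp add: case_prod_unfold) fastforce
  qed
qed

definition good_part :: "(('a, 'b) qpath list \<Rightarrow>\<^sub>0 'k) \<Rightarrow> (('a, 'b) qpath list \<Rightarrow>\<^sub>0 'k)" where
  "good_part = lin_ext (\<lambda>us. if good (middle us) then bas us else 0)"

text \<open>
  Prepending a factor changes the parity of the positions, so a new condition appears only when the
  length becomes even.
\<close>

lemma good_Cons:
  assumes "vs \<noteq> []"
  shows "even (length vs) \<Longrightarrow> good (v # vs) \<longleftrightarrow> good vs"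
    and "odd (length vs) \<Longrightarrow> good (v # vs) \<longleftrightarrow> bas (pcat v (hd vs)) \<in> I \<and> good vs"
proof -
  have nth: "(v # vs) ! (2 * j - 1) = vs ! (2 * j - 2)" "(v # vs) ! (2 * j) = vs ! (2 * j - 1)"
    if "1 \<le> j" for j
    using that by (auto simp: nth_Cons' numeral_2_eq_2)
  show "good (v # vs) \<longleftrightarrow> good vs" if "even (length vs)"
    using that nth by (auto simp: good_def M_even_def M_odd_def)
  show "good (v # vs) \<longleftrightarrow> bas (pcat v (hd vs)) \<in> I \<and> good vs" if o: "odd (length vs)"
  proof -
    have "M_odd (v # vs) = {} \<longleftrightarrow> bas (pcat v (hd vs)) \<in> I \<and> M_even vs = {}"
    proof
      assume e: "M_odd (v # vs) = {}"
      have "1 \<notin> M_odd (v # vs)" using e by simp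
      then have "bas (pcat v (hd vs)) \<in> I" using assms by (auto simp: M_odd_def hd_conv_nth Suc_le_eq)
      moreover have "j \<notin> M_even vs" for j
      proof -
        have "Suc j \<notin> M_odd (v # vs)" using e by simp
        then show ?thesis by (auto simp: M_odd_def M_even_def nth_Cons' split: if_splits)
      qed
      ultimately show "bas (pcat v (hd vs)) \<in> I \<and> M_even vs = {}" by auto
    next
      assume a: "bas (pcat v (hd vs)) \<in> I \<and> M_even vs = {}"
      have "j \<notin> M_odd (v # vs)" for j
      proof (cases "j \<le> 1")
        case True
        then show ?thesis using a assms by (cases "j = 1") (auto simp: M_odd_def hd_conv_nth)
      next
        case False
        then obtain i where "j = Suc (Suc i)" by (auto dest!: less_imp_Suc_add simp: not_le)
        moreover have "Suc i \<notin> M_even vs" using a by simp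
        ultimately show ?thesis by (auto simp: M_odd_def M_even_def)
      qed
      then show "M_odd (v # vs) = {}" by auto
    qed
    then show ?thesis using o by (simp add: good_def)
  qed
qed

text \<open>
  A bad term cannot become good by prepending a factor, hence the good part of a summand only depends
  on the good part of the smaller \<open>F\<close>.
\<close>

lemma good_part_step:
  assumes w: "w \<in> paths" and ij: "i \<le> j" "j \<le> plen w" and n: "1 \<le> n"
    and x: "Poly_Mapping.keys x \<subseteq> splits (segment w i j) n"
    and gx: "good_part x = bas (trivial (src (segment w i j)) # vs @ [trivial (trg (segment w i j))])"
    and vs: "length vs = n" "set vs \<subseteq> nonzero_paths" "composable vs" "pconcat vs = segment w i j"
  defines "L \<equiv> segment w 0 i" and "R \<equiv> segment w j (plen w)"
  shows "good_part (step L R x) = 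
    (if good (L # vs) \<and> L \<in> nonzero_paths \<and> R \<in> nonzero_paths
     then bas (trivial (src w) # L # vs @ [R]) else 0)"
proof -
  let ?e = "trivial (trg (segment w i j))"
  define H where "H us = (if good (L # middle us) then step L R (bas us) else 0)" for us
  have seg: "segment w i j \<in> paths" using w ij by (rule segment_paths)
  have us: "good_part (step L R (bas us)) = H us"
    if us: "us \<in> splits (segment w i j) n" for us
    unfolding L_def R_def H_def using step_bas(1)[OF w ij us] by (simp add: good_part_def butlast_append)
  have H0: "H us = 0" if us: "us \<in> splits (segment w i j) n" and ng: "\<not> good (middle us)" for us
  proof -
    have "length (middle us) = n" "middle us \<noteq> []" using us n by (auto simp: splits_def)
    then show ?thesis using good_Cons[of "middle us" L] ng by (auto simp: H_def)
  qed
  have "good_part (step L R x) = good_part (step L R (lin_ext bas x))"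
    by (simp only: lin_ext_bas_id)
  also have "\<dots> = lin_ext (\<lambda>us. good_part (step L R (bas us))) x"
    by (simp only: step_linear good_part_def lin_ext_lin_ext)
  also have "\<dots> = lin_ext (\<lambda>us. if good (middle us) then H us else 0) x"
    using x us H0 by (intro lin_ext_cong) auto
  also have "\<dots> = lin_ext H (good_part x)"
    unfolding good_part_def lin_ext_lin_ext by (intro lin_ext_cong) auto
  also have "\<dots> = H (trivial (src (segment w i j)) # vs @ [?e])"
    using gx by simp
  finally have eq: "good_part (step L R x) = H (trivial (src (segment w i j)) # vs @ [?e])" .
  have ne: "vs \<noteq> []" using vs(1) n by auto
  have t: "trg (last vs) = trg (segment w i j)" using trg_pconcat[OF ne vs(3)] vs(4) by simp
  have "pconcat (vs @ [?e]) = pconcat vs" by (cases vs) (use ne in \<open>auto simp: pconcat_def trivial_def\<close>)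
  then have "trivial (src (segment w i j)) # vs @ [?e] \<in> splits (segment w i j) n"
    unfolding splits_def mem_Collect_eq using vs ne t trivial_nonzero trg_in_verts[OF seg]
    by (intro exI[of _ vs] exI[of _ ?e]) (auto simp: composable_append)
  from step_bas(1)[OF w ij this]
  have "step L R (bas (trivial (src (segment w i j)) # vs @ [?e])) =
      (if L \<in> nonzero_paths \<and> R \<in> nonzero_paths then bas (trivial (src w) # L # vs @ [R]) else 0)"
    using w ij by (simp add: L_def R_def trg_segment src_segment butlast_append)
  then show ?thesis by (simp add: eq H_def butlast_append)
qed

text \<open>
  The induction has to remember, for odd \<open>n\<close>, how long the first factor of the good term is: at the
  next, even stage its product with the prepended factor must lie in \<open>I\<close>, and this selects the summand.
\<close>

lemma F_gen_good:
  assumes "w \<in> AP n" "1 \<le> n"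
  shows "\<exists>vs. length vs = n \<and> set vs \<subseteq> nonzero_paths \<and> composable vs \<and> pconcat vs = w \<and> good vs \<and>
    good_part (F_gen n w) = bas (trivial (src w) # vs @ [trivial (trg w)]) \<and>
    (\<forall>k. n = Suc (2 * k) \<longrightarrow>
       (\<exists>y>0. (y, plen w) \<in> chain_occ w (2 * k) \<and> hd vs = segment w 0 y))"
  using assms
proof (induction n arbitrary: w)
  case (Suc n)
  have w: "w \<in> paths" and whole: "(0, plen w) \<in> chain_occ w (Suc n)"
    using Suc.prems AP_iff by blast+
  interpret zero_intervals "zero_at w" "plen w" using zero_intervals[OF w] .
  have nonzero: "segment w 0 y \<in> nonzero_paths" if "\<not> zero_at w 0 y" "y \<le> plen w" for y
    using that w by (auto simp: nonzero_paths_def zero_at_def segment_paths)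
  have R: "segment w (plen w) (plen w) = trivial (trg w)" "trivial (trg w) \<in> nonzero_paths"
    using w trivial_nonzero trg_in_verts[OF w] by (auto simp: segment_trivial)
  show ?case
  proof (cases "n = 0")
    case True
    have wz: "w \<in> nonzero_paths" using True Suc.prems by (auto simp: AP_def arrow_nonzero)
    have l: "plen w = 1" using True Suc.prems by (auto simp: AP_def plen_arrow)
    have "good [w]" by (simp add: good_def M_even_def)
    moreover have "(1, plen w) \<in> chain_occ w 0" using l occ_iff[of 1 "plen w" 0] pos_0[of 1] pos_1[of 1] by auto
    moreover have "segment w 0 1 = w" using segment_whole[OF w] l by simp
    ultimately show ?thesis
      using True F_gen_1[of w] Suc.prems wz
      by (intro exI[of _ "[w]"]) (auto simp: good_part_def simp del: F_gen.simps intro!: exI[of _ 1])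
  next
    case False
    then have n: "1 \<le> n" by simp
    let ?st = "\<lambda>i j. step (segment w 0 i) (segment w j (plen w)) (F_gen n (segment w i j))"
    have sum: "good_part (F_gen (Suc n) w) = (\<Sum>(i, j)\<in>later_subs w n. good_part (?st i j))"
      by (simp add: F_gen_Suc[OF w n] good_part_def lin_ext_sum case_prod_unfold)
    have IH: "\<exists>vs. length vs = n \<and> set vs \<subseteq> nonzero_paths \<and> composable vs \<and> 
        pconcat vs = segment w i j \<and> good vs \<and>
        good_part (?st i j) =
          (if good (segment w 0 i # vs) \<and> segment w 0 i \<in> nonzero_paths \<and> segment w j (plen w) \<in> nonzero_paths
           then bas (trivial (src w) # segment w 0 i # vs @ [segment w j (plen w)]) else 0) \<and>
        (\<forall>k. n = Suc (2 * k) \<longrightarrow>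
          (\<exists>y>i. (y, j) \<in> chain_occ w (2 * k) \<and> hd vs = segment w i y))"
      if o: "(i, j) \<in> chain_occ w n" for i j
    proof -
      have b: "i \<le> j" "j \<le> plen w" using occ_bounds[OF o] by auto
      have \<zeta>: "segment w i j \<in> AP n" using chain_occ_AP[OF w o] .
      obtain vs where vs: "length vs = n" "set vs \<subseteq> nonzero_paths" "composable vs"
        "pconcat vs = segment w i j" "good vs"
        "good_part (F_gen n (segment w i j)) =
          bas (trivial (src (segment w i j)) # vs @ [trivial (trg (segment w i j))])"
        "\<forall>k. n = Suc (2 * k) \<longrightarrow> (\<exists>y>0. (y, plen (segment w i j)) \<in> chain_occ (segment w i j) (2 * k)
           \<and> hd vs = segment (segment w i j) 0 y)"
        using Suc.IH[OF \<zeta> n] by blast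
      have "\<exists>y>i. (y, j) \<in> chain_occ w (2 * k) \<and> hd vs = segment w i y" if k: "n = Suc (2 * k)" for k
      proof -
        obtain y where y: "0 < y" "(y, j - i) \<in> chain_occ (segment w i j) (2 * k)"
          "hd vs = segment (segment w i j) 0 y" using vs(7) k b by (auto simp: plen_segment)
        have "(i + y, i + (j - i)) \<in> chain_occ w (2 * k)"
          using chain_occ_segment[OF w b, of "j - i" y "2 * k"] y by simp
        then have "(i + y, j) \<in> chain_occ w (2 * k)" using b by simp
        moreover from this have "i + y \<le> j" using occ_bounds by blast
        then have "hd vs = segment w i (i + y)" using y(3) segment_segment[OF w b, of 0 y] by simp
        ultimately show ?thesis using y(1) by (intro exI[of _ "i + y"]) auto
      qed
      then show ?thesis
        using vs good_part_step[OF w b n keys_F_gen[OF \<zeta>] vs(6) vs(1-4)]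
        by (intro exI[of _ vs]) blast
    qed
    have conc: "pconcat (segment w 0 i # vs) = w" "composable (segment w 0 i # vs)"
      if "pconcat vs = segment w i (plen w)" "length vs = n" "i \<le> plen w" "composable vs" for i vs
    proof -
      have ne: "vs \<noteq> []" using that n by auto
      show "pconcat (segment w 0 i # vs) = w"
        using w that by (simp add: pconcat_Cons[OF ne] pcat_segment segment_whole)
      have "src (hd vs) = trg (segment w 0 i)"
        using that w by (metis src_pconcat src_segment trg_segment le0)
      then show "composable (segment w 0 i # vs)" using that ne by (cases vs) auto
    qed
    show ?thesis
    proof (cases "even n")
      case True
      then obtain k where k: "n = 2 * k" by blast
      have "(0, plen w) \<in> occ (Suc (2 * k))" using whole k by simp
      from odd_chain_subs[OF this] obtain y where
        y: "0 < y" "\<not> zero_at w 0 y" "occ n = {(0, (first_end ^^ k) 0), (y, plen w)}" unfolding k .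
      have yo: "(y, plen w) \<in> occ n" using y(3) by simp
      then have yl: "y \<le> plen w" using occ_bounds by blast
      have later_subs: "later_subs w n = {(y, plen w)}" unfolding later_subs_def y(3) using y(1) by auto
      obtain vs where vs: "length vs = n" "set vs \<subseteq> nonzero_paths" "composable vs"
        "pconcat vs = segment w y (plen w)" "good vs" 
        "good_part (?st y (plen w)) =
          (if good (segment w 0 y # vs) \<and> segment w 0 y \<in> nonzero_paths \<and> segment w (plen w) (plen w) \<in> nonzero_paths
           then bas (trivial (src w) # segment w 0 y # vs @ [segment w (plen w) (plen w)]) else 0)"
        using IH[OF yo] by blast
      have "vs \<noteq> []" using vs(1) n by auto
      then have "good (segment w 0 y # vs)" using good_Cons(1)[of vs] vs(1,5) True by simp
      then have "good_part (F_gen (Suc n) w) = bas (trivial (src w) # (segment w 0 y # vs) @ [trivial (trg w)])"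
        using sum later_subs vs(6) R nonzero[OF y(2) yl] by simp
      then show ?thesis
        using vs \<open>good (segment w 0 y # vs)\<close> conc[OF vs(4,1) yl vs(3)] nonzero[OF y(2) yl] y(1) yo k
        by (intro exI[of _ "segment w 0 y # vs"]) auto
    next
      case False
      then obtain k where k: "n = Suc (2 * k)" by (metis oddE Suc_eq_plus1)
      have "(0, plen w) \<in> occ (Suc (Suc (2 * k)))" using whole k by simp
      from even_chain_good_sub[OF this] obtain x where x: "0 < x" "\<not> zero_at w 0 x"
        "(x, plen w) \<in> occ n" "\<exists>z. (0, z) \<in> occ n"
        and iff: "\<forall>x' z y. (x', z) \<in> occ n \<and> (y, z) \<in> occ (2 * k) \<and> x' < y \<longrightarrow>
          (zero_at w 0 y \<longleftrightarrow> x' = x)"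
        unfolding k .
      have xl: "x \<le> plen w" using x(3) occ_bounds by blast
      obtain z where "(0, z) \<in> occ n" using x(4) by blast
      then have xi: "(x, plen w) \<in> later_subs w n"
        using x(1,3) by (auto simp: later_subs_def intro!: bexI[of _ "(0, z)"])
      have good_iff: "good (segment w 0 i # vs) \<longleftrightarrow> i = x"
        if "(i, j) \<in> occ n" "length vs = n" "good vs" "y > i" "(y, j) \<in> occ (2 * k)" "hd vs = segment w i y"
        for i j y vs
      proof -
        have "y \<le> plen w" using occ_bounds that(5) by fastforce
        then have "bas (pcat (segment w 0 i) (hd vs)) \<in> I \<longleftrightarrow> zero_at w 0 y"
          using that w by (simp add: pcat_segment zero_at_def)
        moreover have "vs \<noteq> []" using that(2) n by auto
        ultimately show ?thesis using good_Cons(2)[of vs "segment w 0 i"] that n False iff[rule_format, of i j y] by auto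
      qed
      have zero: "good_part (?st i j) = 0" if ij: "(i, j) \<in> later_subs w n - {(x, plen w)}" for i j
      proof -
        have o: "(i, j) \<in> occ n" using ij by (simp add: later_subs_def)
        have "i \<noteq> x" using ij o x(3) by (auto simp: occ_iff)
        obtain vs y where "length vs = n" "good vs" "y > i" "(y, j) \<in> occ (2 * k)" "hd vs = segment w i y"
         "good_part (?st i j) =
          (if good (segment w 0 i # vs) \<and> segment w 0 i \<in> nonzero_paths \<and> segment w j (plen w) \<in> nonzero_paths
           then bas (trivial (src w) # segment w 0 i # vs @ [segment w j (plen w)]) else 0)"
          using IH[OF o] k by blast
        then show ?thesis using good_iff[OF o] \<open>i \<noteq> x\<close> by simp
      qed
      obtain vs y where vs: "length vs = n" "set vs \<subseteq> nonzero_paths" "composable vs"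
        "pconcat vs = segment w x (plen w)" "good vs"
        "y > x" "(y, plen w) \<in> occ (2 * k)" "hd vs = segment w x y"
        "good_part (?st x (plen w)) =
          (if good (segment w 0 x # vs) \<and> segment w 0 x \<in> nonzero_paths \<and> segment w (plen w) (plen w) \<in> nonzero_paths
           then bas (trivial (src w) # segment w 0 x # vs @ [segment w (plen w) (plen w)]) else 0)"
        using IH[OF x(3)] k by blast
      have g: "good (segment w 0 x # vs)" using good_iff[OF x(3) vs(1,5,6,7,8)] by simp
      have "good_part (F_gen (Suc n) w) = good_part (?st x (plen w))"
        unfolding sum using zero xi finite_later_subs[OF w]
        by (subst sum.remove[OF finite_later_subs[OF w] xi]) (auto intro!: sum.neutral)
      also have "\<dots> = bas (trivial (src w) # (segment w 0 x # vs) @ [trivial (trg w)])"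
        using g vs(9) R nonzero[OF x(2) xl] by simp
      finally have "good_part (F_gen (Suc n) w) =
        bas (trivial (src w) # (segment w 0 x # vs) @ [trivial (trg w)])" .
      moreover have "Suc n \<noteq> Suc (2 * k')" for k' using False by auto
      ultimately show ?thesis
        using vs(1,2) g conc[OF vs(4,1) xl vs(3)] nonzero[OF x(2) xl]
        by (intro exI[of _ "segment w 0 x # vs"] conjI) (simp_all del: F_gen.simps)
    qed
  qed
qed simp

end

section \<open>The composite of \<open>F\<close> and \<open>G\<close>, and the bracket\<close>

lemma lin_ext_fun_minus: "lin_ext (\<lambda>v. \<phi> v - \<psi> v) x = lin_ext \<phi> x - lin_ext \<psi> x"
  by (simp add: lin_ext_def cs.scale_right_diff_distrib sum_subtractf)

lemma lin_ext_fun_cscale: "lin_ext (\<lambda>v. cscale c (\<phi> v)) x = cscale c (lin_ext \<phi> x)"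
  by (simp add: lin_ext_def cs.scale_sum_right mult.commute)

lemma lin_ext_fun_sum: "lin_ext (\<lambda>v. \<Sum>i\<in>S. \<phi> i v) x = (\<Sum>i\<in>S. lin_ext (\<phi> i) x)"
  by (simp add: lin_ext_def cs.scale_sum_right) (rule sum.swap)

lemma keys_sum_subset:
  "(\<And>i. i \<in> T \<Longrightarrow> Poly_Mapping.keys (x i) \<subseteq> S) \<Longrightarrow> Poly_Mapping.keys (\<Sum>i\<in>T. x i) \<subseteq> S"
  by (rule order_trans[OF keys_sum_sub]) (rule UN_least)

lemma keys_lin_ext_subset:
  "(\<And>v. v \<in> Poly_Mapping.keys x \<Longrightarrow> Poly_Mapping.keys (\<phi> v) \<subseteq> S) \<Longrightarrow>
   Poly_Mapping.keys (lin_ext \<phi> x) \<subseteq> S"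
  by (rule order_trans[OF keys_lin_ext]) (rule UN_least)

lemma sum_count_list:
  "(\<Sum>i<length xs. if xs ! i = a then y else 0) = cscale (of_nat (count_list xs a)) y"
proof (induction xs rule: rev_induct)
  case (snoc x xs)
  have "(\<Sum>i<length xs. if (xs @ [x]) ! i = a then y else 0) = (\<Sum>i<length xs. if xs ! i = a then y else 0)"
    by (intro sum.cong) (auto simp: nth_append)
  then show ?case using snoc by (simp add: cs.scale_left_distrib)
qed simp

context pre_digraph
begin

text \<open>
  The derivation of \<open>A\<close> that multiplies each path by its number of arrows \<open>\<alpha>\<close>.
\<close>

definition weight :: "'b \<Rightarrow> (('a, 'b) qpath \<Rightarrow>\<^sub>0 'k::field) \<Rightarrow> (('a, 'b) qpath \<Rightarrow>\<^sub>0 'k)" where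
  "weight \<alpha> = lin_ext (\<lambda>v. cscale (of_nat (arrow_count \<alpha> v)) (bas v))"

lemma pure_cscale: "pure (as @ cscale c a # bs) = cscale c (pure (as @ a # bs))"
  by (subst (1 2) pure_slot) (simp add: lin_ext_cscale)

lemma pconcat_paths:
  "vs \<noteq> [] \<Longrightarrow> composable vs \<Longrightarrow> set vs \<subseteq> paths \<Longrightarrow> pconcat vs \<in> paths"
proof (induction vs rule: induct_list012)
  case (3 x y zs)
  then show ?case by (simp add: pconcat_Cons[of "y # zs"] pcat_paths)
qed auto

end

context monomial_algebra
begin

lemma arg_min_singleton: "arg_min fst (\<lambda>w. w \<in> {p}) = (p :: nat \<times> nat)"
  using arg_min_natI[of "\<lambda>w. w \<in> {p}" p fst] by simp

lemma split_at_whole: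
  assumes "w \<in> paths"
  shows "split_at w (0, plen w) = bas [trivial (src w), w, trivial (trg w)]"
  using assms trivial_nonzero trg_in_verts[OF assms] path_in_verts[OF assms]
  by (auto simp: split_at_eq segment_trivial segment_whole pbas_def)

lemma G_gen_bad: "vs \<noteq> [] \<Longrightarrow> \<not> good vs \<Longrightarrow> G_gen vs = 0"
  by (cases "length vs = 1") (auto simp: G_gen_def good_def M_even_def)

lemma G_bas: "G (bas (p # vs @ [q])) = lact (cls p) (ract (G_gen vs) (cls q))"
  by (simp add: G_def bext_tensor_bas)

lemma G_linear: "G (lin_ext \<phi> x) = lin_ext (\<lambda>v. G (\<phi> v)) x"
  by (simp add: G_def bext_tensor_def lin_ext_lin_ext)

lemma triple_between:
  assumes "p \<in> nonzero_paths" "r \<in> nonzero_paths" "composable [p, q, r]"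
  shows "[p, q, r] \<in> between (src p) (trg r)"
  unfolding between_def mem_Collect_eq using assms by (intro exI[of _ p] exI[of _ "[q]"] exI[of _ r]) auto

text \<open>
  The factors of the good term multiply to \<open>w\<close>, and no proper subpath of \<open>w\<close> is in \<open>AP\<^sub>n\<close>, so
  that \<open>\<chi>\<close> is a singleton.  In odd degree the occurrence at position \<open>0\<close> also has to lie in the first
  factor, which is why that factor must not be trivial.
\<close>

lemma G_good_term:
  assumes w: "w \<in> AP n" and n: "1 \<le> n" and vs: "length vs = n" "pconcat vs = w" "good vs"
    and y: "odd n \<Longrightarrow> 0 < plen (hd vs)"
  shows "G (bas (trivial (src w) # vs @ [trivial (trg w)])) = gen w"
proof -
  have p: "w \<in> paths" "(0, plen w) \<in> chain_occ w n" using w AP_iff by auto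
  have "G_gen vs = split_at w (0, plen w)"
  proof (cases "n = 1")
    case True
    then have "vs = [w]" using vs by (cases vs) auto
    moreover have "plen w = 1" using w True by (auto simp: AP_def plen_arrow)
    ultimately show ?thesis by (simp add: G_gen_def)
  next
    case False
    have chi: "chi vs = {(0, plen w)}"
      using zero_intervals.occ_whole_unique[OF zero_intervals[OF p(1)] p(2)] vs(1,2) p(1)
      by (simp add: chi_def occs_AP)
    have len: "length vs \<noteq> 0" "length vs \<noteq> 1" using vs(1) False n by auto
    show ?thesis
    proof (cases "even n")
      case True
      then show ?thesis
        using vs len chi by (simp only: G_gen_def arg_min_singleton) simp
    next
      case False
      have "{p \<in> chi vs. 0 \<le> fst p \<and> fst p < plen (hd vs)} = {(0, plen w)}"
        unfolding chi using y[OF False] by force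
      then show ?thesis
        using vs len chi False by (simp only: G_gen_def) simp
    qed
  qed
  then have "G_gen vs = bas [trivial (src w), w, trivial (trg w)]" using split_at_whole p by simp
  moreover have "Poly_Mapping.keys (bas [trivial (src w), w, trivial (trg w)] :: _ \<Rightarrow>\<^sub>0 'k) \<subseteq> between (src w) (trg w)"
    using triple_between[of "trivial (src w)" "trivial (trg w)" w] p
    by (simp add: trivial_nonzero path_in_verts trg_in_verts)
  ultimately show ?thesis
    using p by (simp add: G_bas between_act path_in_verts trg_in_verts gen_eq)
qed

lemma G_F_gen:
  assumes w: "w \<in> AP n" shows "G (F_gen n w) = gen w"
proof (cases "n = 0")
  case True
  then have F: "F_gen 0 w = bas ([] @ w # [] @ [w])" "w = trivial (src w)" "src w \<in> verts Q"
    using F_gen_0[of w] w by auto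
  have "lact (cls w) (ract (gen (trivial x)) (cls w)) = (if x = src w then gen w else 0)"
    if "x \<in> verts Q" for x
  proof -
    have g: "gen (trivial x) = bas [trivial x, trivial x, trivial x]"
      using that by (simp add: gen_eq)
    have r: "ract (bas ([trivial x, trivial x] @ [trivial x])) (bas (trivial (src w))) =
        (if x = src w then bas ([trivial x, trivial x] @ [trivial x]) else (0 :: _ \<Rightarrow>\<^sub>0 'k))"
      by (subst ract_bas) (auto simp: trivial_nonzero that F(3))
    have l: "lact (bas (trivial (src w))) (bas (trivial x # [trivial x, trivial x])) =
        (if x = src w then bas (trivial x # [trivial x, trivial x]) else (0 :: _ \<Rightarrow>\<^sub>0 'k))"
      by (subst lact_bas) (auto simp: trivial_nonzero that F(3))
    have c: "cls w = (bas (trivial (src w)) :: _ \<Rightarrow>\<^sub>0 'k)"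
      using F(2) trivial_nonzero[OF F(3)] by (simp add: cls_eq)
    have gw: "gen w = bas [trivial (src w), trivial (src w), trivial (src w)]"
      using gen_eq[of "trivial (src w)"] F(2,3) by (metis src_trivial trg_trivial trivial_paths)
    show ?thesis unfolding c g gw using r l by auto
  qed
  then have "lact (cls w) (ract (G_gen []) (cls w)) = (\<Sum>x\<in>verts Q. if x = src w then gen w else 0)"
    by (simp add: G_gen_def lact_def ract_def lin_ext_sum del: sum.delta sum.delta')
  also have "\<dots> = gen w" using F(3) by simp
  finally have "lact (cls w) (ract (G_gen []) (cls w)) = gen w" .
  moreover have "G (F_gen 0 w) = lact (cls w) (ract (G_gen []) (cls w))"
    using G_bas[of w "[]" w] F(1) by simp
  ultimately show ?thesis using True by simp
next
  case False
  then have n: "1 \<le> n" by simp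
  have p: "w \<in> paths" using w AP_iff by blast
  obtain vs where vs: "length vs = n" "pconcat vs = w" "good vs"
    "good_part (F_gen n w) = bas (trivial (src w) # vs @ [trivial (trg w)])"
    "\<forall>k. n = Suc (2 * k) \<longrightarrow> (\<exists>y>0. (y, plen w) \<in> chain_occ w (2 * k) \<and> hd vs = segment w 0 y)"
    using F_gen_good[OF w n] by blast
  have "0 < plen (hd vs)" if "odd n"
  proof -
    obtain k where "n = Suc (2 * k)" using \<open>odd n\<close> by (metis oddE Suc_eq_plus1)
    then obtain y where y: "0 < y" "(y, plen w) \<in> chain_occ w (2 * k)" "hd vs = segment w 0 y" using vs(5) by blast
    have "y \<le> plen w" using chain_occ_bounds[OF p y(2)] by simp
    then show ?thesis using y by (simp add: plen_segment)
  qed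
  note G = G_good_term[OF w n vs(1-3) this]
  have bad: "G (bas us) = 0" if us: "us \<in> splits w n" "\<not> good (middle us)" for us
  proof -
    obtain us' b where u: "us = trivial (src w) # us' @ [b]" "length us' = n" using us by (auto simp: splits_def)
    then have "G_gen us' = 0" using us n by (intro G_gen_bad) auto
    then show ?thesis using u by (simp add: G_bas)
  qed
  have "G (F_gen n w) = G (lin_ext bas (F_gen n w))" by (simp only: lin_ext_bas_id)
  also have "\<dots> = lin_ext (\<lambda>us. G (if good (middle us) then bas us else 0)) (F_gen n w)"
    unfolding G_linear using keys_F_gen[OF w] bad by (intro lin_ext_cong) (auto simp: G_def bext_tensor_def)
  also have "\<dots> = G (good_part (F_gen n w))" by (simp only: good_part_def G_linear)
  finally show ?thesis using vs(4) G by simp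
qed

lemma F_eq:
  assumes "w \<in> AP n" shows "F n (gen w) = F_gen n w"
proof -
  have p: "w \<in> paths" using assms AP_iff by blast
  have "F n (gen w) = lact (cls (trivial (src w))) (ract (F_gen n w) (cls (trivial (trg w))))"
    using bext_tensor_bas[of _ "trivial (src w)" "[w]" "trivial (trg w)"] by (simp add: F_def gen_eq[OF p])
  also have "\<dots> = F_gen n w"
    using keys_F_gen[OF assms] splits_between[OF p] p
    by (intro between_act) (auto simp: path_in_verts trg_in_verts)
  finally show ?thesis .
qed

text \<open>
  The basis of \<open>A \<otimes> kAP\<^sub>n \<otimes> A\<close>.
\<close>

definition triples :: "nat \<Rightarrow> ('a, 'b) qpath list set" where
  "triples n = {[p, q, r] | p q r. p \<in> nonzero_paths \<and> q \<in> AP n \<and> r \<in> nonzero_paths \<and> composable [p, q, r]}"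

lemma triplesI:
  "p \<in> nonzero_paths \<Longrightarrow> q \<in> AP n \<Longrightarrow> r \<in> nonzero_paths \<Longrightarrow> composable [p, q, r] \<Longrightarrow>
   [p, q, r] \<in> triples n"
  unfolding triples_def by blast

lemma bardzell_iff: "x \<in> bardzell n \<longleftrightarrow> Poly_Mapping.keys x \<subseteq> triples n"
proof -
  have "{vs \<in> listset [nonzero_paths, AP n, nonzero_paths]. composable vs} = triples n"
    by (auto simp: triples_def set_Cons_def)
  then show ?thesis by (simp add: bardzell_def tensor_def)
qed

lemma lact_bardzell:
  assumes "x \<in> bardzell n" shows "lact (bas p) x \<in> bardzell n"
proof -
  have "lact (bas p) (bas us) \<in> bardzell n" if "us \<in> triples n" for us
  proof -
    obtain q w r where u: "us = [q, w, r]" "q \<in> nonzero_paths" "w \<in> AP n" "r \<in> nonzero_paths"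
      "composable [q, w, r]" using \<open>us \<in> triples n\<close> unfolding triples_def by blast
    then show ?thesis
      using lact_bas[OF u(5), of p] by (simp add: bardzell_iff triplesI)
  qed
  then have "Poly_Mapping.keys (lin_ext (\<lambda>us. lact (bas p) (bas us)) x) \<subseteq> triples n"
    using assms unfolding bardzell_iff by (intro keys_lin_ext_subset) blast
  then show ?thesis by (simp add: bardzell_iff flip: lact_linear) (simp add: lin_ext_bas_id)
qed

lemma ract_bardzell:
  assumes "x \<in> bardzell n" shows "ract x (bas b) \<in> bardzell n"
proof -
  have "ract (bas us) (bas b) \<in> bardzell n" if "us \<in> triples n" for us
  proof -
    obtain q w r where u: "us = [q, w, r]" "q \<in> nonzero_paths" "w \<in> AP n" "r \<in> nonzero_paths"
      "composable [q, w, r]" using \<open>us \<in> triples n\<close> unfolding triples_def by blast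
    then show ?thesis
      using ract_bas[of "[q, w]" r b] by (simp add: bardzell_iff triplesI)
  qed
  then have "Poly_Mapping.keys (lin_ext (\<lambda>us. ract (bas us) (bas b)) x) \<subseteq> triples n"
    using assms unfolding bardzell_iff by (intro keys_lin_ext_subset) blast
  then show ?thesis by (simp add: bardzell_iff flip: ract_linear) (simp add: lin_ext_bas_id)
qed

lemma segment_nonzero:
  assumes "v \<in> nonzero_paths" "i \<le> j" "j \<le> plen v"
  shows "segment v i j \<in> nonzero_paths"
proof -
  have v: "v \<in> paths" "bas v \<notin> I" using assms(1) by (auto simp: nonzero_paths_def)
  interpret zero_intervals "zero_at v" "plen v" using zero_intervals[OF v(1)] .
  have "\<not> zero_at v 0 (plen v)" using v by (simp add: zero_at_def segment_whole)
  then have "\<not> zero_at v i j" using Z_mono[of i j 0 "plen v"] assms(3) by auto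
  then show ?thesis using assms(2,3) v by (simp add: zero_at_def nonzero_paths_def segment_paths)
qed

lemma keys_split_at:
  assumes T: "T \<in> paths" and o: "(i, j) \<in> occs (AP n) T"
  shows "Poly_Mapping.keys (split_at T (i, j)) \<subseteq> triples n \<inter> between (src T) (trg T)"
proof -
  have b: "i \<le> j" "j \<le> plen T" "segment T i j \<in> AP n" using o by (auto simp: occs_def)
  have "composable [segment T 0 i, segment T i j, segment T j (plen T)]"
    "src (segment T 0 i) = src T" "trg (segment T j (plen T)) = trg T"
    using T b by (auto simp: src_segment trg_segment)
  then show ?thesis
    using b triple_between[of "segment T 0 i" "segment T j (plen T)" "segment T i j"]
    by (auto simp: split_at_eq pbas_def intro!: triplesI)
qed

lemma keys_G_gen:
  assumes vs: "vs \<noteq> []" "composable vs" "set vs \<subseteq> nonzero_paths"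
  shows "Poly_Mapping.keys (G_gen vs) \<subseteq> triples (length vs) \<inter> between (src (hd vs)) (trg (last vs))"
proof -
  let ?T = "pconcat vs" and ?n = "length vs"
  have T: "?T \<in> paths" using vs nonzero_is_path by (intro pconcat_paths) auto
  have ends: "src ?T = src (hd vs)" "trg ?T = trg (last vs)" using vs trg_pconcat by auto
  have K: "Poly_Mapping.keys (split_at ?T p) \<subseteq> triples ?n \<inter> between (src (hd vs)) (trg (last vs))"
    if "p \<in> occs (AP ?n) ?T" for p
    using keys_split_at[OF T, of "fst p" "snd p" ?n] that ends by simp
  show ?thesis
  proof (cases "?n = 1")
    case True
    then obtain v where v: "vs = [v]" by (cases vs) auto
    have "(i, Suc i) \<in> occs (AP ?n) ?T" if "i < plen v" for i
      using segment_arrow[of v i] that T v by (auto simp: occs_def AP_def)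
    then have "Poly_Mapping.keys (\<Sum>i<plen v. split_at v (i, Suc i)) \<subseteq> triples ?n \<inter> between (src (hd vs)) (trg (last vs))"
      using K v by (intro keys_sum_subset) auto
    then show ?thesis using v by (simp add: G_gen_def)
  next
    case False
    have arg_min: "arg_min fst (\<lambda>w. w \<in> chi vs) \<in> chi vs" if "chi vs \<noteq> {}"
      using that arg_min_natI[of "\<lambda>w. w \<in> chi vs" _ fst] by blast
    have "Poly_Mapping.keys (\<Sum>w\<in>W. split_at ?T w) \<subseteq> triples ?n \<inter> between (src (hd vs)) (trg (last vs))"
      if "W \<subseteq> chi vs" for W
      using K that unfolding chi_def by (intro keys_sum_subset) auto
    note sum = this
    have len: "length vs \<noteq> 0" using vs(1) by simp
    consider "\<not> good vs \<or> chi vs = {}" | "good vs" "chi vs \<noteq> {}" "even (length vs)"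
      | "good vs" "chi vs \<noteq> {}" "odd (length vs)" by blast
    then show ?thesis
    proof cases
      case 1
      then have "G_gen vs = 0" using len False by (simp only: G_gen_def if_False if_True)
      then show ?thesis by simp
    next
      case 2
      then have "G_gen vs = split_at ?T (arg_min fst (\<lambda>w. w \<in> chi vs))"
        using len False by (simp only: G_gen_def if_False if_True) simp
      then show ?thesis using K[OF arg_min[OF 2(2), unfolded chi_def]] unfolding chi_def by simp
    next
      case 3
      then have "G_gen vs = (\<Sum>w\<in>{w \<in> chi vs. 0 \<le> fst w \<and> fst w < plen (hd vs)}. split_at ?T w)"
        using len False by (simp only: G_gen_def if_False if_True) simp
      then show ?thesis using sum by simp
    qed
  qed
qed

lemma G_one_one:
  assumes vs: "composable vs" "set vs \<subseteq> nonzero_paths"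
  shows "G (pure (\<one>\<^bsub>A\<^esub> # map bas vs @ [\<one>\<^bsub>A\<^esub>])) = G_gen vs \<and> G_gen vs \<in> bardzell (length vs)"
proof (cases "vs = []")
  case False
  have p: "set vs \<subseteq> paths" using vs nonzero_is_path by auto
  have "G (pure (\<one>\<^bsub>A\<^esub> # map bas vs @ [\<one>\<^bsub>A\<^esub>])) =
      lact (cls (trivial (src (hd vs)))) (ract (G_gen vs) (cls (trivial (trg (last vs)))))"
    by (simp add: pure_one_one[OF False vs(1) p] G_bas)
  also have "\<dots> = G_gen vs"
    using keys_G_gen[OF False vs] hd_in_set[OF False] last_in_set[OF False] p
    by (intro between_act) (auto intro: path_in_verts trg_in_verts)
  finally show ?thesis using keys_G_gen[OF False vs] by (simp add: bardzell_iff)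
next
  case True
  have AP0: "trivial x \<in> AP 0" if "x \<in> verts Q" for x using that by (simp add: AP_def)
  have pure: "pure [\<one>\<^bsub>A\<^esub>, \<one>\<^bsub>A\<^esub>] = (\<Sum>x\<in>verts Q. F_gen 0 (trivial x))"
  proof -
    have "pure [\<one>\<^bsub>A\<^esub>, \<one>\<^bsub>A\<^esub>] = (\<Sum>x\<in>verts Q. pure [bas (trivial x), \<one>\<^bsub>A\<^esub>])"
      using pure_slot[of "[]" "\<one>\<^bsub>A\<^esub>" "[\<one>\<^bsub>A\<^esub>]"] lin_ext_one by simp
    also have "\<dots> = (\<Sum>x\<in>verts Q. F_gen 0 (trivial x))"
      by (intro sum.cong) (auto simp: cls_eq trivial_nonzero)
    finally show ?thesis .
  qed
  have "G (pure [\<one>\<^bsub>A\<^esub>, \<one>\<^bsub>A\<^esub>]) = (\<Sum>x\<in>verts Q. G (F_gen 0 (trivial x)))"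
    unfolding pure by (simp add: G_def bext_tensor_def lin_ext_sum)
  also have "\<dots> = (\<Sum>x\<in>verts Q. gen (trivial x))"
    using AP0 G_F_gen[of _ 0] by (intro sum.cong) (auto simp del: F_gen.simps)
  finally have "G (pure [\<one>\<^bsub>A\<^esub>, \<one>\<^bsub>A\<^esub>]) = G_gen []" by (simp add: G_gen_def)
  moreover have "gen (trivial x) \<in> bardzell 0" if "x \<in> verts Q" for x
    using that AP0[OF that] by (auto simp: gen_eq bardzell_iff trivial_nonzero intro!: triplesI)
  then have "G_gen [] \<in> bardzell 0"
    by (simp add: bardzell_iff G_gen_def keys_sum_subset)
  ultimately show ?thesis using True by simp
qed

lemma delta_linear: "delta \<alpha> (lin_ext \<phi> x) = lin_ext (\<lambda>v. delta \<alpha> (\<phi> v)) x"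
  by (simp add: delta_def bext_A_def lin_ext_lin_ext)

lemma delta_split:
  assumes v: "v \<in> nonzero_paths" and i: "i < plen v"
  shows "delta \<alpha> (split_at v (i, Suc i)) = (if snd v ! i = \<alpha> then bas v else 0)"
proof -
  let ?p = "segment v 0 i" and ?q = "segment v i (Suc i)" and ?r = "segment v (Suc i) (plen v)"
  have p: "v \<in> paths" using v nonzero_is_path by blast
  have nz: "?p \<in> nonzero_paths" "?q \<in> nonzero_paths" "?r \<in> nonzero_paths" "segment v 0 (Suc i) \<in> nonzero_paths"
    using v i by (auto intro!: segment_nonzero)
  have c: "composable [?p, ?q, ?r]" using p i by (auto simp: src_segment trg_segment)
  have q: "?q = arrow (snd v ! i)" using segment_arrow[OF p i] by simp
  have eq: "[?q] = [arrow \<alpha>] \<longleftrightarrow> snd v ! i = \<alpha>" unfolding q by (auto simp: arrow_def)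
  have m: "bas ?p \<otimes>\<^bsub>A\<^esub> bas ?q \<otimes>\<^bsub>A\<^esub> bas ?r = (bas v :: _ \<Rightarrow>\<^sub>0 'k)"
    using p i nz v by (simp add: A_mult_bas src_segment trg_segment pcat_segment segment_whole)
  have "delta \<alpha> (split_at v (i, Suc i)) = delta \<alpha> (bas (?p # [?q] @ [?r]))"
    using nz c by (simp add: split_at_eq pbas_def)
  also have "\<dots> = cls ?p \<otimes>\<^bsub>A\<^esub> (if [?q] = [arrow \<alpha>] then cls (arrow \<alpha>) else 0) \<otimes>\<^bsub>A\<^esub> cls ?r"
    by (simp only: delta_def bext_A_bas)
  also have "\<dots> = (if snd v ! i = \<alpha> then bas v else 0)"
  proof (cases "snd v ! i = \<alpha>")
    case True
    then have "arrow \<alpha> = ?q" using q by simp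
    then show ?thesis using True m nz by (simp add: cls_eq)
  qed (simp only: eq if_False A_mult_zero)
  finally show ?thesis .
qed

lemma delta_G:
  assumes "x \<in> carrier A"
  shows "delta \<alpha> (G (pure [\<one>\<^bsub>A\<^esub>, x, \<one>\<^bsub>A\<^esub>])) = weight \<alpha> x"
proof -
  have *: "delta \<alpha> (G (pure [\<one>\<^bsub>A\<^esub>, bas v, \<one>\<^bsub>A\<^esub>])) = cscale (of_nat (arrow_count \<alpha> v)) (bas v)"
    if v: "v \<in> nonzero_paths" for v
  proof -
    have "G (pure [\<one>\<^bsub>A\<^esub>, bas v, \<one>\<^bsub>A\<^esub>]) = (\<Sum>i<plen v. split_at v (i, Suc i))"
      using G_one_one[of "[v]"] v by (simp add: G_gen_def)
    then have "delta \<alpha> (G (pure [\<one>\<^bsub>A\<^esub>, bas v, \<one>\<^bsub>A\<^esub>])) = (\<Sum>i<plen v. delta \<alpha> (split_at v (i, Suc i)))"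
      by (simp add: delta_def bext_A_def lin_ext_sum)
    also have "\<dots> = (\<Sum>i<length (snd v). if snd v ! i = \<alpha> then bas v else 0)"
      using delta_split[OF v] by (intro sum.cong) (auto simp: plen_def)
    finally show ?thesis by (simp add: sum_count_list arrow_count_def)
  qed
  have "pure [\<one>\<^bsub>A\<^esub>, x, \<one>\<^bsub>A\<^esub>] = lin_ext (\<lambda>v. pure [\<one>\<^bsub>A\<^esub>, bas v, \<one>\<^bsub>A\<^esub>]) x"
    using pure_slot[of "[\<one>\<^bsub>A\<^esub>]" x "[\<one>\<^bsub>A\<^esub>]"] by simp
  then have "delta \<alpha> (G (pure [\<one>\<^bsub>A\<^esub>, x, \<one>\<^bsub>A\<^esub>])) = lin_ext (\<lambda>v. delta \<alpha> (G (pure [\<one>\<^bsub>A\<^esub>, bas v, \<one>\<^bsub>A\<^esub>]))) x"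
    by (simp only: G_linear delta_linear)
  then show ?thesis using assms * by (auto simp: weight_def carrier_A intro!: lin_ext_cong)
qed

text \<open>
  The Leibniz rule; the left factor contributes nothing because it is trivial.
\<close>

lemma weight_sandwich:
  assumes y: "y \<in> carrier A" and b: "b \<in> nonzero_paths" and x: "x \<in> verts Q"
  shows "bas (trivial x) \<otimes>\<^bsub>A\<^esub> weight \<alpha> y \<otimes>\<^bsub>A\<^esub> bas b =
    weight \<alpha> (bas (trivial x) \<otimes>\<^bsub>A\<^esub> y \<otimes>\<^bsub>A\<^esub> bas b) -
    cscale (of_nat (arrow_count \<alpha> b)) (bas (trivial x) \<otimes>\<^bsub>A\<^esub> y \<otimes>\<^bsub>A\<^esub> bas b)"
proof -
  let ?S = "\<lambda>y. bas (trivial x) \<otimes>\<^bsub>A\<^esub> y \<otimes>\<^bsub>A\<^esub> bas b"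
  have lin: "?S (lin_ext \<phi> z) = lin_ext (\<lambda>v. ?S (\<phi> v)) z" for \<phi> :: "_ \<Rightarrow> _ \<Rightarrow>\<^sub>0 'k" and z :: "_ \<Rightarrow>\<^sub>0 'k"
    by (simp add: A_mult lin_ext_lin_ext)
  have "?S (cscale (of_nat (arrow_count \<alpha> v)) (bas v)) =
      weight \<alpha> (?S (bas v)) - cscale (of_nat (arrow_count \<alpha> b)) (?S (bas v))"
    if v: "v \<in> nonzero_paths" for v
    using v x
    by (auto simp: A_mult_cscale A_mult_bas weight_def pcat_arrow_count cs.scale_left_distrib)
  then have "lin_ext (\<lambda>v. ?S (cscale (of_nat (arrow_count \<alpha> v)) (bas v))) y =
      lin_ext (\<lambda>v. weight \<alpha> (?S (bas v)) - cscale (of_nat (arrow_count \<alpha> b)) (?S (bas v))) y"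
    using y by (intro lin_ext_cong) (auto simp: carrier_A)
  also have "\<dots> = weight \<alpha> (?S (lin_ext bas y)) - cscale (of_nat (arrow_count \<alpha> b)) (?S (lin_ext bas y))"
    by (simp only: lin_ext_fun_minus lin_ext_fun_cscale lin weight_def lin_ext_lin_ext)
  finally show ?thesis by (simp only: lin_ext_bas_id lin[symmetric] weight_def)
qed

context
  fixes f n
  assumes f: "f \<in> bimod_maps (bardzell n)"
begin

lemma f_closed: "x \<in> bardzell n \<Longrightarrow> f x \<in> carrier A"
  using f by (simp add: bimod_maps_def)

lemma f_add: "x \<in> bardzell n \<Longrightarrow> y \<in> bardzell n \<Longrightarrow> f (x + y) = f x + f y"
  using f by (simp add: bimod_maps_def)

lemma f_lact: "a \<in> carrier A \<Longrightarrow> x \<in> bardzell n \<Longrightarrow> f (lact a x) = a \<otimes>\<^bsub>A\<^esub> f x"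
  using f by (simp add: bimod_maps_def)

lemma f_ract: "a \<in> carrier A \<Longrightarrow> x \<in> bardzell n \<Longrightarrow> f (ract x a) = f x \<otimes>\<^bsub>A\<^esub> a"
  using f by (simp add: bimod_maps_def)

text \<open>
  Scalars act through the multiples of the unit of \<open>A\<close>, so additive bimodule maps are \<open>k\<close>-linear.
\<close>

lemma f_cscale:
  assumes x: "x \<in> bardzell n" shows "f (cscale c x) = cscale c (f x)"
proof -
  have "lact (cscale c \<one>\<^bsub>A\<^esub>) (bas us) = cscale c (bas us)" if us: "us \<in> triples n" for us
  proof -
    obtain p q r where u: "us = [p, q, r]" "p \<in> nonzero_paths" "composable [p, q, r]" using us by (auto simp: triples_def)
    have "lact (cscale c \<one>\<^bsub>A\<^esub>) (bas us) = pure ([] @ cscale c (bas p) # map bas [q, r])"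
      using u by (simp add: lact_def A_mult_cscale A_one_mult bas_carrier)
    also have "\<dots> = cscale c (pure (map bas us))" unfolding pure_cscale using u by simp
    finally show ?thesis using u unfolding pure_bas by (simp add: pbas_def)
  qed
  then have "lin_ext (\<lambda>us. lact (cscale c \<one>\<^bsub>A\<^esub>) (bas us)) x = lin_ext (\<lambda>us. cscale c (bas us)) x"
    using x by (intro lin_ext_cong) (auto simp: bardzell_iff)
  then have "lact (cscale c \<one>\<^bsub>A\<^esub>) x = cscale c x"
    by (simp only: lact_linear[symmetric] lin_ext_bas_id lin_ext_fun_cscale)
  then show ?thesis
    using f_lact[OF cscale_carrier[OF A_one_closed] x, of c] f_closed[OF x]
    by (simp add: A_mult_cscale A_one_mult)
qed

lemma f_lin_ext:
  assumes "\<And>v. v \<in> Poly_Mapping.keys x \<Longrightarrow> \<phi> v \<in> bardzell n"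
  shows "f (lin_ext \<phi> x) = lin_ext (\<lambda>v. f (\<phi> v)) x"
proof -
  have zero: "0 \<in> bardzell n" by (simp add: bardzell_iff)
  have "f (\<Sum>v\<in>S. cscale (c v) (\<phi> v)) = (\<Sum>v\<in>S. cscale (c v) (f (\<phi> v))) \<and>
      (\<Sum>v\<in>S. cscale (c v) (\<phi> v)) \<in> bardzell n"
    if "finite S" "S \<subseteq> Poly_Mapping.keys x" for S c
    using that
  proof (induction S rule: finite_induct)
    case empty
    then show ?case using zero f_add[OF zero zero] by simp
  next
    case (insert v S)
    have v: "\<phi> v \<in> bardzell n" using insert.prems assms by simp
    then have cv: "cscale (c v) (\<phi> v) \<in> bardzell n" using keys_cscale[of "c v" "\<phi> v"] by (auto simp: bardzell_iff)
    let ?s = "\<Sum>v\<in>S. cscale (c v) (\<phi> v)"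
    have s: "?s \<in> bardzell n" "f ?s = (\<Sum>v\<in>S. cscale (c v) (f (\<phi> v)))" using insert by auto
    have "cscale (c v) (\<phi> v) + ?s \<in> bardzell n"
      using cv s(1) Poly_Mapping.keys_add[of "cscale (c v) (\<phi> v)" ?s] by (auto simp: bardzell_iff)
    then show ?case using insert.hyps f_add[OF cv s(1)] f_cscale[OF v] s(2) by simp
  qed
  from this[OF finite_keys order_refl] show ?thesis by (simp add: lin_ext_def)
qed

lemma bracket_weight:
  assumes w: "w \<in> AP n"
  shows "bracket 1 n (delta \<alpha>) f (gen w) =
    weight \<alpha> (f (gen w)) - cscale (of_nat (arrow_count \<alpha> w)) (f (gen w))"
proof -
  let ?F = "F_gen n w" and ?c = "\<lambda>v. of_nat (arrow_count \<alpha> v) :: 'k"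
  define y where "y us = f (G (bas us))" for us
  have p: "w \<in> paths" using w AP_iff by blast
  have key: "\<exists>vs b. us = trivial (src w) # vs @ [b] \<and> length vs = n \<and> set vs \<subseteq> nonzero_paths \<and>
      b \<in> nonzero_paths \<and> composable vs \<and> arrow_count \<alpha> w = (\<Sum>v\<leftarrow>vs. arrow_count \<alpha> v) + arrow_count \<alpha> b"
    if us: "us \<in> Poly_Mapping.keys ?F" for us
  proof -
    obtain vs b where u: "us = trivial (src w) # vs @ [b]" "length vs = n" "set vs \<subseteq> nonzero_paths"
      "b \<in> nonzero_paths" "composable (vs @ [b])" "pconcat (vs @ [b]) = w"
      using us keys_F_gen[OF w] by (auto simp: splits_def)
    have "composable vs" using u(5) by (cases "vs = []") (auto simp: composable_append)
    moreover have "arrow_count \<alpha> w = (\<Sum>v\<leftarrow>vs. arrow_count \<alpha> v) + arrow_count \<alpha> b"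
      using arrow_count_pconcat[of \<alpha> "vs @ [b]"] u(6) by simp
    ultimately show ?thesis using u by blast
  qed
  have e: "trivial (src w) \<in> nonzero_paths" using p by (simp add: trivial_nonzero path_in_verts)
  have y: "cls (trivial (src w)) \<otimes>\<^bsub>A\<^esub> f (G_gen vs) \<otimes>\<^bsub>A\<^esub> cls b = y (trivial (src w) # vs @ [b])"
      "G_gen vs \<in> bardzell n" "G (bas (trivial (src w) # vs @ [b])) \<in> bardzell n"
    if vs: "length vs = n" "set vs \<subseteq> nonzero_paths" "b \<in> nonzero_paths" "composable vs" for vs b
  proof -
    show g: "G_gen vs \<in> bardzell n" using G_one_one[of vs] vs by simp
    then have r: "ract (G_gen vs) (bas b) \<in> bardzell n" by (rule ract_bardzell)
    then show "G (bas (trivial (src w) # vs @ [b])) \<in> bardzell n"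
      using e vs(3) by (simp add: G_bas cls_eq lact_bardzell)
    have "f (lact (bas (trivial (src w))) (ract (G_gen vs) (bas b))) =
        bas (trivial (src w)) \<otimes>\<^bsub>A\<^esub> (f (G_gen vs) \<otimes>\<^bsub>A\<^esub> bas b)"
      using e vs(3) r g by (simp add: f_lact f_ract bas_carrier)
    also have "\<dots> = bas (trivial (src w)) \<otimes>\<^bsub>A\<^esub> f (G_gen vs) \<otimes>\<^bsub>A\<^esub> bas b"
      using e vs(3) f_closed[OF g] bas_carrier ring.ring_simprules(11)[OF ring_A] by metis
    finally show "cls (trivial (src w)) \<otimes>\<^bsub>A\<^esub> f (G_gen vs) \<otimes>\<^bsub>A\<^esub> cls b = y (trivial (src w) # vs @ [b])"
      using e vs(3) by (simp add: y_def G_bas cls_eq)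
  qed
  have "circ 1 n (delta \<alpha>) f (gen w) = lin_ext (\<lambda>us. weight \<alpha> (y us) - cscale (?c (last us)) (y us)) ?F"
  proof -
    have "circ 1 n (delta \<alpha>) f (gen w) = bar_circ_i 1 n (delta \<alpha> \<circ> G) (f \<circ> G) ?F"
      using F_eq[OF w] by (simp add: circ_def circ_i_def)
    also have "\<dots> = lin_ext (\<lambda>us. weight \<alpha> (y us) - cscale (?c (last us)) (y us)) ?F"
      unfolding bar_circ_i_def bext_A_def
    proof (rule lin_ext_cong)
      fix us assume "us \<in> Poly_Mapping.keys ?F"
      then obtain vs b where u: "us = trivial (src w) # vs @ [b]" "length vs = n" "set vs \<subseteq> nonzero_paths"
        "b \<in> nonzero_paths" "composable vs" using key by blast
      have "delta \<alpha> (G (pure [\<one>\<^bsub>A\<^esub>, f (G (pure (\<one>\<^bsub>A\<^esub> # map bas vs @ [\<one>\<^bsub>A\<^esub>]))), \<one>\<^bsub>A\<^esub>])) = weight \<alpha> (f (G_gen vs))"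
        using G_one_one[OF u(5,3)] u(2) f_closed by (simp add: delta_G)
      then show "cls (hd us) \<otimes>\<^bsub>A\<^esub> (delta \<alpha> \<circ> G) (pure (\<one>\<^bsub>A\<^esub> # map bas (take (1 - 1) (middle us)) @
          (f \<circ> G) (pure (\<one>\<^bsub>A\<^esub> # map bas (take n (drop (1 - 1) (middle us))) @ [\<one>\<^bsub>A\<^esub>])) #
          map bas (drop (1 - 1 + n) (middle us)) @ [\<one>\<^bsub>A\<^esub>])) \<otimes>\<^bsub>A\<^esub> cls (last us) =
        weight \<alpha> (y us) - cscale (?c (last us)) (y us)"
        using u y(1,2)[OF u(2,3,4,5)] e weight_sandwich[OF f_closed, of "G_gen vs" b "src w" \<alpha>] p
        by (simp add: cls_eq path_in_verts)
    qed
    finally show ?thesis .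
  qed
  moreover have "circ n 1 f (delta \<alpha>) (gen w) =
      lin_ext (\<lambda>us. cscale (?c w - ?c (last us)) (y us)) ?F"
  proof -
    have "circ n 1 f (delta \<alpha>) (gen w) = (\<Sum>i=1..n. bar_circ_i i 1 (f \<circ> G) (delta \<alpha> \<circ> G) ?F)"
      using F_eq[OF w] by (simp add: circ_def circ_i_def)
    also have "\<dots> = (\<Sum>i=1..n. lin_ext (\<lambda>us. cscale (?c (us ! i)) (y us)) ?F)"
    proof (rule sum.cong[OF refl])
      fix i assume i: "i \<in> {1..n}"
      show "bar_circ_i i 1 (f \<circ> G) (delta \<alpha> \<circ> G) ?F = lin_ext (\<lambda>us. cscale (?c (us ! i)) (y us)) ?F"
        unfolding bar_circ_i_def bext_A_def
      proof (rule lin_ext_cong)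
        fix us assume "us \<in> Poly_Mapping.keys ?F"
        then obtain vs b where u: "us = trivial (src w) # vs @ [b]" "length vs = n" "set vs \<subseteq> nonzero_paths"
          "b \<in> nonzero_paths" "composable vs" using key by blast
        define v where "v = vs ! (i - 1)"
        have j: "i - 1 < length vs" using i u(2) by auto
        have v: "v \<in> nonzero_paths" "us ! i = v"
          using u j nth_mem[OF j] i by (auto simp: v_def nth_Cons' nth_append)
        have t: "take 1 (drop (i - 1) vs) = [v]" 
          using j by (simp add: v_def take_Suc hd_drop_conv_nth)
        have id: "take (i - 1) vs @ v # drop (i - 1 + 1) vs = vs" using j by (simp add: v_def id_take_nth_drop[symmetric])
        have "delta \<alpha> (G (pure [\<one>\<^bsub>A\<^esub>, bas v, \<one>\<^bsub>A\<^esub>])) = cscale (?c v) (bas v)"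
          using v(1) by (simp add: delta_G bas_carrier weight_def)
        then have "f (G (pure (\<one>\<^bsub>A\<^esub> # map bas (take (i - 1) vs) @
            (delta \<alpha> \<circ> G) (pure (\<one>\<^bsub>A\<^esub> # map bas (take 1 (drop (i - 1) vs)) @ [\<one>\<^bsub>A\<^esub>])) #
            map bas (drop (i - 1 + 1) vs) @ [\<one>\<^bsub>A\<^esub>]))) =
          f (G (pure ((\<one>\<^bsub>A\<^esub> # map bas (take (i - 1) vs)) @ cscale (?c v) (bas v) #
            map bas (drop (i - 1 + 1) vs) @ [\<one>\<^bsub>A\<^esub>])))"
          unfolding t by simp
        also have "\<dots> = f (cscale (?c v) (G (pure (\<one>\<^bsub>A\<^esub> # map bas (take (i - 1) vs @ v # drop (i - 1 + 1) vs) @ [\<one>\<^bsub>A\<^esub>]))))"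
          unfolding pure_cscale by (simp add: G_def bext_tensor_def lin_ext_cscale)
        also have "\<dots> = cscale (?c v) (f (G_gen vs))"
          unfolding id using G_one_one[OF u(5,3)] u(2) f_cscale by simp
        finally show "cls (hd us) \<otimes>\<^bsub>A\<^esub> (f \<circ> G) (pure (\<one>\<^bsub>A\<^esub> # map bas (take (i - 1) (middle us)) @
            (delta \<alpha> \<circ> G) (pure (\<one>\<^bsub>A\<^esub> # map bas (take 1 (drop (i - 1) (middle us))) @ [\<one>\<^bsub>A\<^esub>])) #
            map bas (drop (i - 1 + 1) (middle us)) @ [\<one>\<^bsub>A\<^esub>])) \<otimes>\<^bsub>A\<^esub> cls (last us) =
          cscale (?c (us ! i)) (y us)"
          using u(1) y(1)[OF u(2,3,4,5)] v(2) by (simp add: A_mult_cscale butlast_append)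
      qed
    qed
    also have "\<dots> = lin_ext (\<lambda>us. \<Sum>i=1..n. cscale (?c (us ! i)) (y us)) ?F"
      by (simp add: lin_ext_fun_sum)
    also have "\<dots> = lin_ext (\<lambda>us. cscale (?c w - ?c (last us)) (y us)) ?F"
    proof (rule lin_ext_cong)
      fix us assume "us \<in> Poly_Mapping.keys ?F"
      then obtain vs b where u: "us = trivial (src w) # vs @ [b]" "length vs = n"
        "arrow_count \<alpha> w = (\<Sum>v\<leftarrow>vs. arrow_count \<alpha> v) + arrow_count \<alpha> b" using key by blast
      have "(\<Sum>v\<leftarrow>vs. arrow_count \<alpha> v) = (\<Sum>i<n. arrow_count \<alpha> (vs ! i))"
        using u(2) by (simp add: sum_list_sum_nth atLeast0LessThan)
      also have "\<dots> = (\<Sum>i=1..n. arrow_count \<alpha> (us ! i))"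
        by (rule sum.reindex_bij_witness[of _ "\<lambda>i. i - 1" Suc]) (use u in \<open>auto simp: nth_append\<close>)
      finally have "?c w - ?c (last us) = (\<Sum>i=1..n. ?c (us ! i))" using u by simp
      then show "(\<Sum>i=1..n. cscale (?c (us ! i)) (y us)) = cscale (?c w - ?c (last us)) (y us)"
        by (simp add: cs.scale_sum_left)
    qed
    finally show ?thesis .
  qed
  ultimately have "bracket 1 n (delta \<alpha>) f (gen w) = lin_ext (\<lambda>us. weight \<alpha> (y us) - cscale (?c w) (y us)) ?F"
    by (simp add: bracket_def lin_ext_fun_minus[symmetric] cs.scale_left_diff_distrib)
  also have "\<dots> = weight \<alpha> (lin_ext y ?F) - cscale (?c w) (lin_ext y ?F)"
    by (simp add: lin_ext_fun_minus lin_ext_fun_cscale weight_def lin_ext_lin_ext)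
  \<comment> \<open>Both products were sums over the same terms of \<open>F\<close>, which now reassemble.\<close>
  also have "lin_ext y ?F = f (G (lin_ext bas ?F))"
    unfolding y_def G_linear using key y(3) by (intro f_lin_ext[symmetric]) blast
  also have "G (lin_ext bas ?F) = gen w" by (simp only: lin_ext_bas_id G_F_gen[OF w])
  finally show ?thesis .
qed

end

lemma gen_bardzell: "w \<in> AP n \<Longrightarrow> gen w \<in> bardzell n"
proof -
  assume w: "w \<in> AP n"
  then have "w \<in> paths" using AP_iff by blast
  then show ?thesis
    using w by (auto simp: gen_eq bardzell_iff trivial_nonzero path_in_verts trg_in_verts intro!: triplesI)
qed

end

theorem mainTheorem2:
  fixes Q :: "('a, 'b) pre_digraph"
    and I :: "(('a, 'b) qpath \<Rightarrow>\<^sub>0 'k::field) set"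
    and f :: "(('a, 'b) qpath list \<Rightarrow>\<^sub>0 'k) \<Rightarrow> (('a, 'b) qpath \<Rightarrow>\<^sub>0 'k)"
    and \<alpha> :: 'b and n :: nat and w :: "('a, 'b) qpath"
  assumes "monomial_algebra Q I"
    and "\<And>\<beta>. \<beta> \<in> arcs Q \<Longrightarrow>
           vector_space.dim cscale (quiver_ideal.corner Q I (tail Q \<beta>) (head Q \<beta>)) = 1"
    and "\<alpha> \<in> arcs Q"
    and "f \<in> quiver_ideal.bimod_maps Q I (quiver_ideal.bardzell Q I n)"
    and "w \<in> quiver_ideal.AP Q I n"
  shows
    \<comment> \<open>\<open>C(\<alpha>, x) x\<close> is read as the \<open>k\<close>-linear expression in \<open>x = f(1 \<otimes> w \<otimes> 1)\<close> with value
       \<open>C(\<alpha>, v) v\<close> on the basis \<open>\<P>\<close> of \<open>A\<close>\<close>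
    "quiver_ideal.bracket Q I 1 n (quiver_ideal.delta Q I \<alpha>) f (quiver_ideal.gen Q I w) =
       lin_ext (\<lambda>v. cscale (quiver_ideal.lin_count \<alpha> (quiver_ideal.cls Q I v)
                              - of_nat (pre_digraph.arrow_count \<alpha> w))
                     (quiver_ideal.cls Q I v))
         (f (quiver_ideal.gen Q I w))
     \<and> (f (quiver_ideal.gen Q I w) \<in>
           insert 0 (quiver_ideal.cls Q I ` quiver_ideal.nonzero_paths Q I) \<longrightarrow>
        quiver_ideal.bracket Q I 1 n (quiver_ideal.delta Q I \<alpha>) f (quiver_ideal.gen Q I w) =
          cscale (quiver_ideal.lin_count \<alpha> (f (quiver_ideal.gen Q I w))
                    - of_nat (pre_digraph.arrow_count \<alpha> w))
            (f (quiver_ideal.gen Q I w)))"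
proof -
  interpret monomial_algebra Q I by fact
  let ?x = "f (gen w)" and ?c = "of_nat (arrow_count \<alpha> w) :: 'k"
  have x: "?x \<in> carrier A" using f_closed[OF assms(4)] gen_bardzell[OF assms(5)] by blast
  have count: "lin_count \<alpha> (cls v) = of_nat (arrow_count \<alpha> v)" if "v \<in> nonzero_paths" for v
    using that by (simp add: lin_count_def cls_eq) (simp add: bas_def)
  have "weight \<alpha> ?x - cscale ?c ?x = weight \<alpha> ?x - lin_ext (\<lambda>v. cscale ?c (bas v)) ?x"
    by (simp only: lin_ext_fun_cscale lin_ext_bas_id)
  also have "\<dots> = lin_ext (\<lambda>v. cscale (of_nat (arrow_count \<alpha> v) - ?c) (bas v)) ?x"
    by (simp add: weight_def lin_ext_fun_minus[symmetric] cs.scale_left_diff_distrib)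
  also have "\<dots> = lin_ext (\<lambda>v. cscale (lin_count \<alpha> (cls v) - ?c) (cls v)) ?x"
    using x count by (intro lin_ext_cong) (auto simp: carrier_A cls_eq)
  finally have main: "bracket 1 n (delta \<alpha>) f (gen w) =
      lin_ext (\<lambda>v. cscale (lin_count \<alpha> (cls v) - ?c) (cls v)) ?x"
    using bracket_weight[OF assms(4,5)] by simp
  moreover have "lin_ext (\<lambda>v. cscale (lin_count \<alpha> (cls v) - ?c) (cls v)) ?x = cscale (lin_count \<alpha> ?x - ?c) ?x"
    if "?x \<in> insert 0 (cls ` nonzero_paths)"
    using that by (auto simp: cls_eq)
  ultimately show ?thesis by simp
qed

end
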